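(* Let $\ell>0$ and let $f\in W^{1,2}(0,\ell)$ be complex-valued with $f(x)\neq0$ for all $x\in[0,\ell]$ and $f(0)=1$. Then the kernel $\widehat{K}_f$ satisfies $$\iint_{\mathcal{T}_\ell}f^2(x)\left\{\frac{\partial\widehat{K}_f}{\partial x}\frac{\partial\phi}{\partial x}-\frac{\partial\widehat{K}_f}{\partial t}\frac{\partial\phi}{\partial t}\right\}dx\,dt=0\qquad\forall\phi\in C_0^\infty(\mathcal{T}_\ell),$$ that is, $\widehat{K}_f$ is a weak solution of the hyperbolic equation $\frac{\partial}{\partial x}\left(f^2(x)\frac{\partial\widehat{K}_f(x,t)}{\partial x}\right)=f^2(x)\frac{\partial^2\widehat{K}_f(x,t)}{\partial t^2}$ in $\mathcal{T}_\ell$, satisfying the Goursat conditions $\widehat{K}_f(x,x)=1-\frac1{f(x)}$, $\widehat{K}_f(x,-x)=0$.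
   Context: All functions are complex-valued. $\mathcal{T}_\ell=\{(x,t)\in\mathbb{R}^2: 0\le x\le\ell,\ |t|\le x\}$; $C_0^\infty(\mathcal{T}_\ell)$ denotes smooth functions compactly supported in its interior. The impedance operator is $\mathbf{L}_fv=-\frac1{f^2}(f^2v')'$, $v\in W^{2,2}(0,\ell)$. For $\rho\in\mathbb{C}$, $\widehat{e}_f(\rho,\cdot)\in W^{2,2}(0,\ell)$ is the solution of $\mathbf{L}_fv=\rho^2v$ on $(0,\ell)$ with $v(0)=1$, $v'(0)=i\rho$. $\widehat{K}_f\in L^2(\mathcal{T}_\ell)$ is the kernel with $\widehat K_f(x,\cdot)\in L^2(-x,x)$ and $\widehat{e}_f(\rho,x)=e^{i\rho x}-i\rho\int_{-x}^x\widehat{K}_f(x,t)e^{i\rho t}dt$ for all $\rho\in\mathbb{C}$, $x\in(0,\ell]$ (it exists, is unique up to null sets, and belongs to $C(\overline{\mathcal{T}_\ell})\cap W^{1,2}(\mathcal{T}_\ell)$, so its partial derivatives are weak derivatives in $L^2$). *)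

theory Defs
  imports "HOL-Analysis.Analysis"
begin

section \<open>Test functions\<close>

primrec Ck_function :: "nat \<Rightarrow> ('a::euclidean_space \<Rightarrow> complex) \<Rightarrow> bool" where
  "Ck_function 0 \<phi> \<longleftrightarrow> continuous_on UNIV \<phi>"
| "Ck_function (Suc k) \<phi> \<longleftrightarrow>
     (\<forall>x. \<phi> differentiable (at x)) \<and>
     (\<forall>b. Ck_function k (\<lambda>x. frechet_derivative \<phi> (at x) b))"

definition smooth_function :: "('a::euclidean_space \<Rightarrow> complex) \<Rightarrow> bool" where
  "smooth_function \<phi> \<longleftrightarrow> (\<forall>k. Ck_function k \<phi>)"

text \<open>Elements of \<open>C\<^sub>0\<^sup>\<infinity>(\<Omega>)\<close> are represented by their extension by zero to the whole space.\<close>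

definition test_function :: "'a::euclidean_space set \<Rightarrow> ('a \<Rightarrow> complex) \<Rightarrow> bool" where
  "test_function \<Omega> \<phi> \<longleftrightarrow>
     smooth_function \<phi> \<and> compact (closure {x. \<phi> x \<noteq> 0}) \<and> closure {x. \<phi> x \<noteq> 0} \<subseteq> \<Omega>"

definition partial_deriv :: "'a::euclidean_space \<Rightarrow> ('a \<Rightarrow> complex) \<Rightarrow> 'a \<Rightarrow> complex" where
  "partial_deriv b \<phi> x = frechet_derivative \<phi> (at x) b"

section \<open>Weak derivatives and Sobolev spaces\<close>

definition L2_on :: "'a::euclidean_space set \<Rightarrow> ('a \<Rightarrow> complex) \<Rightarrow> bool" where
  "L2_on \<Omega> u \<longleftrightarrow>
     set_borel_measurable lebesgue \<Omega> u \<and> set_integrable lebesgue \<Omega> (\<lambda>x. (cmod (u x))\<^sup>2)"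

text \<open>\<open>g\<close> is the weak derivative of \<open>u\<close> in direction \<open>b\<close> on the open set \<open>\<Omega>\<close>, both functions
  being square integrable. Functions are representatives of their almost-everywhere classes.\<close>

definition weak_deriv ::
  "'a::euclidean_space set \<Rightarrow> 'a \<Rightarrow> ('a \<Rightarrow> complex) \<Rightarrow> ('a \<Rightarrow> complex) \<Rightarrow> bool" where
  "weak_deriv \<Omega> b u g \<longleftrightarrow> L2_on \<Omega> u \<and> L2_on \<Omega> g \<and>
     (\<forall>\<phi>. test_function \<Omega> \<phi> \<longrightarrow>
        (LINT x:\<Omega>|lebesgue. u x * partial_deriv b \<phi> x) = - (LINT x:\<Omega>|lebesgue. g x * \<phi> x))"

text \<open>\<open>sobolev2 k \<Omega> u\<close> says \<open>u \<in> W\<^sup>k\<^sup>,\<^sup>2(\<Omega>)\<close>.\<close>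

primrec sobolev2 :: "nat \<Rightarrow> 'a::euclidean_space set \<Rightarrow> ('a \<Rightarrow> complex) \<Rightarrow> bool" where
  "sobolev2 0 \<Omega> u \<longleftrightarrow> L2_on \<Omega> u"
| "sobolev2 (Suc k) \<Omega> u \<longleftrightarrow>
     L2_on \<Omega> u \<and> (\<forall>b\<in>Basis. \<exists>g. weak_deriv \<Omega> b u g \<and> sobolev2 k \<Omega> g)"

section \<open>The impedance equation\<close>

text \<open>\<open>h\<close> represents \<open>L\<^sub>f v = - (1 / f\<^sup>2) (f\<^sup>2 v')'\<close> on \<open>(0, l)\<close>.\<close>

definition impedance_op ::
  "real \<Rightarrow> (real \<Rightarrow> complex) \<Rightarrow> (real \<Rightarrow> complex) \<Rightarrow> (real \<Rightarrow> complex) \<Rightarrow> bool" where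
  "impedance_op l f v h \<longleftrightarrow>
     (\<exists>v' w. weak_deriv {0<..<l} 1 v v' \<and>
             weak_deriv {0<..<l} 1 (\<lambda>x. (f x)\<^sup>2 * v' x) w \<and>
             (AE x in lebesgue. x \<in> {0<..<l} \<longrightarrow> h x = - (1 / (f x)\<^sup>2) * w x))"

text \<open>The values at \<open>0\<close> are those of the representatives of \<open>v\<close> and of its weak derivative that are
  continuous on \<open>[0, l]\<close>.\<close>

definition impedance_exp_solution ::
  "real \<Rightarrow> (real \<Rightarrow> complex) \<Rightarrow> complex \<Rightarrow> (real \<Rightarrow> complex) \<Rightarrow> bool" where
  "impedance_exp_solution l f \<rho> v \<longleftrightarrow>
     sobolev2 2 {0<..<l} v \<and> continuous_on {0..l} v \<and>
     impedance_op l f v (\<lambda>x. \<rho>\<^sup>2 * v x) \<and>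
     v 0 = 1 \<and>
     (\<exists>v'. weak_deriv {0<..<l} 1 v v' \<and> continuous_on {0..l} v' \<and> v' 0 = \<i> * \<rho>)"

section \<open>The integral kernel\<close>

definition goursat_triangle :: "real \<Rightarrow> (real \<times> real) set" where
  "goursat_triangle l = {(x, t). 0 \<le> x \<and> x \<le> l \<and> \<bar>t\<bar> \<le> x}"

definition impedance_kernel ::
  "real \<Rightarrow> (complex \<Rightarrow> real \<Rightarrow> complex) \<Rightarrow> (real \<times> real \<Rightarrow> complex) \<Rightarrow> bool" where
  "impedance_kernel l e K \<longleftrightarrow>
     L2_on (goursat_triangle l) K \<and>
     (\<forall>x\<in>{0<..l}. L2_on {-x<..<x} (\<lambda>t. K (x, t))) \<and>
     (\<forall>\<rho>. \<forall>x\<in>{0<..l}. e \<rho> x = exp (\<i> * \<rho> * of_real x)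
        - \<i> * \<rho> * (LINT t:{-x<..<x}|lebesgue. K (x, t) * exp (\<i> * \<rho> * of_real t)))"

end

(* The transform T(rho, x) of K(x, .) is (exp(i rho x) - e(rho, x)) / (i rho). Hence the weak impedance
   equation for e gives, for F = f^2, rho <> 0 and every test function c on (0, l),
     int T(rho, .) ((F c')' + rho^2 F c) = int F' exp(i rho x) c.
   This is the very weak form of the hyperbolic equation for K, tested with c(x) exp(i rho t), plus a
   term on the diagonal t = x. Odd powers of cos (pi s / (4 l)) are finite sums of exponentials
   exp(i rho s) with rho <> 0. Normalised, they are an approximate identity: with
   c(x) = int phi(x, s) exp(- i rho s) ds they yield the very weak equation for every phi, and the
   derivatives are moved onto K by approximating F by smooth functions. With c(x) exp(-+ i rho x) in
   place of c they concentrate on t = +-x and yield first order weak equations for K(x, +-x). Replacing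
   c by c / f turns these into the statement that (K(x, x) - 1) f and K(x, -x) f are constant, and
   K(0, 0) = 0 because e'(rho, 0) = i rho. *)

theory Submission
  imports Defs
begin

text \<open>Since \<open>f\<close> has only a square integrable derivative, \<open>F'\<close> is
  merely integrable, and \<open>F\<close> times a test function is in general no test function.
  Products and quotients with \<open>f\<close> or \<open>F\<close> are therefore reached through
  smooth functions that converge uniformly while their derivatives converge in mean. The equation is
  known for one transform at a time, divided by i rho, so the steps use finite sums over nonzero
  frequencies; odd powers supply these because 2 j - N never vanishes for odd N. On the sides of the
  triangle, c(x) exp(-+ i rho x) works because the terms with rho^2 cancel and a single factor rho
  remains. It differentiates the cosine power, and on [-x, x] the derivative of cos(alpha (t - x))^N
  is a nonnegative kernel whose mass tends to 1 and sits at the end point, while the power itself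
  tends to 0. The two sides differ through the free term: exp(i rho x) exp(- i rho x) = 1 survives
  at t = x, whereas at t = -x it sums to cos(2 alpha x)^N, which tends to 0.\<close>

section \<open>Calculus of smooth functions\<close>

lemma frechet_derivative_eq:
  assumes "(f has_derivative f') (at x)"
  shows "frechet_derivative f (at x) = f'"
  using assms frechet_derivative_at by metis

text \<open>The recursive definition does not list the lower orders. Differentiability gives
  continuity at the bottom, and the induction lifts this through the derivatives.\<close>

lemma Ck_function_SucD: "Ck_function (Suc k) \<phi> \<Longrightarrow> Ck_function k \<phi>"
proof (induction k arbitrary: \<phi>)
  case 0
  then show ?case
    by (auto intro!: differentiable_imp_continuous_within simp: continuous_on_eq_continuous_within)
next
  case (Suc k)
  then show ?case
    by (metis Ck_function.simps(2))
qed

lemma Ck_function_const: "Ck_function k (\<lambda>x. c)"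
proof (induction k arbitrary: c)
  case (Suc k)
  have "frechet_derivative (\<lambda>x::'a. c) (at x) = (\<lambda>b. 0)" for x
    by (rule frechet_derivative_eq) auto
  with Suc show ?case by auto
qed auto

lemma Ck_function_add:
  "Ck_function k \<phi> \<Longrightarrow> Ck_function k \<psi> \<Longrightarrow> Ck_function k (\<lambda>x. \<phi> x + \<psi> x)"
proof (induction k arbitrary: \<phi> \<psi>)
  case (Suc k)
  have "frechet_derivative (\<lambda>x. \<phi> x + \<psi> x) (at x) =
      (\<lambda>b. frechet_derivative \<phi> (at x) b + frechet_derivative \<psi> (at x) b)" for x
    using Suc.prems by (intro frechet_derivative_eq has_derivative_add)
      (auto simp: frechet_derivative_works[symmetric])
  with Suc show ?case by (auto intro!: differentiable_add)
qed (auto intro: continuous_on_add)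

lemma Ck_function_mult:
  "Ck_function k \<phi> \<Longrightarrow> Ck_function k \<psi> \<Longrightarrow> Ck_function k (\<lambda>x. \<phi> x * \<psi> x)"
proof (induction k arbitrary: \<phi> \<psi>)
  case (Suc k)
  have "frechet_derivative (\<lambda>x. \<phi> x * \<psi> x) (at x) =
      (\<lambda>b. \<phi> x * frechet_derivative \<psi> (at x) b + frechet_derivative \<phi> (at x) b * \<psi> x)" for x
    using Suc.prems by (intro frechet_derivative_eq has_derivative_mult)
      (auto simp: frechet_derivative_works[symmetric])
  moreover have "Ck_function k \<phi>" "Ck_function k \<psi>"
    using Suc.prems Ck_function_SucD by blast+
  ultimately show ?case
    using Suc by (auto intro!: differentiable_mult Ck_function_add)
qed (auto intro: continuous_on_mult)

lemma Ck_function_fst: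
  fixes \<phi> :: "'a::euclidean_space \<Rightarrow> complex"
  shows "Ck_function k \<phi> \<Longrightarrow> Ck_function k (\<lambda>z::'a \<times> 'b::euclidean_space. \<phi> (fst z))"
proof (induction k arbitrary: \<phi>)
  case 0
  then show ?case
    by (auto intro!: continuous_on_compose2[of UNIV \<phi>] continuous_intros)
next
  case (Suc k)
  have D: "((\<lambda>z::'a \<times> 'b. \<phi> (fst z)) has_derivative
      (\<lambda>b. frechet_derivative \<phi> (at (fst z)) (fst b))) (at z)" for z
    by (rule has_derivative_compose[of fst fst z UNIV \<phi>])
      (use Suc.prems in \<open>auto intro: derivative_intros simp: frechet_derivative_works[symmetric]\<close>)
  then have "frechet_derivative (\<lambda>z::'a \<times> 'b. \<phi> (fst z)) (at z) =
      (\<lambda>b. frechet_derivative \<phi> (at (fst z)) (fst b))" for z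
    by (rule frechet_derivative_eq)
  moreover have "Ck_function k (\<lambda>z::'a \<times> 'b. frechet_derivative \<phi> (at (fst z)) b)" for b
    using Suc by (intro Suc.IH[of "\<lambda>x. frechet_derivative \<phi> (at x) b"]) auto
  moreover have "(\<lambda>z::'a \<times> 'b. \<phi> (fst z)) differentiable (at z)" for z
    using D differentiable_def by blast
  ultimately show ?case by simp
qed

lemma smooth_function_simps [simp, intro]:
  "smooth_function (\<lambda>x. c)"
  "smooth_function \<phi> \<Longrightarrow> smooth_function \<psi> \<Longrightarrow> smooth_function (\<lambda>x. \<phi> x + \<psi> x)"
  "smooth_function \<phi> \<Longrightarrow> smooth_function \<psi> \<Longrightarrow> smooth_function (\<lambda>x. \<phi> x * \<psi> x)"
  by (simp_all add: smooth_function_def Ck_function_const Ck_function_add Ck_function_mult)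

lemma smooth_function_sum [intro]:
  "(\<And>i. i \<in> A \<Longrightarrow> smooth_function (\<phi> i)) \<Longrightarrow> smooth_function (\<lambda>x. \<Sum>i\<in>A. \<phi> i x)"
  by (induction A rule: infinite_finite_induct) auto

lemma smooth_function_power [intro]:
  "smooth_function \<phi> \<Longrightarrow> smooth_function (\<lambda>x. \<phi> x ^ n)"
  by (induction n) auto

lemma smooth_function_fst:
  "smooth_function \<phi> \<Longrightarrow> smooth_function (\<lambda>z::'a::euclidean_space \<times> 'b::euclidean_space. \<phi> (fst z))"
  by (simp add: smooth_function_def Ck_function_fst)

lemma smooth_function_partial_deriv [simp, intro]:
  "smooth_function \<phi> \<Longrightarrow> smooth_function (partial_deriv b \<phi>)"
  unfolding smooth_function_def partial_deriv_def[abs_def]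
  by (metis Ck_function.simps(2))

lemma smooth_function_differentiable: "smooth_function \<phi> \<Longrightarrow> \<phi> differentiable (at x)"
  by (metis Ck_function.simps(2) smooth_function_def)

lemma smooth_function_has_derivative:
  "smooth_function \<phi> \<Longrightarrow> (\<phi> has_derivative (\<lambda>b. partial_deriv b \<phi> x)) (at x)"
  using smooth_function_differentiable[of \<phi> x]
  by (simp add: frechet_derivative_works partial_deriv_def)

lemma smooth_function_continuous: "smooth_function \<phi> \<Longrightarrow> continuous_on S \<phi>"
  by (metis Ck_function.simps(1) smooth_function_def continuous_on_subset subset_UNIV)

lemma smooth_function_has_vector_derivative:
  fixes \<phi> :: "real \<Rightarrow> complex"
  assumes "smooth_function \<phi>"
  shows "(\<phi> has_vector_derivative partial_deriv 1 \<phi> x) (at x within S)"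
proof -
  have *: "(\<phi> has_derivative (\<lambda>b. partial_deriv b \<phi> x)) (at x)"
    by (rule smooth_function_has_derivative[OF assms])
  then interpret bounded_linear "\<lambda>b. partial_deriv b \<phi> x"
    by (rule has_derivative_bounded_linear)
  have "partial_deriv b \<phi> x = b *\<^sub>R partial_deriv 1 \<phi> x" for b
    using scaleR[of b 1] by simp
  with * have "(\<phi> has_vector_derivative partial_deriv 1 \<phi> x) (at x)"
    unfolding has_vector_derivative_def by (metis (no_types, lifting) ext)
  then show ?thesis by (rule has_vector_derivative_at_within)
qed

lemma partial_deriv_real_eq:
  fixes \<phi> :: "real \<Rightarrow> complex"
  assumes "(\<phi> has_vector_derivative d) (at x)"
  shows "partial_deriv b \<phi> x = b *\<^sub>R d"
  using frechet_derivative_eq[OF assms[unfolded has_vector_derivative_def]]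
  by (simp add: partial_deriv_def)

text \<open>On the line the derivative in direction \<open>b\<close> is \<open>b\<close> times a
  single function, so one formula for \<phi>' controls all directions. This is the induction step
  for every concrete smooth function below.\<close>

lemma Ck_function_of_vector_derivative:
  fixes \<phi> :: "real \<Rightarrow> complex"
  assumes "\<And>x. (\<phi> has_vector_derivative \<phi>' x) (at x)" and "Ck_function k \<phi>'"
  shows "Ck_function (Suc k) \<phi>"
proof -
  have "frechet_derivative \<phi> (at x) b = of_real b * \<phi>' x" for x b
    using partial_deriv_real_eq[OF assms(1)] by (simp add: partial_deriv_def scaleR_conv_of_real)
  moreover have "\<phi> differentiable (at x)" for x
    using assms(1)[of x] by (auto simp: differentiable_def has_vector_derivative_def)
  ultimately show ?thesis
    using assms(2) by (auto intro!: Ck_function_mult Ck_function_const)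
qed

lemma smooth_function_of_vector_derivative:
  fixes \<phi> :: "real \<Rightarrow> complex"
  assumes "\<And>x. (\<phi> has_vector_derivative \<phi>' x) (at x)" and "smooth_function \<phi>'"
  shows "smooth_function \<phi>"
  unfolding smooth_function_def
  using Ck_function_of_vector_derivative[OF assms(1)] assms(2) Ck_function_SucD
  by (metis smooth_function_def)

lemma smooth_function_of_real: "smooth_function (of_real :: real \<Rightarrow> complex)"
  by (rule smooth_function_of_vector_derivative[where \<phi>' = "\<lambda>_. 1"])
    (auto intro!: derivative_eq_intros)

lemma has_vector_derivative_cexp:
  "((\<lambda>x. exp (c * of_real x) :: complex) has_vector_derivative c * exp (c * of_real x)) (at x within S)"
  by (rule has_vector_derivative_real_field) (auto intro!: derivative_eq_intros)

lemma smooth_function_exp: "smooth_function (\<lambda>x::real. exp (c * of_real x) :: complex)"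
proof -
  \<comment> \<open>Each derivative contributes a factor \<open>c\<close>; the free factor
    \<open>d\<close> makes the family closed under differentiation, so that the induction goes
    through.\<close>
  have "Ck_function k (\<lambda>x::real. d * exp (c * of_real x) :: complex)" for k d
  proof (induction k arbitrary: d)
    case (Suc k)
    show ?case
      by (rule Ck_function_of_vector_derivative[where \<phi>' = "\<lambda>x. (d * c) * exp (c * of_real x)"])
        (use Suc[of "d * c"] has_vector_derivative_mult_right[OF has_vector_derivative_cexp, of d c] in
          \<open>simp_all add: mult.assoc\<close>)
  qed (auto intro!: continuous_intros)
  from this[of _ 1] show ?thesis by (simp add: smooth_function_def)
qed

section \<open>Test functions\<close>

lemma test_function_smooth: "test_function \<Omega> \<phi> \<Longrightarrow> smooth_function \<phi>"
  by (simp add: test_function_def)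

lemma compact_closure_subset: "compact S \<Longrightarrow> closure T \<subseteq> S \<Longrightarrow> compact (closure T)"
  using compact_Int_closed[of S "closure T"] by (simp add: inf.absorb2)

lemma test_function_mult:
  assumes "test_function \<Omega> \<phi>" "smooth_function p"
  shows "test_function \<Omega> (\<lambda>x. p x * \<phi> x)"
proof -
  have "closure {x. p x * \<phi> x \<noteq> 0} \<subseteq> closure {x. \<phi> x \<noteq> 0}"
    by (rule closure_mono) auto
  moreover have "smooth_function (\<lambda>x. p x * \<phi> x)"
    using assms by (intro smooth_function_simps) (simp_all add: test_function_def)
  ultimately show ?thesis
    using assms compact_closure_subset[of "closure {x. \<phi> x \<noteq> 0}" "{x. p x * \<phi> x \<noteq> 0}"]
    by (simp add: test_function_def subset_trans)
qed

lemma test_function_zero_outside: "test_function \<Omega> \<phi> \<Longrightarrow> x \<notin> \<Omega> \<Longrightarrow> \<phi> x = 0"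
  using closure_subset[of "{x. \<phi> x \<noteq> 0}"] by (auto simp: test_function_def)

text \<open>Off the closed support \<phi> vanishes on an open set, hence so does its derivative:
  differentiation does not enlarge the support.\<close>

lemma test_function_partial_deriv:
  assumes "test_function \<Omega> \<phi>"
  shows "test_function \<Omega> (partial_deriv b \<phi>)"
proof -
  have "partial_deriv b \<phi> x = 0" if x: "x \<notin> closure {x. \<phi> x \<noteq> 0}" for x
  proof -
    have "(\<phi> has_derivative (\<lambda>b. 0)) (at x)"
    proof (rule has_derivative_transform_within_open[where f="\<lambda>_. 0"])
      show "open (- closure {x. \<phi> x \<noteq> 0})" using closed_closure by (rule open_Compl)
      show "0 = \<phi> y" if "y \<in> - closure {x. \<phi> x \<noteq> 0}" for y
        using that closure_subset[of "{x. \<phi> x \<noteq> 0}"] by auto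
    qed (use x in auto)
    from frechet_derivative_eq[OF this] show ?thesis by (simp add: partial_deriv_def)
  qed
  then have "{x. partial_deriv b \<phi> x \<noteq> 0} \<subseteq> closure {x. \<phi> x \<noteq> 0}" by auto
  then have "closure {x. partial_deriv b \<phi> x \<noteq> 0} \<subseteq> closure {x. \<phi> x \<noteq> 0}"
    by (simp add: closure_minimal)
  then show ?thesis
    using assms compact_closure_subset[of "closure {x. \<phi> x \<noteq> 0}" "{x. partial_deriv b \<phi> x \<noteq> 0}"]
    by (simp add: test_function_def subset_trans)
qed

lemma test_function_bounded:
  assumes "test_function \<Omega> \<phi>"
  obtains B where "B > 0" "\<And>x. cmod (\<phi> x) \<le> B"
proof -
  let ?S = "closure {x. \<phi> x \<noteq> 0}"
  have "compact ?S" "continuous_on ?S \<phi>"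
    using assms smooth_function_continuous by (auto simp: test_function_def)
  then have "bounded (\<phi> ` ?S)"
    by (simp add: compact_continuous_image compact_imp_bounded)
  then obtain B where B: "B > 0" "\<And>x. x \<in> ?S \<Longrightarrow> cmod (\<phi> x) \<le> B"
    unfolding bounded_pos by auto
  have "cmod (\<phi> x) \<le> B" for x
    using B closure_subset[of "{x. \<phi> x \<noteq> 0}"] by (cases "\<phi> x = 0") auto
  with B that show ?thesis by blast
qed

lemma test_function_has_vector_derivative:
  fixes \<phi> :: "real \<Rightarrow> complex"
  shows "test_function \<Omega> \<phi> \<Longrightarrow> (\<phi> has_vector_derivative partial_deriv 1 \<phi> x) (at x within S)"
  by (simp add: smooth_function_has_vector_derivative test_function_smooth)

lemma partial_deriv_mult:
  assumes "smooth_function \<phi>" "smooth_function \<psi>"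
  shows "partial_deriv b (\<lambda>x. \<phi> x * \<psi> x) x = \<phi> x * partial_deriv b \<psi> x + partial_deriv b \<phi> x * \<psi> x"
  using frechet_derivative_eq[OF has_derivative_mult[OF smooth_function_has_derivative[OF assms(1)]
        smooth_function_has_derivative[OF assms(2)]]]
  by (simp add: partial_deriv_def)

lemma partial_deriv_fst:
  assumes "smooth_function \<phi>"
  shows "partial_deriv b (\<lambda>z. \<phi> (fst z)) z = partial_deriv (fst b) \<phi> (fst z)"
proof -
  have "((\<lambda>z. \<phi> (fst z)) has_derivative (\<lambda>b. partial_deriv (fst b) \<phi> (fst z))) (at z)"
    by (rule has_derivative_compose[of fst fst z UNIV \<phi>])
      (auto intro: derivative_intros smooth_function_has_derivative[OF assms])
  from frechet_derivative_eq[OF this] show ?thesis by (simp add: partial_deriv_def)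
qed

lemma partial_deriv_exp:
  "partial_deriv 1 (\<lambda>x::real. exp (c * of_real x) :: complex) x = c * exp (c * of_real x)"
  using partial_deriv_real_eq[OF has_vector_derivative_cexp] by simp

section \<open>A smooth bump\<close>

text \<open>The standard flat function exp(-1/x), divided by powers of x so that derivatives stay
  linear combinations of members of the family.\<close>

definition flat_exp :: "nat \<Rightarrow> real \<Rightarrow> complex" where
  "flat_exp n x = (if x > 0 then of_real (exp (- 1 / x) / x ^ n) else 0)"

lemma flat_exp_tendsto_0: "((\<lambda>x::real. exp (- 1 / x) / x ^ n) \<longlongrightarrow> 0) (at_right 0)"
proof -
  have "((\<lambda>x::real. x ^ n / exp x) \<longlongrightarrow> 0) at_top"
    by (rule tendsto_power_div_exp_0)
  then have "((\<lambda>x::real. inverse x ^ n / exp (inverse x)) \<longlongrightarrow> 0) (at_right 0)"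
    using filterlim_inverse_at_top_right filterlim_compose by fastforce
  moreover have "inverse x ^ n / exp (inverse x) = exp (- 1 / x) / x ^ n" for x :: real
    by (simp add: exp_minus field_simps)
  ultimately show ?thesis by simp
qed

lemma flat_exp_has_vector_derivative:
  "(flat_exp n has_vector_derivative (flat_exp (n + 2) x - of_nat n * flat_exp (n + 1) x)) (at x)"
proof -
  consider "x > 0" | "x < 0" | "x = 0" by linarith
  then show ?thesis
  proof cases
    case 1
    have "((\<lambda>x. of_real (exp (- 1 / x) / x ^ n) :: complex) has_vector_derivative
        of_real (exp (- 1 / x) / x ^ (n + 2) - n * (exp (- 1 / x) / x ^ (n + 1)))) (at x)"
    proof (rule has_vector_derivative_of_real)
      have "((\<lambda>x. exp (- 1 / x) / x ^ n) has_real_derivative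
          exp (- 1 / x) / x ^ (n + 2) - n * (exp (- 1 / x) / x ^ (n + 1))) (at x)"
        using 1 by (auto intro!: derivative_eq_intros simp: power2_eq_square field_simps)
          (cases n; simp add: field_simps)
      then show "((\<lambda>x. exp (- 1 / x) / x ^ n) has_field_derivative
          exp (- 1 / x) / x ^ (n + 2) - n * (exp (- 1 / x) / x ^ (n + 1))) (at x)" .
    qed
    then have "(flat_exp n has_vector_derivative
        of_real (exp (- 1 / x) / x ^ (n + 2) - n * (exp (- 1 / x) / x ^ (n + 1)))) (at x)"
      by (rule has_vector_derivative_transform_within_open[where S = "{0<..}"])
        (use 1 in \<open>auto simp: flat_exp_def\<close>)
    with 1 show ?thesis by (simp add: flat_exp_def)
  next
    case 2
    have "((\<lambda>_. 0 :: complex) has_vector_derivative 0) (at x)" by simp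
    then have "(flat_exp n has_vector_derivative 0) (at x)"
      by (rule has_vector_derivative_transform_within_open[where S = "{..<0}"])
        (use 2 in \<open>auto simp: flat_exp_def\<close>)
    with 2 show ?thesis by (simp add: flat_exp_def)
  next
    case 3
    \<comment> \<open>For y > 0 the difference quotient at 0 is the member of the family with
      exponent n + 1, so \<open>flat_exp_tendsto_0\<close> applies; for y < 0 it is identically
      0.\<close>
    have "((\<lambda>y. flat_exp n y /\<^sub>R y) \<longlongrightarrow> 0) (at_right 0)"
    proof (rule Lim_transform_eventually)
      show "((\<lambda>x. of_real (exp (- 1 / x) / x ^ Suc n) :: complex) \<longlongrightarrow> 0) (at_right 0)"
        using tendsto_of_real[OF flat_exp_tendsto_0[of "Suc n"], where 'a = complex]
        by (simp only: of_real_0)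
      show "\<forall>\<^sub>F x in at_right 0. of_real (exp (- 1 / x) / x ^ Suc n) = flat_exp n x /\<^sub>R x"
        unfolding eventually_at_filter
        by (auto simp: flat_exp_def scaleR_conv_of_real field_simps)
    qed
    moreover have "((\<lambda>y. flat_exp n y /\<^sub>R y) \<longlongrightarrow> 0) (at_left 0)"
      by (rule Lim_transform_eventually[where f = "\<lambda>_. 0"])
        (auto simp: flat_exp_def eventually_at_filter)
    ultimately have "((\<lambda>y. flat_exp n y /\<^sub>R y) \<longlongrightarrow> 0) (at 0)"
      by (simp add: filterlim_split_at)
    then have "((\<lambda>y. norm (flat_exp n y /\<^sub>R y)) \<longlongrightarrow> 0) (at 0)"
      by (rule tendsto_norm_zero)
    then have "((\<lambda>y. norm (flat_exp n y /\<^sub>R norm y)) \<longlongrightarrow> 0) (at 0)" by simp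
    then have "((\<lambda>y. flat_exp n y /\<^sub>R norm y) \<longlongrightarrow> 0) (at 0)"
      by (rule tendsto_norm_zero_cancel)
    then show ?thesis
      using 3 by (simp add: has_vector_derivative_def has_derivative_def flat_exp_def[of _ 0])
  qed
qed

lemma smooth_flat_exp: "smooth_function (flat_exp n)"
proof -
  have "Ck_function k (flat_exp n)" for k n
  proof (induction k arbitrary: n)
    case 0
    show ?case
      using has_vector_derivative_continuous[OF flat_exp_has_vector_derivative]
      by (simp add: continuous_on_eq_continuous_within)
  next
    case (Suc k)
    have "Ck_function k (\<lambda>x. flat_exp (n + 2) x + (- of_nat n) * flat_exp (n + 1) x)"
      by (intro Ck_function_add Ck_function_mult Ck_function_const Suc)
    then show ?case
      using Ck_function_of_vector_derivative[OF flat_exp_has_vector_derivative, of k n] by simp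
  qed
  then show ?thesis by (simp add: smooth_function_def)
qed

lemma smooth_function_affine:
  fixes \<phi> :: "real \<Rightarrow> complex"
  assumes "smooth_function \<phi>"
  shows "smooth_function (\<lambda>x. \<phi> (a * x + b))"
proof -
  have "Ck_function k \<phi> \<Longrightarrow> Ck_function k (\<lambda>x. \<phi> (a * x + b))" for k and \<phi> :: "real \<Rightarrow> complex"
  proof (induction k arbitrary: \<phi>)
    case 0
    then show ?case by (auto intro!: continuous_on_compose2[of UNIV \<phi>] continuous_intros)
  next
    case (Suc k)
    \<comment> \<open>Only k + 1 orders of differentiability are available inside the induction, so
      the lemma for smooth functions is repeated from one derivative.\<close>
    have "(\<phi> has_vector_derivative partial_deriv 1 \<phi> x) (at x)" for x
    proof -
      have *: "(\<phi> has_derivative (\<lambda>b. partial_deriv b \<phi> x)) (at x)"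
        using Suc.prems by (simp add: partial_deriv_def frechet_derivative_works[symmetric])
      then interpret bounded_linear "\<lambda>b. partial_deriv b \<phi> x"
        by (rule has_derivative_bounded_linear)
      have "partial_deriv b \<phi> x = b *\<^sub>R partial_deriv 1 \<phi> x" for b
        using scaleR[of b 1] by simp
      with * show ?thesis
        unfolding has_vector_derivative_def by (metis (no_types, lifting) ext)
    qed
    then have "((\<lambda>x. \<phi> (a * x + b)) has_vector_derivative a *\<^sub>R partial_deriv 1 \<phi> (a * x + b)) (at x)" for x
      by (intro vector_diff_chain_at[unfolded o_def]) (auto intro!: derivative_eq_intros)
    moreover have "Ck_function k (\<lambda>x. of_real a * partial_deriv 1 \<phi> (a * x + b))"
      using Suc by (auto intro!: Ck_function_mult Ck_function_const simp: partial_deriv_def)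
    ultimately show ?case
      by (intro Ck_function_of_vector_derivative) (auto simp: scaleR_conv_of_real)
  qed
  with assms show ?thesis by (simp add: smooth_function_def)
qed

text \<open>One flat function switched on at \<open>a\<close>, times a reflected one switched off at
  \<open>b\<close>.\<close>

lemma exists_bump:
  fixes a b :: real
  assumes "a < b"
  shows "\<exists>\<omega>. smooth_function \<omega> \<and> (\<forall>x. \<omega> x \<noteq> 0 \<longleftrightarrow> a < x \<and> x < b)"
proof (intro exI conjI allI)
  show "smooth_function (\<lambda>x. flat_exp 0 (1 * x + - a) * flat_exp 0 ((-1) * x + b))"
    by (intro smooth_function_simps smooth_function_affine smooth_flat_exp)
  show "flat_exp 0 (1 * x + - a) * flat_exp 0 ((-1) * x + b) \<noteq> 0 \<longleftrightarrow> a < x \<and> x < b" for x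
    by (auto simp: flat_exp_def)
qed

section \<open>Integration\<close>

lemma lmeasurable_box_real [simp]: "{a<..<b::real} \<in> lmeasurable" "{a..b} \<in> lmeasurable"
  using lmeasurable_box[of a b] lmeasurable_cbox[of a b] by simp_all

lemma integrable_mult_bounded:
  fixes h g :: "'a \<Rightarrow> complex"
  assumes "integrable M h" "g \<in> borel_measurable M" "\<And>x. x \<in> space M \<Longrightarrow> cmod (g x) \<le> B"
  shows "integrable M (\<lambda>x. g x * h x)"
proof (rule Bochner_Integration.integrable_bound)
  show "integrable M (\<lambda>x. B * cmod (h x))" using assms by auto
  show "AE x in M. norm (g x * h x) \<le> norm (B * cmod (h x))"
  proof (rule AE_I2)
    fix x assume "x \<in> space M"
    then have "cmod (g x) \<le> B" by (rule assms)
    then have "cmod (g x) * cmod (h x) \<le> B * cmod (h x)" by (rule mult_right_mono) simp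
    also have "\<dots> \<le> norm (B * cmod (h x))" by simp
    finally show "norm (g x * h x) \<le> norm (B * cmod (h x))" by (simp add: norm_mult)
  qed
qed (use assms in auto)

lemma integrable_bounded_finite:
  fixes g :: "'a \<Rightarrow> complex"
  assumes "finite_measure M" "g \<in> borel_measurable M" "\<And>x. x \<in> space M \<Longrightarrow> cmod (g x) \<le> B"
  shows "integrable M g"
  using assms by (intro finite_measure.integrable_const_bound[where B = B]) auto

lemma tendsto_integral_mult_uniform:
  fixes h :: "'a \<Rightarrow> complex"
  assumes unif: "uniform_limit (space M) p F sequentially"
    and p: "\<And>n. p n \<in> borel_measurable M"
    and B: "\<And>x. x \<in> space M \<Longrightarrow> cmod (F x) \<le> B"
    and h: "integrable M h"
  shows "(\<lambda>n. \<integral>x. p n x * h x \<partial>M) \<longlonglongrightarrow> (\<integral>x. F x * h x \<partial>M)"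
proof -
  have pF: "(\<lambda>n. p n x) \<longlonglongrightarrow> F x" if "x \<in> space M" for x
    using assms(1) that by (rule tendsto_uniform_limitI)
  have F: "F \<in> borel_measurable M"
    by (rule borel_measurable_LIMSEQ_metric[OF p pF])
  \<comment> \<open>Closeness within 1 yields the dominating bound B + 1, but only from some index N
    on; hence the shifted sequence below.\<close>
  have "\<forall>\<^sub>F n in sequentially. \<forall>x\<in>space M. dist (p n x) (F x) < 1"
    using assms(1) by (rule uniform_limitD) simp
  then obtain N where N: "\<And>n x. n \<ge> N \<Longrightarrow> x \<in> space M \<Longrightarrow> dist (p n x) (F x) < 1"
    unfolding eventually_sequentially by blast
  have bd: "cmod (p n x) \<le> B + 1" if "n \<ge> N" "x \<in> space M" for n x
    using N[OF that] B[OF that(2)] norm_triangle_ineq2[of "p n x" "F x"] by (simp add: dist_norm)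
  have "(\<lambda>n. \<integral>x. p (n + N) x * h x \<partial>M) \<longlonglongrightarrow> (\<integral>x. F x * h x \<partial>M)"
  proof (rule integral_dominated_convergence[where w = "\<lambda>x. (B + 1) * cmod (h x)"])
    show "AE x in M. (\<lambda>n. p (n + N) x * h x) \<longlonglongrightarrow> F x * h x"
      using pF by (intro AE_I2 tendsto_mult_right LIMSEQ_ignore_initial_segment) auto
    show "AE x in M. norm (p (n + N) x * h x) \<le> (B + 1) * cmod (h x)" for n
      using bd by (intro AE_I2) (auto simp: norm_mult intro!: mult_right_mono)
  qed (use h p F in auto)
  then show ?thesis by (rule LIMSEQ_offset)
qed

text \<open>The factors \<open>h n\<close> may vary without converging, so only the difference of
  the integrals has a limit; a common bound for them suffices.\<close>

lemma tendsto_integral_mult_L1: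
  fixes h :: "nat \<Rightarrow> 'a \<Rightarrow> complex"
  assumes lim: "(\<lambda>n. \<integral>x. cmod (g n x - g0 x) \<partial>M) \<longlonglongrightarrow> 0"
    and g: "\<And>n. integrable M (g n)" "integrable M g0"
    and h: "\<And>n. h n \<in> borel_measurable M" "\<And>n x. x \<in> space M \<Longrightarrow> cmod (h n x) \<le> B"
  shows "(\<lambda>n. (\<integral>x. h n x * g n x \<partial>M) - (\<integral>x. h n x * g0 x \<partial>M)) \<longlonglongrightarrow> 0"
proof (rule Lim_null_comparison)
  have "norm ((\<integral>x. h n x * g n x \<partial>M) - (\<integral>x. h n x * g0 x \<partial>M)) \<le> B * (\<integral>x. cmod (g n x - g0 x) \<partial>M)" for n
  proof -
    have "(\<integral>x. h n x * g n x \<partial>M) - (\<integral>x. h n x * g0 x \<partial>M) = (\<integral>x. h n x * (g n x - g0 x) \<partial>M)"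
      using integrable_mult_bounded[OF g(1) h] integrable_mult_bounded[OF g(2) h]
      by (simp add: algebra_simps Bochner_Integration.integral_diff)
    also have "norm \<dots> \<le> (\<integral>x. norm (h n x * (g n x - g0 x)) \<partial>M)"
      by (rule integral_norm_bound)
    also have "\<dots> \<le> (\<integral>x. B * cmod (g n x - g0 x) \<partial>M)"
    proof (rule integral_mono)
      show "integrable M (\<lambda>x. norm (h n x * (g n x - g0 x)))"
        using integrable_mult_bounded[OF Bochner_Integration.integrable_diff[OF g] h]
        by (rule integrable_norm)
    qed (use g h in \<open>auto simp: norm_mult intro!: mult_right_mono\<close>)
    finally show ?thesis by simp
  qed
  then show "\<forall>\<^sub>F n in sequentially. norm ((\<integral>x. h n x * g n x \<partial>M) - (\<integral>x. h n x * g0 x \<partial>M))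
      \<le> B * (\<integral>x. cmod (g n x - g0 x) \<partial>M)" by simp
  show "(\<lambda>n. B * (\<integral>x. cmod (g n x - g0 x) \<partial>M)) \<longlonglongrightarrow> 0"
    using tendsto_mult_right_zero[OF lim] .
qed

lemma continuous_on_measurable_interval:
  fixes f :: "real \<Rightarrow> complex"
  shows "continuous_on {0..l} f \<Longrightarrow> f \<in> borel_measurable (lebesgue_on {0<..<l})"
  by (rule continuous_imp_measurable_on_sets_lebesgue) (auto intro: continuous_on_subset)

lemma continuous_on_interval_bounded:
  fixes f :: "real \<Rightarrow> complex"
  assumes "continuous_on {0..l} f"
  obtains B where "B > 0" "\<And>x. x \<in> {0..l} \<Longrightarrow> cmod (f x) \<le> B"
  using compact_imp_bounded[OF compact_continuous_image[OF assms]] unfolding bounded_pos by auto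

lemma integrable_continuous_interval:
  fixes f :: "real \<Rightarrow> complex"
  assumes "continuous_on {0..l} f"
  shows "integrable (lebesgue_on {0<..<l}) f"
proof -
  obtain B where "\<And>x. x \<in> {0..l} \<Longrightarrow> cmod (f x) \<le> B"
    using continuous_on_interval_bounded[OF assms] by blast
  then show ?thesis
    using assms by (intro integrable_bounded_finite[where B = B] finite_measure_lebesgue_on
        continuous_on_measurable_interval) auto
qed

lemma integrable_mult_continuous_interval:
  fixes f g :: "real \<Rightarrow> complex"
  assumes "continuous_on {0..l} f" "integrable (lebesgue_on {0<..<l}) g"
  shows "integrable (lebesgue_on {0<..<l}) (\<lambda>x. f x * g x)"
proof -
  obtain B where "\<And>x. x \<in> {0..l} \<Longrightarrow> cmod (f x) \<le> B"
    using continuous_on_interval_bounded[OF assms(1)] by blast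
  then show ?thesis
    using assms by (intro integrable_mult_bounded[where B = B] continuous_on_measurable_interval) auto
qed

text \<open>Weak derivatives are tested on the open interval with the Bochner integral, while the
  fundamental theorem of calculus is applied to the gauge integral on the closed one. The end points
  do not contribute.\<close>

lemma lebesgue_on_interval_eq_integral:
  fixes f :: "real \<Rightarrow> 'a::euclidean_space"
  assumes "integrable (lebesgue_on {a<..<b}) f"
  shows "integral\<^sup>L (lebesgue_on {a<..<b}) f = integral {a..b} f" "f integrable_on {a..b}"
    "f absolutely_integrable_on {a..b}"
proof -
  have "f integrable_on {a<..<b}" by (rule integrable_on_lebesgue_on[OF assms]) simp
  then show "f integrable_on {a..b}"
    by (simp add: integrable_on_open_interval_real)
  show "integral\<^sup>L (lebesgue_on {a<..<b}) f = integral {a..b} f"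
    using lebesgue_integral_eq_integral[OF assms] by (simp add: integral_open_interval_real)
  have "f absolutely_integrable_on {a<..<b}"
    using assms by (simp add: integrable_restrict_space set_integrable_def)
  then show "f absolutely_integrable_on {a..b}"
    using absolutely_integrable_on_open_interval[where f = f and a = a and b = b] by simp
qed

lemma integral_vector_derivative_interval:
  fixes f :: "real \<Rightarrow> complex"
  assumes "0 \<le> l" "\<And>x. x \<in> {0..l} \<Longrightarrow> (f has_vector_derivative f' x) (at x within {0..l})"
    and "continuous_on {0..l} f'"
  shows "(\<integral>x. f' x \<partial>lebesgue_on {0<..<l}) = f l - f 0"
  using fundamental_theorem_of_calculus[OF assms(1,2)] integrable_continuous_interval[OF assms(3)]
  by (simp add: lebesgue_on_interval_eq_integral integral_unique)

lemma test_function_interval_ends: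
  assumes "test_function {0<..<l::real} \<psi>"
  shows "\<psi> 0 = 0" "\<psi> l = 0"
  using test_function_zero_outside[OF assms] by auto

lemma integral_test_function_deriv:
  assumes "0 \<le> l" "test_function {0<..<l::real} \<psi>"
  shows "(\<integral>x. partial_deriv 1 \<psi> x \<partial>lebesgue_on {0<..<l}) = 0"
  using integral_vector_derivative_interval[OF assms(1) test_function_has_vector_derivative[OF assms(2)]]
    assms test_function_interval_ends[OF assms(2)]
  by (simp add: smooth_function_continuous test_function_smooth)

section \<open>Approximation in mean by smooth functions\<close>

text \<open>\<open>measurable_on\<close> means by definition being the limit of continuous functions
  off a negligible set; Lebesgue measurability is translated into it.\<close>

lemma borel_measurable_ae_limit_continuous:
  fixes g :: "'a::euclidean_space \<Rightarrow> 'b::euclidean_space"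
  assumes g: "g \<in> borel_measurable (lebesgue_on S)" and S: "S \<in> sets lebesgue"
  obtains u where "\<And>n. continuous_on UNIV (u n)"
    "AE x in lebesgue_on S. (\<lambda>n. u n x) \<longlonglongrightarrow> g x"
proof -
  have "g measurable_on S"
    using lebesgue_measurable_imp_measurable_on[OF borel_measurable_if_I[OF assms], of UNIV]
    by (simp add: measurable_on_UNIV)
  then obtain N u where N: "negligible N" and u: "\<forall>n. continuous_on UNIV (u n)"
    "\<forall>x. x \<notin> N \<longrightarrow> (\<lambda>n. u n x) \<longlonglongrightarrow> (if x \<in> S then g x else 0)"
    unfolding measurable_on_def by (elim exE conjE)
  have "AE x in lebesgue. x \<notin> N"
    using N unfolding negligible_iff_null_sets by (rule AE_not_in)
  then have "AE x in lebesgue_on S. x \<notin> N"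
    using S by (subst AE_restrict_space_iff) (auto elim: AE_mp)
  then have "AE x in lebesgue_on S. (\<lambda>n. u n x) \<longlonglongrightarrow> g x"
  proof (rule AE_mp, intro AE_I2 impI)
    fix x assume "x \<in> space (lebesgue_on S)" "x \<notin> N"
    then show "(\<lambda>n. u n x) \<longlonglongrightarrow> g x" using u(2)[rule_format, of x] by simp
  qed
  then show thesis by (rule that[OF u(1)[rule_format]])
qed

text \<open>Radial projection onto the closed disc of radius \<open>k\<close>: a truncation that
  preserves continuity and supplies constant bounds for dominated convergence.\<close>

definition clip :: "real \<Rightarrow> complex \<Rightarrow> complex" where
  "clip k z = of_real (k / max k (cmod z)) * z"

lemma norm_clip: "k > 0 \<Longrightarrow> cmod (clip k z) \<le> k"
  by (auto simp: clip_def norm_mult norm_divide field_simps mult_left_mono max_def)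

lemma norm_clip_le: "k > 0 \<Longrightarrow> cmod (clip k z) \<le> cmod z"
  by (auto simp: clip_def norm_mult norm_divide field_simps mult_left_mono max_def)

lemma continuous_on_clip: "k > 0 \<Longrightarrow> continuous_on S (clip k)"
  unfolding clip_def by (intro continuous_intros) (auto simp: max_def)

lemma tendsto_clip: "(\<lambda>n. clip (real (Suc n)) z) \<longlonglongrightarrow> z"
proof (rule tendsto_eventually)
  show "\<forall>\<^sub>F n in sequentially. clip (real (Suc n)) z = z"
  proof (rule eventually_sequentiallyI[of "nat \<lceil>cmod z\<rceil>"])
    fix n assume "nat \<lceil>cmod z\<rceil> \<le> n"
    then have "cmod z \<le> real (Suc n)" by linarith
    then show "clip (real (Suc n)) z = z" by (simp add: clip_def max_def)
  qed
qed

text \<open>Two applications of dominated convergence: truncating \<open>g\<close> at a high level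
  costs little in mean, and the continuous functions that converge to \<open>g\<close> almost
  everywhere, truncated at the same level, are bounded on a set of finite measure.\<close>

lemma continuous_L1_approximation:
  fixes g :: "'a::euclidean_space \<Rightarrow> complex"
  assumes S: "S \<in> lmeasurable" and g: "integrable (lebesgue_on S) g" and e: "e > 0"
  obtains h where "continuous_on UNIV h" "integrable (lebesgue_on S) h"
    "(\<integral>x. cmod (h x - g x) \<partial>lebesgue_on S) < e"
proof -
  let ?M = "lebesgue_on S"
  interpret finite_measure ?M by (rule finite_measure_lebesgue_on[OF S])
  have Ss: "S \<in> sets lebesgue" using S by (rule fmeasurableD)
  have clipm: "clip k \<in> borel_measurable borel" if "k > 0" for k
    by (rule borel_measurable_continuous_onI[OF continuous_on_clip[OF that]])
  have gm: "g \<in> borel_measurable ?M" using g by auto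
  have "(\<lambda>n. \<integral>x. cmod (clip (real (Suc n)) (g x) - g x) \<partial>?M) \<longlonglongrightarrow> (\<integral>x. 0 \<partial>?M)"
  proof (rule integral_dominated_convergence[where w = "\<lambda>x. 2 * cmod (g x)"])
    show "AE x in ?M. (\<lambda>n. cmod (clip (real (Suc n)) (g x) - g x)) \<longlonglongrightarrow> 0"
      using tendsto_clip by (intro AE_I2 tendsto_norm_zero) (simp only: LIM_zero_iff)
    show "AE x in ?M. norm (cmod (clip (real (Suc n)) (g x) - g x)) \<le> 2 * cmod (g x)" for n
    proof (rule AE_I2)
      fix x
      show "norm (cmod (clip (real (Suc n)) (g x) - g x)) \<le> 2 * cmod (g x)"
        using norm_triangle_ineq4[of "clip (real (Suc n)) (g x)" "g x"]
          norm_clip_le[of "real (Suc n)" "g x"] by simp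
    qed
    show "(\<lambda>x. cmod (clip (real (Suc n)) (g x) - g x)) \<in> borel_measurable ?M" for n
      using measurable_compose[OF gm clipm[of "real (Suc n)"]] gm by simp
  qed (use g in auto)
  then have "\<forall>\<^sub>F n in sequentially. (\<integral>x. cmod (clip (real (Suc n)) (g x) - g x) \<partial>?M) < e / 2"
    using e by (intro order_tendstoD(2)) auto
  then obtain k where k: "k > 0" and ke: "(\<integral>x. cmod (clip k (g x) - g x) \<partial>?M) < e / 2"
    unfolding eventually_sequentially by (metis le_refl of_nat_0_less_iff zero_less_Suc)
  obtain u where u: "\<And>n. continuous_on UNIV (u n)" "AE x in ?M. (\<lambda>n. u n x) \<longlonglongrightarrow> g x"
    using borel_measurable_ae_limit_continuous[OF gm Ss] by blast
  have cu: "continuous_on UNIV (\<lambda>x. clip k (u n x))" for n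
    using continuous_on_compose2[OF continuous_on_clip[OF k, of UNIV] u(1)] by simp
  have cum: "(\<lambda>x. clip k (u n x)) \<in> borel_measurable ?M" for n
    using cu continuous_imp_measurable_on_sets_lebesgue[OF _ Ss] continuous_on_subset by blast
  have cg: "(\<lambda>x. clip k (g x)) \<in> borel_measurable ?M"
    using measurable_compose[OF gm clipm[OF k]] .
  have "(\<lambda>n. \<integral>x. cmod (clip k (u n x) - clip k (g x)) \<partial>?M) \<longlonglongrightarrow> (\<integral>x. 0 \<partial>?M)"
  proof (rule integral_dominated_convergence[where w = "\<lambda>x. 2 * k"])
    show "AE x in ?M. (\<lambda>n. cmod (clip k (u n x) - clip k (g x))) \<longlonglongrightarrow> 0"
      using u(2)
    proof (rule AE_mp, intro AE_I2 impI)
      fix x assume "(\<lambda>n. u n x) \<longlonglongrightarrow> g x"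
      then have "(\<lambda>n. clip k (u n x)) \<longlonglongrightarrow> clip k (g x)"
        using continuous_on_tendsto_compose[OF continuous_on_clip[OF k, of UNIV]] by auto
      then show "(\<lambda>n. cmod (clip k (u n x) - clip k (g x))) \<longlonglongrightarrow> 0"
        by (intro tendsto_norm_zero) (simp only: LIM_zero_iff)
    qed
    show "AE x in ?M. norm (cmod (clip k (u n x) - clip k (g x))) \<le> 2 * k" for n
    proof (rule AE_I2)
      fix x
      show "norm (cmod (clip k (u n x) - clip k (g x))) \<le> 2 * k"
        using norm_triangle_ineq4[of "clip k (u n x)" "clip k (g x)"]
          norm_clip[OF k, of "u n x"] norm_clip[OF k, of "g x"] by simp
    qed
  qed (use cum cg in auto)
  then have "\<forall>\<^sub>F n in sequentially. (\<integral>x. cmod (clip k (u n x) - clip k (g x)) \<partial>?M) < e / 2"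
    using e by (intro order_tendstoD(2)) auto
  then obtain n where n: "(\<integral>x. cmod (clip k (u n x) - clip k (g x)) \<partial>?M) < e / 2"
    unfolding eventually_sequentially by blast
  have int: "integrable ?M (\<lambda>x. clip k (u n x))" "integrable ?M (\<lambda>x. clip k (g x))"
    using norm_clip[OF k] cum cg by (auto intro!: integrable_bounded_finite[where B = k] finite_measure_axioms)
  have "(\<integral>x. cmod (clip k (u n x) - g x) \<partial>?M)
      \<le> (\<integral>x. cmod (clip k (u n x) - clip k (g x)) + cmod (clip k (g x) - g x) \<partial>?M)"
    using int g by (intro integral_mono) (auto intro: norm_diff_triangle_le)
  also have "\<dots> < e"
    using n ke int g by (subst Bochner_Integration.integral_add) auto
  finally show thesis using that cu int by blast
qed

text \<open>Approximants of a derivative have to come with a primitive. A complex polynomial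
  function is given by its real and imaginary parts, which are integrated coefficientwise.\<close>

lemma polynomial_smooth_antiderivative:
  fixes r :: "real \<Rightarrow> complex"
  assumes "polynomial_function r"
  obtains q where "smooth_function q" "smooth_function r" "q 0 = 0"
    "\<And>x. (q has_vector_derivative r x) (at x)"
proof -
  have "real_polynomial_function (Re \<circ> r)" "real_polynomial_function (Im \<circ> r)"
    using assms bounded_linear_Re bounded_linear_Im by (simp_all add: polynomial_function_def)
  then obtain a b m n where ab: "Re \<circ> r = (\<lambda>x. \<Sum>i\<le>m. a i * x ^ i)"
    "Im \<circ> r = (\<lambda>x. \<Sum>i\<le>n. b i * x ^ i)"
    unfolding real_polynomial_function_iff_sum by (elim exE)
  have r: "r = (\<lambda>x. (\<Sum>i\<le>m. of_real (a i) * of_real x ^ i) + \<i> * (\<Sum>i\<le>n. of_real (b i) * of_real x ^ i))"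
  proof
    fix x
    have "r x = of_real ((Re \<circ> r) x) + \<i> * of_real ((Im \<circ> r) x)"
      using complex_eq[of "r x"] by simp
    then show "r x = (\<Sum>i\<le>m. of_real (a i) * of_real x ^ i) + \<i> * (\<Sum>i\<le>n. of_real (b i) * of_real x ^ i)"
      unfolding ab by simp
  qed
  define q where "q x = (\<Sum>i\<le>m. of_real (a i / Suc i) * of_real x ^ Suc i)
      + \<i> * (\<Sum>i\<le>n. of_real (b i / Suc i) * of_real x ^ Suc i)" for x :: real
  have sm: "smooth_function r"
    unfolding r
    by (intro smooth_function_simps(2,3) smooth_function_sum smooth_function_simps(1)
        smooth_function_power smooth_function_of_real)
  have pw: "((\<lambda>x. of_real (c / Suc i) * of_real x ^ Suc i) has_vector_derivative (of_real c * of_real x ^ i :: complex)) (at x)"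
    for c :: real and i x
  proof -
    have "((\<lambda>x. of_real (c / Suc i * x ^ Suc i) :: complex) has_vector_derivative of_real (c * x ^ i)) (at x)"
      by (intro has_vector_derivative_of_real) (auto intro!: derivative_eq_intros simp del: power_Suc of_nat_Suc)
    then show ?thesis by (simp del: power_Suc of_nat_Suc)
  qed
  have d: "(q has_vector_derivative r x) (at x)" for x
    unfolding q_def r
    by (intro has_vector_derivative_add has_vector_derivative_mult_right has_vector_derivative_sum pw)
  show thesis
    by (rule that[OF smooth_function_of_vector_derivative[OF d sm] sm _ d]) (simp add: q_def)
qed

lemma smooth_L1_approximation:
  assumes "0 < l" "integrable (lebesgue_on {0<..<l}) g" "e > 0"
  obtains q r where "smooth_function q" "smooth_function r" "q 0 = 0"
    "\<And>x. (q has_vector_derivative r x) (at x)"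
    "(\<integral>x. cmod (r x - g x) \<partial>lebesgue_on {0<..<l}) < e"
proof -
  let ?M = "lebesgue_on {0<..<l}"
  interpret finite_measure ?M by (rule finite_measure_lebesgue_on) simp
  have msp: "measure ?M (space ?M) = l"
    using assms(1) by (simp add: measure_restrict_space)
  obtain h where h: "continuous_on UNIV h" "integrable ?M h" "(\<integral>x. cmod (h x - g x) \<partial>?M) < e / 2"
    using continuous_L1_approximation[OF lmeasurable_box_real(1) assms(2), of "e / 2"] assms(3) by auto
  \<comment> \<open>The interval has measure \<open>l\<close>, so a uniform error of e / (2 l) costs
    e / 2 in mean.\<close>
  obtain r where r: "polynomial_function r" "\<And>x. x \<in> {0..l} \<Longrightarrow> cmod (h x - r x) < e / (2 * l)"
    using Stone_Weierstrass_polynomial_function[of "{0..l}" h "e / (2 * l)"] assms h(1)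
      continuous_on_subset by (metis compact_Icc divide_pos_pos mult_pos_pos subset_UNIV zero_less_numeral)
  obtain q where q: "smooth_function q" "smooth_function r" "q 0 = 0"
    "\<And>x. (q has_vector_derivative r x) (at x)"
    using polynomial_smooth_antiderivative[OF r(1)] by blast
  have ri: "integrable ?M r"
    by (intro integrable_continuous_interval smooth_function_continuous q)
  have "(\<integral>x. cmod (r x - g x) \<partial>?M) \<le> (\<integral>x. e / (2 * l) + cmod (h x - g x) \<partial>?M)"
  proof (rule integral_mono)
    fix x assume "x \<in> space ?M"
    then show "cmod (r x - g x) \<le> e / (2 * l) + cmod (h x - g x)"
      using r(2)[of x] norm_triangle_ineq[of "r x - h x" "h x - g x"] by (simp add: norm_minus_commute)
  qed (use ri h assms in auto)
  also have "\<dots> < e"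
    using h assms(1,2) msp by (subst Bochner_Integration.integral_add) auto
  finally show thesis using that q by blast
qed

section \<open>The fundamental lemma for weak derivatives\<close>

text \<open>Polynomials that converge uniformly to the conjugate of \<open>D\<close> are admissible
  as \<open>r\<close>, so the integral of |D|^2 vanishes; continuity then gives zero everywhere, end
  points included.\<close>

lemma integral_mult_smooth_zero_imp_zero:
  fixes D :: "real \<Rightarrow> complex"
  assumes l: "0 < l" and D: "continuous_on {0..l} D"
    and zero: "\<And>q r. smooth_function q \<Longrightarrow> smooth_function r \<Longrightarrow>
      (\<And>x. (q has_vector_derivative r x) (at x)) \<Longrightarrow> (\<integral>x. r x * D x \<partial>lebesgue_on {0<..<l}) = 0"
    and x: "x \<in> {0..l}"
  shows "D x = 0"
proof -
  let ?M = "lebesgue_on {0<..<l}"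
  obtain r where r: "\<And>n. polynomial_function (r n)"
    "uniform_limit {0..l} r (\<lambda>x. cnj (D x)) sequentially"
  proof -
    have "\<exists>g. polynomial_function g \<and> (\<forall>x\<in>{0..l}. cmod (cnj (D x) - g x) < inverse (Suc n))" for n
      using D by (intro Stone_Weierstrass_polynomial_function continuous_intros) auto
    then obtain g where g: "\<And>n. polynomial_function (g n)"
      "\<And>n x. x \<in> {0..l} \<Longrightarrow> cmod (cnj (D x) - g n x) < inverse (Suc n)"
      by metis
    have "uniform_limit {0..l} g (\<lambda>x. cnj (D x)) sequentially"
    proof (rule uniform_limitI)
      fix e :: real assume "e > 0"
      then have "\<forall>\<^sub>F n in sequentially. inverse (real (Suc n)) < e"
        using LIMSEQ_inverse_real_of_nat order_tendstoD(2) by blast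
      then show "\<forall>\<^sub>F n in sequentially. \<forall>x\<in>{0..l}. dist (g n x) (cnj (D x)) < e"
      proof (rule eventually_mono, intro ballI)
        fix n x assume "inverse (real (Suc n)) < e" "x \<in> {0..l}"
        with g(2)[of x n] show "dist (g n x) (cnj (D x)) < e"
          by (simp add: dist_norm norm_minus_commute)
      qed
    qed
    with g(1) show thesis by (rule that)
  qed
  obtain B where B: "\<And>x. x \<in> {0..l} \<Longrightarrow> cmod (D x) \<le> B"
    using continuous_on_interval_bounded[OF D] by blast
  have "(\<lambda>n. \<integral>x. r n x * D x \<partial>?M) \<longlonglongrightarrow> (\<integral>x. cnj (D x) * D x \<partial>?M)"
  proof (rule tendsto_integral_mult_uniform)
    show "uniform_limit (space ?M) r (\<lambda>x. cnj (D x)) sequentially"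
      by (rule uniform_limit_on_subset[OF r(2)]) auto
    show "r n \<in> borel_measurable ?M" for n
      using r(1)[of n] by (intro continuous_on_measurable_interval continuous_on_polymonial_function)
    show "cmod (cnj (D x)) \<le> B" if "x \<in> space ?M" for x
      using that B[of x] by simp
    show "integrable ?M D" by (rule integrable_continuous_interval[OF D])
  qed
  moreover have "(\<integral>x. r n x * D x \<partial>?M) = 0" for n
    using polynomial_smooth_antiderivative[OF r(1)[of n]] zero by metis
  ultimately have z: "(\<integral>x. cnj (D x) * D x \<partial>?M) = 0"
    using LIMSEQ_unique[OF _ tendsto_const[of 0]] by simp
  have cD: "continuous_on {0..l} (\<lambda>x. (cmod (D x))\<^sup>2)"
    using D by (intro continuous_intros)
  have "(\<integral>x. of_real ((cmod (D x))\<^sup>2) \<partial>?M) = (0 :: complex)"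
    using z by (simp add: complex_norm_square mult.commute flip: of_real_power)
  moreover have ci: "integrable ?M (\<lambda>x. complex_of_real ((cmod (D x))\<^sup>2))"
    using cD by (intro integrable_continuous_interval continuous_on_of_real)
  ultimately have "(\<integral>x. (cmod (D x))\<^sup>2 \<partial>?M) = 0"
    by (simp only: integral_complex_of_real of_real_eq_0_iff)
  moreover have "integrable ?M (\<lambda>x. (cmod (D x))\<^sup>2)"
    using integrable_norm[OF ci] by (simp add: norm_power)
  ultimately have "integral {0..l} (\<lambda>x. (cmod (D x))\<^sup>2) = 0"
    by (simp add: lebesgue_on_interval_eq_integral)
  then have "integral (cbox 0 l) (\<lambda>x. (cmod (D x))\<^sup>2) = 0" by simp
  then have "\<forall>x\<in>cbox 0 l. (cmod (D x))\<^sup>2 = 0"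
    using cD l by (subst (asm) integral_cbox_eq_0_iff) (auto simp: box_ne_empty)
  then show ?thesis using x by simp
qed

text \<open>The du Bois-Reymond lemma. Localised by a bump \<omega>, the product h \<omega> has weak
  derivative h \<omega>', hence equals the primitive \<open>V\<close> of that function. So h = V /
  \<omega> is differentiable where \<omega> does not vanish, and the quotient rule gives derivative
  0.\<close>

lemma integral_test_deriv_zero_imp_constant:
  fixes h :: "real \<Rightarrow> complex"
  assumes l: "0 < l" and h: "continuous_on {0..l} h"
    and zero: "\<And>\<psi>. test_function {0<..<l} \<psi> \<Longrightarrow>
      (\<integral>x. h x * partial_deriv 1 \<psi> x \<partial>lebesgue_on {0<..<l}) = 0"
    and x: "x \<in> {0..l}"
  shows "h x = h 0"
proof -
  let ?M = "lebesgue_on {0<..<l}"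
  have inner: "h x = h y" if xy: "0 < x" "x < l" "0 < y" "y < l" for x y
  proof -
    \<comment> \<open>Halfway between the two points and the ends: (a, b) contains both points, and
      its closure lies inside (0, l).\<close>
    define a b where "a = min x y / 2" and "b = (max x y + l) / 2"
    have ab: "0 < a" "a < b" "b < l" and abx: "x \<in> {a<..<b}" "y \<in> {a<..<b}"
      using xy by (auto simp: a_def b_def min_def max_def)
    from exists_bump[OF ab(2)] obtain \<omega>
      where "smooth_function \<omega> \<and> (\<forall>x. \<omega> x \<noteq> 0 \<longleftrightarrow> a < x \<and> x < b)" ..
    then have \<omega>: "smooth_function \<omega>" "\<And>x. \<omega> x \<noteq> 0 \<longleftrightarrow> a < x \<and> x < b"
      by simp_all
    let ?w = "partial_deriv 1 \<omega>"
    have "{x. \<omega> x \<noteq> 0} = {a<..<b}" by (simp add: set_eq_iff \<omega>(2))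
    then have supp: "closure {x. \<omega> x \<noteq> 0} = {a..b}"
      by (simp only: closure_greaterThanLessThan[OF ab(2)])
    have t\<omega>: "test_function {0<..<l} \<omega>"
      unfolding test_function_def supp using ab \<omega>(1) by auto
    have cw: "continuous_on S ?w" for S
      by (intro smooth_function_continuous smooth_function_partial_deriv \<omega>)
    have c\<omega>: "continuous_on S \<omega>" for S
      by (intro smooth_function_continuous \<omega>)
    have chw: "continuous_on {0..l} (\<lambda>x. h x * ?w x)"
      by (intro continuous_intros h cw)
    have ch\<omega>: "continuous_on {0..l} (\<lambda>x. h x * \<omega> x)"
      by (intro continuous_intros h c\<omega>)
    define V where "V x = integral {0..x} (\<lambda>x. h x * ?w x)" for x
    have V: "(V has_vector_derivative h x * ?w x) (at x within {0..l})" if "x \<in> {0..l}" for x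
      unfolding V_def by (rule integral_has_vector_derivative[OF chw that])
    then have cV: "continuous_on {0..l} V"
      using has_vector_derivative_continuous continuous_on_eq_continuous_within by blast
    have V0: "V 0 = 0" by (simp add: V_def)
    \<comment> \<open>The hypothesis for \<omega> itself. With \<open>V\<close> zero at both ends,
      integration by parts against an arbitrary \<open>q\<close> leaves no boundary terms.\<close>
    have Vl: "V l = 0"
      using zero[OF t\<omega>] lebesgue_on_interval_eq_integral(1)[OF integrable_continuous_interval[OF chw]]
      by (simp add: V_def)
    have D0: "h x * \<omega> x - V x = 0" if "x \<in> {0..l}" for x
    proof (rule integral_mult_smooth_zero_imp_zero[OF l _ _ that])
      show "continuous_on {0..l} (\<lambda>x. h x * \<omega> x - V x)"
        by (intro continuous_intros h c\<omega> cV)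
      fix q r :: "real \<Rightarrow> complex"
      assume q: "smooth_function q" and r: "smooth_function r"
        and qr: "\<And>x. (q has_vector_derivative r x) (at x)"
      have cq: "continuous_on {0..l} q" and cr: "continuous_on {0..l} r"
        using q r by (simp_all add: smooth_function_continuous)
      have pq: "partial_deriv 1 q x = r x" for x
        using partial_deriv_real_eq[OF qr, of 1 x] by simp
      have "(\<integral>x. r x * V x + q x * (h x * ?w x) \<partial>?M) = q l * V l - q 0 * V 0"
      proof (rule integral_vector_derivative_interval)
        show "((\<lambda>x. q x * V x) has_vector_derivative r x * V x + q x * (h x * ?w x)) (at x within {0..l})"
          if "x \<in> {0..l}" for x
          using has_vector_derivative_mult[OF has_vector_derivative_at_within[OF qr] V[OF that]]
          by (simp add: add.commute)
        show "continuous_on {0..l} (\<lambda>x. r x * V x + q x * (h x * ?w x))"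
          by (intro continuous_intros cr cq cV chw h cw)
      qed (use l in simp)
      then have 1: "(\<integral>x. r x * V x + q x * (h x * ?w x) \<partial>?M) = 0"
        by (simp add: V0 Vl)
      have "(\<integral>x. h x * partial_deriv 1 (\<lambda>x. q x * \<omega> x) x \<partial>?M) = 0"
        by (rule zero[OF test_function_mult[OF t\<omega> q]])
      then have 2: "(\<integral>x. h x * (q x * ?w x + r x * \<omega> x) \<partial>?M) = 0"
        by (simp add: partial_deriv_mult[OF q \<omega>(1)] pq)
      have "(\<integral>x. r x * (h x * \<omega> x - V x) \<partial>?M) =
          (\<integral>x. h x * (q x * ?w x + r x * \<omega> x) - (r x * V x + q x * (h x * ?w x)) \<partial>?M)"
        by (simp add: algebra_simps)
      also have "\<dots> = (\<integral>x. h x * (q x * ?w x + r x * \<omega> x) \<partial>?M)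
          - (\<integral>x. r x * V x + q x * (h x * ?w x) \<partial>?M)"
        by (intro Bochner_Integration.integral_diff integrable_continuous_interval continuous_intros
          cr cq cV h cw c\<omega>)
      finally show "(\<integral>x. r x * (h x * \<omega> x - V x) \<partial>?M) = 0" by (simp only: 1 2 diff_self)
    qed
    have hV: "h x = V x / \<omega> x" if "x \<in> {a<..<b}" for x
    proof -
      have "\<omega> x \<noteq> 0" "h x * \<omega> x = V x" using that ab \<omega>(2)[of x] D0[of x] by simp_all
      then show ?thesis by (simp add: nonzero_eq_divide_eq)
    qed
    \<comment> \<open>Differentiability of \<open>h\<close> is not assumed: it is inherited from V /
      \<omega>, and V' = h \<omega>' together with V = h \<omega> cancels the two terms of the
      quotient rule.\<close>
    have "(h has_vector_derivative 0) (at x within {a<..<b})" if x: "x \<in> {a<..<b}" for x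
    proof -
      have "x \<in> interior {0..l}" using x ab by simp
      then have Vx: "(V has_vector_derivative h x * ?w x) (at x)"
        using V[of x] x ab at_within_interior[of x "{0..l}"] by (metis interior_subset subsetD)
      have nz: "\<omega> x \<noteq> 0" using x \<omega>(2) by simp
      have wx: "(\<omega> has_vector_derivative ?w x) (at x)"
        by (rule smooth_function_has_vector_derivative[OF \<omega>(1)])
      have "((\<lambda>x. V x / \<omega> x) has_derivative
          (\<lambda>d. - V x * (inverse (\<omega> x) * (d *\<^sub>R ?w x) * inverse (\<omega> x)) + (d *\<^sub>R (h x * ?w x)) / \<omega> x)) (at x)"
        using Vx wx nz unfolding has_vector_derivative_def by (intro has_derivative_divide)
      moreover have "- V x * (inverse (\<omega> x) * (d *\<^sub>R ?w x) * inverse (\<omega> x)) + (d *\<^sub>R (h x * ?w x)) / \<omega> x = 0" for d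
      proof -
        have "V x = h x * \<omega> x" using hV[OF x] nz by simp
        then show ?thesis using nz by (simp only:) (simp add: scaleR_conv_of_real field_simps)
      qed
      ultimately have "((\<lambda>x. V x / \<omega> x) has_vector_derivative 0) (at x)"
        by (simp add: has_vector_derivative_def)
      then have "(h has_vector_derivative 0) (at x)"
        by (rule has_vector_derivative_transform_within_open[where S = "{a<..<b}"])
          (use x hV in \<open>simp_all add: hV\<close>)
      then show ?thesis by (rule has_vector_derivative_at_within)
    qed
    then have "\<exists>c. \<forall>x\<in>{a<..<b}. h x = c"
      using has_vector_derivative_zero_constant[of "{a<..<b}" h] by (metis convex_real_interval(8))
    with abx show ?thesis by auto
  qed
  have cl: "closure {0<..<l} = {0..l}" by (rule closure_greaterThanLessThan[OF l])
  have "h y = h (l / 2)" if "y \<in> {0..l}" for y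
  proof (rule continuous_constant_on_closure[of "{0<..<l}"])
    show "continuous_on (closure {0<..<l}) h" "y \<in> closure {0<..<l}"
      using h that by (simp_all only: cl)
    show "h z = h (l / 2)" if "z \<in> {0<..<l}" for z
      by (rule inner) (use that l in auto)
  qed
  from this[OF x] this[of 0] l show ?thesis by simp
qed

section \<open>Absolutely continuous functions as limits of smooth functions\<close>

text \<open>\<open>F\<close> is absolutely continuous on \<open>[0, l]\<close> with derivative \<open>F'\<close>.\<close>

definition smooth_approx :: "real \<Rightarrow> (real \<Rightarrow> complex) \<Rightarrow> (real \<Rightarrow> complex) \<Rightarrow>
    (nat \<Rightarrow> real \<Rightarrow> complex) \<Rightarrow> (nat \<Rightarrow> real \<Rightarrow> complex) \<Rightarrow> bool" where
  "smooth_approx l F F' p p' \<longleftrightarrow>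
     (\<forall>n. smooth_function (p n) \<and> smooth_function (p' n)) \<and>
     (\<forall>n x. (p n has_vector_derivative p' n x) (at x)) \<and>
     uniform_limit {0..l} p F sequentially \<and>
     integrable (lebesgue_on {0<..<l}) F' \<and>
     (\<lambda>n. \<integral>x. cmod (p' n x - F' x) \<partial>lebesgue_on {0<..<l}) \<longlonglongrightarrow> 0"

lemma smooth_approxD:
  assumes "smooth_approx l F F' p p'"
  shows "smooth_function (p n)" "smooth_function (p' n)" "(p n has_vector_derivative p' n x) (at x)"
    "uniform_limit {0..l} p F sequentially" "integrable (lebesgue_on {0<..<l}) F'"
    "(\<lambda>n. \<integral>x. cmod (p' n x - F' x) \<partial>lebesgue_on {0<..<l}) \<longlonglongrightarrow> 0"
    "partial_deriv 1 (p n) x = p' n x"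
proof -
  show "(p n has_vector_derivative p' n x) (at x)" using assms by (simp add: smooth_approx_def)
  from partial_deriv_real_eq[OF this, of 1] show "partial_deriv 1 (p n) x = p' n x" by simp
qed (use assms in \<open>simp_all add: smooth_approx_def\<close>)

lemma smooth_approx_continuous:
  assumes "smooth_approx l F F' p p'"
  shows "continuous_on {0..l} F"
  by (rule uniform_limit_theorem[OF _ smooth_approxD(4)[OF assms]])
    (simp_all add: smooth_function_continuous smooth_approxD(1)[OF assms])

lemma smooth_approx_tendsto_integral:
  assumes "smooth_approx l F F' p p'" "integrable (lebesgue_on {0<..<l}) h"
  shows "(\<lambda>n. \<integral>x. p n x * h x \<partial>lebesgue_on {0<..<l}) \<longlonglongrightarrow> (\<integral>x. F x * h x \<partial>lebesgue_on {0<..<l})"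
proof -
  obtain B where B: "\<And>x. x \<in> {0..l} \<Longrightarrow> cmod (F x) \<le> B"
    using continuous_on_interval_bounded[OF smooth_approx_continuous[OF assms(1)]] by blast
  show ?thesis
  proof (rule tendsto_integral_mult_uniform)
    show "uniform_limit (space (lebesgue_on {0<..<l})) p F sequentially"
      by (rule uniform_limit_on_subset[OF smooth_approxD(4)[OF assms(1)]]) auto
    show "p n \<in> borel_measurable (lebesgue_on {0<..<l})" for n
      by (intro continuous_on_measurable_interval smooth_function_continuous smooth_approxD(1)[OF assms(1)])
    show "cmod (F x) \<le> B" if "x \<in> space (lebesgue_on {0<..<l})" for x
      using that B[of x] by simp
  qed (rule assms)
qed

lemma smooth_approx_integrable_deriv:
  "smooth_approx l F F' p p' \<Longrightarrow> integrable (lebesgue_on {0<..<l}) (p' n)"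
  by (intro integrable_continuous_interval smooth_function_continuous) (rule smooth_approxD)

lemma smooth_approx_tendsto_integral_deriv:
  assumes "smooth_approx l F F' p p'" "h \<in> borel_measurable (lebesgue_on {0<..<l})"
    and "\<And>x. x \<in> {0<..<l} \<Longrightarrow> cmod (h x) \<le> B"
  shows "(\<lambda>n. \<integral>x. h x * p' n x \<partial>lebesgue_on {0<..<l}) \<longlonglongrightarrow> (\<integral>x. h x * F' x \<partial>lebesgue_on {0<..<l})"
proof -
  have "(\<lambda>n. (\<integral>x. h x * p' n x \<partial>lebesgue_on {0<..<l}) - (\<integral>x. h x * F' x \<partial>lebesgue_on {0<..<l})) \<longlonglongrightarrow> 0"
    by (rule tendsto_integral_mult_L1[where h = "\<lambda>n. h" and B = B])
      (use assms in \<open>simp_all add: smooth_approxD[OF assms(1)] smooth_approx_integrable_deriv[OF assms(1)]\<close>)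
  then show ?thesis by (simp only: LIM_zero_iff)
qed

lemma smooth_approx_tendsto_integral_deriv_continuous:
  assumes "smooth_approx l F F' p p'" "continuous_on {0..l} h"
  shows "(\<lambda>n. \<integral>x. h x * p' n x \<partial>lebesgue_on {0<..<l}) \<longlonglongrightarrow> (\<integral>x. h x * F' x \<partial>lebesgue_on {0<..<l})"
proof -
  obtain B where B: "\<And>x. x \<in> {0..l} \<Longrightarrow> cmod (h x) \<le> B"
    using continuous_on_interval_bounded[OF assms(2)] by blast
  then show ?thesis
    by (intro smooth_approx_tendsto_integral_deriv[OF assms(1), where B = B]
        continuous_on_measurable_interval[OF assms(2)]) simp
qed

text \<open>True for each smooth approximant. The left side passes to the limit by uniform
  convergence of the functions, the right side by mean convergence of the derivatives.\<close>

lemma smooth_approx_by_parts: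
  assumes l: "0 < l" and F: "smooth_approx l F F' p p'" and \<psi>: "test_function {0<..<l} \<psi>"
  shows "(\<integral>x. F x * partial_deriv 1 \<psi> x \<partial>lebesgue_on {0<..<l})
    = - (\<integral>x. \<psi> x * F' x \<partial>lebesgue_on {0<..<l})"
proof -
  let ?M = "lebesgue_on {0<..<l}"
  note sm = test_function_smooth[OF \<psi>]
  have c: "continuous_on {0..l} \<psi>" "continuous_on {0..l} (partial_deriv 1 \<psi>)"
    by (intro smooth_function_continuous smooth_function_partial_deriv sm)+
  have cp: "continuous_on {0..l} (p n)" "continuous_on {0..l} (p' n)" for n
    by (intro smooth_function_continuous smooth_approxD[OF F])+
  have eq: "(\<integral>x. p n x * partial_deriv 1 \<psi> x \<partial>?M) = - (\<integral>x. \<psi> x * p' n x \<partial>?M)" for n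
  proof -
    have "(\<integral>x. partial_deriv 1 (\<lambda>x. p n x * \<psi> x) x \<partial>?M) = 0"
      using l by (intro integral_test_function_deriv test_function_mult \<psi> smooth_approxD(1)[OF F]) simp
    moreover have "partial_deriv 1 (\<lambda>x. p n x * \<psi> x) = (\<lambda>x. p n x * partial_deriv 1 \<psi> x + \<psi> x * p' n x)"
      by (rule ext) (simp add: partial_deriv_mult[OF smooth_approxD(1)[OF F] sm] smooth_approxD(7)[OF F])
    ultimately have "(\<integral>x. p n x * partial_deriv 1 \<psi> x + \<psi> x * p' n x \<partial>?M) = 0" by (simp only:)
    moreover have "(\<integral>x. p n x * partial_deriv 1 \<psi> x + \<psi> x * p' n x \<partial>?M)
        = (\<integral>x. p n x * partial_deriv 1 \<psi> x \<partial>?M) + (\<integral>x. \<psi> x * p' n x \<partial>?M)"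
      by (intro Bochner_Integration.integral_add integrable_continuous_interval continuous_intros c cp)
    ultimately show ?thesis by (simp add: add_eq_0_iff2)
  qed
  have "(\<lambda>n. - (\<integral>x. \<psi> x * p' n x \<partial>?M)) \<longlonglongrightarrow> - (\<integral>x. \<psi> x * F' x \<partial>?M)"
    by (intro tendsto_minus smooth_approx_tendsto_integral_deriv_continuous[OF F] c)
  moreover have "(\<lambda>n. \<integral>x. p n x * partial_deriv 1 \<psi> x \<partial>?M) \<longlonglongrightarrow> (\<integral>x. F x * partial_deriv 1 \<psi> x \<partial>?M)"
    by (intro smooth_approx_tendsto_integral[OF F] integrable_continuous_interval c)
  ultimately show ?thesis
    unfolding eq[symmetric] by (rule LIMSEQ_unique[rotated])
qed

text \<open>Smooth functions close to \<open>g\<close> in mean have primitives that are uniformly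
  close, since all primitives start from the same value at 0.\<close>

lemma indefinite_integral_smooth_approx:
  assumes l: "0 < l" and g: "integrable (lebesgue_on {0<..<l}) g"
    and F: "\<And>x. x \<in> {0..l} \<Longrightarrow> F x = c + integral {0..x} g"
  obtains p p' where "smooth_approx l F g p p'"
proof -
  let ?M = "lebesgue_on {0<..<l}"
  have "\<exists>q r. smooth_function q \<and> smooth_function r \<and> q 0 = 0 \<and>
      (\<forall>x. (q has_vector_derivative r x) (at x)) \<and> (\<integral>x. cmod (r x - g x) \<partial>?M) < inverse (Suc n)" for n
    using smooth_L1_approximation[OF l g, of "inverse (Suc n)"] by (metis inverse_positive_iff_positive of_nat_0_less_iff zero_less_Suc)
  then obtain q r where q: "\<And>n. smooth_function (q n)" "\<And>n. smooth_function (r n)" "\<And>n. q n 0 = 0"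
    "\<And>n x. (q n has_vector_derivative r n x) (at x)"
    "\<And>n. (\<integral>x. cmod (r n x - g x) \<partial>?M) < inverse (Suc n)"
    by metis
  have ri: "integrable ?M (r n)" for n
    by (intro integrable_continuous_interval smooth_function_continuous q)
  have close: "cmod (c + q n x - F x) \<le> (\<integral>x. cmod (r n x - g x) \<partial>?M)" if x: "x \<in> {0..l}" for n x
  proof -
    have d: "integrable ?M (\<lambda>x. r n x - g x)" using ri g by simp
    have ai: "(\<lambda>x. r n x - g x) absolutely_integrable_on {0..l}"
      by (rule lebesgue_on_interval_eq_integral(3)[OF d])
    have sub: "{0..x} \<subseteq> {0..l}" using x by auto
    have gi: "g integrable_on {0..x}"
      by (rule integrable_on_subinterval[OF lebesgue_on_interval_eq_integral(2)[OF g] sub])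
    have "(r n has_integral (q n x - q n 0)) {0..x}"
      using x q(4) by (intro fundamental_theorem_of_calculus) (auto intro: has_vector_derivative_at_within)
    then have rI: "integral {0..x} (r n) = q n x" and rI': "r n integrable_on {0..x}"
      using q(3) by (auto simp: integral_unique has_integral_integrable)
    have "c + q n x - F x = integral {0..x} (\<lambda>x. r n x - g x)"
      using F[OF x] rI by (simp add: Henstock_Kurzweil_Integration.integral_diff[OF rI' gi])
    also have "cmod \<dots> \<le> integral {0..x} (\<lambda>x. cmod (r n x - g x))"
    proof (rule integral_norm_bound_integral)
      show "(\<lambda>x. cmod (r n x - g x)) integrable_on {0..x}"
        using ai sub integrable_on_subinterval by (metis absolutely_integrable_on_def)
    qed (use rI' gi in \<open>auto intro: integrable_diff\<close>)
    also have "\<dots> \<le> integral {0..l} (\<lambda>x. cmod (r n x - g x))"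
      using ai sub by (intro integral_subset_le) (auto simp: absolutely_integrable_on_def intro: integrable_on_subinterval)
    also have "\<dots> = (\<integral>x. cmod (r n x - g x) \<partial>?M)"
      using d by (intro lebesgue_on_interval_eq_integral(1)[symmetric]) simp
    finally show ?thesis .
  qed
  have "smooth_approx l F g (\<lambda>n x. c + q n x) r"
    unfolding smooth_approx_def
  proof (intro conjI allI)
    show "smooth_function (\<lambda>x. c + q n x)" "smooth_function (r n)" for n
      using q by (simp_all add: smooth_function_simps(1,2))
    show "((\<lambda>x. c + q n x) has_vector_derivative r n x) (at x)" for n x
      using has_vector_derivative_add[OF has_vector_derivative_const q(4)] by simp
    have lim: "(\<lambda>n. inverse (real (Suc n))) \<longlonglongrightarrow> 0" by (rule LIMSEQ_inverse_real_of_nat)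
    show "(\<lambda>n. \<integral>x. cmod (r n x - g x) \<partial>?M) \<longlonglongrightarrow> 0"
    proof (rule tendsto_sandwich[OF _ _ tendsto_const lim])
      show "\<forall>\<^sub>F n in sequentially. 0 \<le> (\<integral>x. cmod (r n x - g x) \<partial>?M)" by simp
      show "\<forall>\<^sub>F n in sequentially. (\<integral>x. cmod (r n x - g x) \<partial>?M) \<le> inverse (real (Suc n))"
        using q(5) by (intro always_eventually allI less_imp_le)
    qed
    show "uniform_limit {0..l} (\<lambda>n x. c + q n x) F sequentially"
    proof (rule uniform_limitI)
      fix e :: real assume "e > 0"
      then have "\<forall>\<^sub>F n in sequentially. inverse (real (Suc n)) < e"
        using lim order_tendstoD(2) by blast
      then show "\<forall>\<^sub>F n in sequentially. \<forall>x\<in>{0..l}. dist (c + q n x) (F x) < e"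
      proof (rule eventually_mono, intro ballI)
        fix n x assume "inverse (real (Suc n)) < e" "x \<in> {0..l}"
        with close[of x n] q(5)[of n] show "dist (c + q n x) (F x) < e"
          by (simp add: dist_norm)
      qed
    qed
  qed (rule g)
  then show thesis by (rule that)
qed

text \<open>The indefinite integral of \<open>g\<close> has the same weak derivative, so the
  difference is continuous with weak derivative 0, hence constant.\<close>

lemma weak_derivative_imp_indefinite_integral:
  fixes u g :: "real \<Rightarrow> complex"
  assumes l: "0 < l" and u: "continuous_on {0..l} u" and g: "integrable (lebesgue_on {0<..<l}) g"
    and weak: "\<And>\<psi>. test_function {0<..<l} \<psi> \<Longrightarrow>
      (\<integral>x. u x * partial_deriv 1 \<psi> x \<partial>lebesgue_on {0<..<l}) = - (\<integral>x. \<psi> x * g x \<partial>lebesgue_on {0<..<l})"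
    and x: "x \<in> {0..l}"
  shows "u x = u 0 + integral {0..x} g"
proof -
  let ?M = "lebesgue_on {0<..<l}"
  let ?G = "\<lambda>x. integral {0..x} g"
  obtain p p' where G: "smooth_approx l ?G g p p'"
    using indefinite_integral_smooth_approx[OF l g, of ?G 0] by (metis add_0)
  note cG = smooth_approx_continuous[OF G]
  have "u x - ?G x = u 0 - ?G 0"
  proof (rule integral_test_deriv_zero_imp_constant[OF l _ _ x])
    show "continuous_on {0..l} (\<lambda>x. u x - ?G x)" by (intro continuous_intros u cG)
    fix \<psi> assume \<psi>: "test_function {0<..<l} \<psi>"
    have c: "continuous_on {0..l} (partial_deriv 1 \<psi>)"
      by (intro smooth_function_continuous smooth_function_partial_deriv test_function_smooth[OF \<psi>])
    have "(\<integral>x. u x * partial_deriv 1 \<psi> x - ?G x * partial_deriv 1 \<psi> x \<partial>?M)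
        = (\<integral>x. u x * partial_deriv 1 \<psi> x \<partial>?M) - (\<integral>x. ?G x * partial_deriv 1 \<psi> x \<partial>?M)"
      by (intro Bochner_Integration.integral_diff integrable_continuous_interval continuous_intros u c cG)
    also have "\<dots> = 0"
      using weak[OF \<psi>] smooth_approx_by_parts[OF l G \<psi>] by simp
    finally show "(\<integral>x. (u x - ?G x) * partial_deriv 1 \<psi> x \<partial>?M) = 0"
      by (simp add: left_diff_distrib)
  qed
  then show ?thesis by (simp add: algebra_simps)
qed

text \<open>Reduces the construction of approximants to a weak identity. The product and quotient
  rules below check only that identity, without following approximants through the algebra.\<close>

lemma weak_derivative_imp_smooth_approx:
  fixes u g :: "real \<Rightarrow> complex"
  assumes "0 < l" "continuous_on {0..l} u" "integrable (lebesgue_on {0<..<l}) g"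
    and "\<And>\<psi>. test_function {0<..<l} \<psi> \<Longrightarrow>
      (\<integral>x. u x * partial_deriv 1 \<psi> x \<partial>lebesgue_on {0<..<l}) = - (\<integral>x. \<psi> x * g x \<partial>lebesgue_on {0<..<l})"
  obtains p p' where "smooth_approx l u g p p'"
  using indefinite_integral_smooth_approx[OF assms(1,3) weak_derivative_imp_indefinite_integral[OF assms]]
  by metis

text \<open>Only \<open>G\<close> is replaced by its approximants: then
  \<open>q n x * \<psi> x\<close> is a test function, against which \<open>F\<close> can be
  integrated by parts before n grows.\<close>

lemma smooth_approx_mult:
  assumes l: "0 < l" and F: "smooth_approx l F F' p p'" and G: "smooth_approx l G G' q q'"
  obtains r r' where "smooth_approx l (\<lambda>x. F x * G x) (\<lambda>x. F x * G' x + G x * F' x) r r'"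
proof (rule weak_derivative_imp_smooth_approx[OF l])
  let ?M = "lebesgue_on {0<..<l}"
  note cF = smooth_approx_continuous[OF F] and cG = smooth_approx_continuous[OF G]
  note iF = smooth_approxD(5)[OF F] and iG = smooth_approxD(5)[OF G]
  show "continuous_on {0..l} (\<lambda>x. F x * G x)" by (intro continuous_intros cF cG)
  show "integrable ?M (\<lambda>x. F x * G' x + G x * F' x)"
    by (intro Bochner_Integration.integrable_add integrable_mult_continuous_interval cF cG iF iG)
  fix \<psi> assume \<psi>: "test_function {0<..<l} \<psi>"
  note sm = test_function_smooth[OF \<psi>]
  let ?d = "partial_deriv 1 \<psi>"
  have c: "continuous_on {0..l} \<psi>" "continuous_on {0..l} ?d"
    by (intro smooth_function_continuous smooth_function_partial_deriv sm)+
  have cq: "continuous_on {0..l} (q n)" "continuous_on {0..l} (q' n)" for n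
    by (intro smooth_function_continuous smooth_approxD[OF G])+
  have "(\<integral>x. F x * partial_deriv 1 (\<lambda>x. q n x * \<psi> x) x \<partial>?M) = - (\<integral>x. (q n x * \<psi> x) * F' x \<partial>?M)" for n
    by (intro smooth_approx_by_parts[OF l F] test_function_mult \<psi> smooth_approxD(1)[OF G])
  moreover have "(\<integral>x. F x * partial_deriv 1 (\<lambda>x. q n x * \<psi> x) x \<partial>?M)
      = (\<integral>x. q n x * (F x * ?d x) + (F x * \<psi> x) * q' n x \<partial>?M)" for n
    by (simp add: partial_deriv_mult[OF smooth_approxD(1)[OF G] sm] smooth_approxD(7)[OF G])
      (simp add: algebra_simps)
  moreover have "(\<integral>x. q n x * (F x * ?d x) + (F x * \<psi> x) * q' n x \<partial>?M)
      = (\<integral>x. q n x * (F x * ?d x) \<partial>?M) + (\<integral>x. (F x * \<psi> x) * q' n x \<partial>?M)" for n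
    by (intro Bochner_Integration.integral_add integrable_continuous_interval continuous_intros cF c cq)
  ultimately have eq: "(\<integral>x. q n x * (F x * ?d x) \<partial>?M) + (\<integral>x. (F x * \<psi> x) * q' n x \<partial>?M)
      = - (\<integral>x. q n x * (\<psi> x * F' x) \<partial>?M)" for n
    by (simp add: mult.assoc)
  have "(\<lambda>n. (\<integral>x. q n x * (F x * ?d x) \<partial>?M) + (\<integral>x. (F x * \<psi> x) * q' n x \<partial>?M)) \<longlonglongrightarrow>
     (\<integral>x. G x * (F x * ?d x) \<partial>?M) + (\<integral>x. (F x * \<psi> x) * G' x \<partial>?M)"
    by (intro tendsto_add smooth_approx_tendsto_integral[OF G] smooth_approx_tendsto_integral_deriv_continuous[OF G]
        integrable_continuous_interval continuous_intros cF c)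
  moreover have "(\<lambda>n. - (\<integral>x. q n x * (\<psi> x * F' x) \<partial>?M)) \<longlonglongrightarrow> - (\<integral>x. G x * (\<psi> x * F' x) \<partial>?M)"
    by (intro tendsto_minus smooth_approx_tendsto_integral[OF G] integrable_mult_continuous_interval c iF)
  ultimately have "(\<integral>x. G x * (F x * ?d x) \<partial>?M) + (\<integral>x. (F x * \<psi> x) * G' x \<partial>?M)
     = - (\<integral>x. G x * (\<psi> x * F' x) \<partial>?M)"
    unfolding eq by (rule LIMSEQ_unique)
  moreover have "(\<integral>x. \<psi> x * (F x * G' x + G x * F' x) \<partial>?M)
      = (\<integral>x. (F x * \<psi> x) * G' x + (G x * \<psi> x) * F' x \<partial>?M)"
    by (simp add: algebra_simps)
  moreover have "\<dots> = (\<integral>x. (F x * \<psi> x) * G' x \<partial>?M) + (\<integral>x. (G x * \<psi> x) * F' x \<partial>?M)"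
    by (intro Bochner_Integration.integral_add integrable_mult_continuous_interval continuous_intros cF cG c iF iG)
  ultimately show "(\<integral>x. F x * G x * ?d x \<partial>?M) = - (\<integral>x. \<psi> x * (F x * G' x + G x * F' x) \<partial>?M)"
    by (simp add: mult_ac add_eq_0_iff2 eq_neg_iff_add_eq_0 add.assoc)
qed (rule that)

text \<open>By compactness |F| has a positive minimum \<open>m\<close>; from some index N on the
  approximants stay above m / 2, so their reciprocals are smooth on the interval and uniformly
  bounded.\<close>

lemma smooth_approx_inverse:
  assumes l: "0 < l" and F: "smooth_approx l F F' p p'" and nz: "\<And>x. x \<in> {0..l} \<Longrightarrow> F x \<noteq> 0"
  obtains r r' where "smooth_approx l (\<lambda>x. 1 / F x) (\<lambda>x. - 1 / (F x)\<^sup>2 * F' x) r r'"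
proof (rule weak_derivative_imp_smooth_approx[OF l])
  let ?M = "lebesgue_on {0<..<l}"
  note cF = smooth_approx_continuous[OF F]
  note iF = smooth_approxD(5)[OF F]
  note cp = smooth_function_continuous[OF smooth_approxD(1)[OF F]] smooth_function_continuous[OF smooth_approxD(2)[OF F]]
  have c2: "continuous_on {0..l} (\<lambda>x. - 1 / (F x)\<^sup>2)"
    using nz by (intro continuous_intros cF) auto
  show "continuous_on {0..l} (\<lambda>x. 1 / F x)" using nz by (intro continuous_intros cF) auto
  show "integrable ?M (\<lambda>x. - 1 / (F x)\<^sup>2 * F' x)"
    by (intro integrable_mult_continuous_interval c2 iF)
  fix \<psi> assume \<psi>: "test_function {0<..<l} \<psi>"
  note sm = test_function_smooth[OF \<psi>]
  let ?d = "partial_deriv 1 \<psi>"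
  have c: "continuous_on {0..l} \<psi>" "continuous_on {0..l} ?d"
    by (intro smooth_function_continuous smooth_function_partial_deriv sm)+
  obtain m where m: "m > 0" "\<And>x. x \<in> {0..l} \<Longrightarrow> m \<le> cmod (F x)"
  proof -
    have "continuous_on {0..l} (\<lambda>x. cmod (F x))" by (intro continuous_intros cF)
    then obtain x0 where "x0 \<in> {0..l}" "\<And>y. y \<in> {0..l} \<Longrightarrow> cmod (F x0) \<le> cmod (F y)"
      using continuous_attains_inf[of "{0..l}" "\<lambda>x. cmod (F x)"] l by auto
    with nz[of x0] that[of "cmod (F x0)"] show thesis by auto
  qed
  have "\<forall>\<^sub>F n in sequentially. \<forall>x\<in>{0..l}. dist (p n x) (F x) < m / 2"
    using smooth_approxD(4)[OF F] by (rule uniform_limitD) (use m in simp)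
  then obtain N where N: "\<And>n x. n \<ge> N \<Longrightarrow> x \<in> {0..l} \<Longrightarrow> dist (p n x) (F x) < m / 2"
    unfolding eventually_sequentially by metis
  have pm: "m / 2 \<le> cmod (p (n + N) x)" if "x \<in> {0..l}" for n x
    using N[of "n + N" x] m(2)[of x] that norm_triangle_ineq2[of "F x" "p (n + N) x"]
    by (simp add: dist_norm norm_minus_commute)
  then have pnz: "p (n + N) x \<noteq> 0" if "x \<in> {0..l}" for n x
    using pm[OF that, of n] m(1) by auto
  have pF: "(\<lambda>n. p (n + N) x) \<longlonglongrightarrow> F x" if "x \<in> {0..l}" for x
    by (intro LIMSEQ_ignore_initial_segment tendsto_uniform_limitI[OF smooth_approxD(4)[OF F] that])
  obtain B where B: "\<And>x. cmod (\<psi> x) \<le> B" "B > 0" using test_function_bounded[OF \<psi>] by metis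
  let ?h = "\<lambda>n x. - \<psi> x / (p (n + N) x)\<^sup>2"
  have ch: "continuous_on {0..l} (?h n)" for n
    using pnz by (intro continuous_intros c cp) auto
  have hB: "cmod (?h n x) \<le> B / (m / 2)\<^sup>2" if "x \<in> {0..l}" for n x
    using pm[OF that] m(1) B by (simp add: norm_divide norm_power frac_le power_mono)
  have eq: "(\<integral>x. ?d x / p (n + N) x \<partial>?M) = - (\<integral>x. ?h n x * p' (n + N) x \<partial>?M)" for n
  proof -
    have "(\<integral>x. ?d x / p (n + N) x + ?h n x * p' (n + N) x \<partial>?M) = \<psi> l / p (n + N) l - \<psi> 0 / p (n + N) 0"
    proof (rule integral_vector_derivative_interval)
      fix x assume x: "x \<in> {0..l}"
      have "((\<lambda>x. \<psi> x / p (n + N) x) has_derivative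
          (\<lambda>d. - \<psi> x * (inverse (p (n + N) x) * (d *\<^sub>R p' (n + N) x) * inverse (p (n + N) x)) + (d *\<^sub>R ?d x) / p (n + N) x)) (at x)"
        using smooth_function_has_vector_derivative[OF sm, of x UNIV] smooth_approxD(3)[OF F, of "n + N" x] pnz[OF x]
        unfolding has_vector_derivative_def by (intro has_derivative_divide) simp_all
      moreover have "(\<lambda>d. - \<psi> x * (inverse (p (n + N) x) * (d *\<^sub>R p' (n + N) x) * inverse (p (n + N) x)) + (d *\<^sub>R ?d x) / p (n + N) x)
          = (\<lambda>d. d *\<^sub>R (?d x / p (n + N) x + ?h n x * p' (n + N) x))"
        using pnz[OF x] by (auto simp: field_simps scaleR_conv_of_real power2_eq_square)
      ultimately show "((\<lambda>x. \<psi> x / p (n + N) x) has_vector_derivative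
          ?d x / p (n + N) x + ?h n x * p' (n + N) x) (at x within {0..l})"
        by (simp add: has_vector_derivative_def has_derivative_at_withinI)
    qed (use l pnz in \<open>auto intro!: continuous_intros c cp\<close>)
    also have "\<dots> = 0" using test_function_interval_ends[OF \<psi>] by simp
    finally have "(\<integral>x. ?d x / p (n + N) x + ?h n x * p' (n + N) x \<partial>?M) = 0" .
    moreover have "(\<integral>x. ?d x / p (n + N) x + ?h n x * p' (n + N) x \<partial>?M)
        = (\<integral>x. ?d x / p (n + N) x \<partial>?M) + (\<integral>x. ?h n x * p' (n + N) x \<partial>?M)"
      using pnz by (intro Bochner_Integration.integral_add integrable_continuous_interval continuous_intros c cp ch) auto
    ultimately show ?thesis by (simp add: add_eq_0_iff2)
  qed
  obtain B' where B': "\<And>x. x \<in> {0..l} \<Longrightarrow> cmod (?d x) \<le> B'"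
    using continuous_on_interval_bounded[OF c(2)] by blast
  have L1: "(\<lambda>n. \<integral>x. ?d x / p (n + N) x \<partial>?M) \<longlonglongrightarrow> (\<integral>x. ?d x / F x \<partial>?M)"
  proof (rule integral_dominated_convergence[where w = "\<lambda>x. B' / (m / 2)"])
    show "AE x in ?M. (\<lambda>n. ?d x / p (n + N) x) \<longlonglongrightarrow> ?d x / F x"
      using pF nz by (intro AE_I2 tendsto_divide tendsto_const) auto
    show "AE x in ?M. norm (?d x / p (n + N) x) \<le> B' / (m / 2)" for n
    proof (rule AE_I2)
      fix x assume "x \<in> space ?M"
      then have x: "x \<in> {0..l}" by simp
      show "norm (?d x / p (n + N) x) \<le> B' / (m / 2)"
        using pm[OF x] B'[OF x] m(1) order_trans[OF norm_ge_zero B'[OF x]]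
        by (simp only: norm_divide) (intro frac_le, auto)
    qed
    interpret finite_measure ?M by (rule finite_measure_lebesgue_on) simp
    show "integrable ?M (\<lambda>x. B' / (m / 2))" by simp
  qed (use pnz nz in \<open>auto intro!: continuous_on_measurable_interval continuous_intros c cp cF\<close>)
  \<comment> \<open>Both factors depend on n. The derivative is replaced by its limit in mean while
    the bounded factor is held; the bounded factor converges afterwards by dominated
    convergence.\<close>
  have "(\<lambda>n. (\<integral>x. ?h n x * p' (n + N) x \<partial>?M) - (\<integral>x. ?h n x * F' x \<partial>?M)) \<longlonglongrightarrow> 0"
    using hB
    by (intro tendsto_integral_mult_L1[where B = "B / (m / 2)\<^sup>2"] smooth_approx_integrable_deriv[OF F] iF
       LIMSEQ_ignore_initial_segment[OF smooth_approxD(6)[OF F]] continuous_on_measurable_interval ch) auto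
  moreover have "(\<lambda>n. \<integral>x. ?h n x * F' x \<partial>?M) \<longlonglongrightarrow> (\<integral>x. (- \<psi> x / (F x)\<^sup>2) * F' x \<partial>?M)"
  proof (rule integral_dominated_convergence[where w = "\<lambda>x. B / (m / 2)\<^sup>2 * cmod (F' x)"])
    show "AE x in ?M. (\<lambda>n. ?h n x * F' x) \<longlonglongrightarrow> (- \<psi> x / (F x)\<^sup>2) * F' x"
      using pF nz by (intro AE_I2 tendsto_intros) auto
    show "AE x in ?M. norm (?h n x * F' x) \<le> B / (m / 2)\<^sup>2 * cmod (F' x)" for n
      using hB by (intro AE_I2) (simp only: norm_mult, intro mult_right_mono, auto)
    show "(\<lambda>x. ?h n x * F' x) \<in> borel_measurable ?M" for n
      using continuous_on_measurable_interval[OF ch[of n]] iF by (intro borel_measurable_times) auto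
    have "continuous_on {0..l} (\<lambda>x. - \<psi> x / (F x)\<^sup>2)"
      using nz by (intro continuous_intros cF c) auto
    from continuous_on_measurable_interval[OF this]
    show "(\<lambda>x. (- \<psi> x / (F x)\<^sup>2) * F' x) \<in> borel_measurable ?M"
      using iF by (intro borel_measurable_times) auto
  qed (use iF in auto)
  ultimately have "(\<lambda>n. ((\<integral>x. ?h n x * p' (n + N) x \<partial>?M) - (\<integral>x. ?h n x * F' x \<partial>?M)) + (\<integral>x. ?h n x * F' x \<partial>?M))
      \<longlonglongrightarrow> 0 + (\<integral>x. (- \<psi> x / (F x)\<^sup>2) * F' x \<partial>?M)"
    by (rule tendsto_add)
  then have "(\<lambda>n. - (\<integral>x. ?h n x * p' (n + N) x \<partial>?M)) \<longlonglongrightarrow> - (\<integral>x. (- \<psi> x / (F x)\<^sup>2) * F' x \<partial>?M)"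
    by (intro tendsto_minus) simp
  from LIMSEQ_unique[OF L1[unfolded eq] this]
  show "(\<integral>x. 1 / F x * ?d x \<partial>?M) = - (\<integral>x. \<psi> x * (- 1 / (F x)\<^sup>2 * F' x) \<partial>?M)"
    by simp
qed (rule that)

section \<open>The weak equation for the transform of the kernel\<close>

lemma set_lebesgue_integral_eq_lebesgue_on:
  fixes h :: "'a::euclidean_space \<Rightarrow> complex"
  shows "S \<in> sets lebesgue \<Longrightarrow> (LINT x:S|lebesgue. h x) = (\<integral>x. h x \<partial>lebesgue_on S)"
  by (simp add: set_lebesgue_integral_def integral_restrict_space)

text \<open>On a set of finite measure |u| is dominated by 1 + |u|^2.\<close>

lemma L2_on_integrable:
  assumes "L2_on S u" "S \<in> lmeasurable"
  shows "integrable (lebesgue_on S) u"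
proof -
  interpret finite_measure "lebesgue_on S" by (rule finite_measure_lebesgue_on[OF assms(2)])
  have S: "S \<in> sets lebesgue" using assms(2) by (rule fmeasurableD)
  have m: "u \<in> borel_measurable (lebesgue_on S)"
    using assms(1) S by (simp add: L2_on_def set_borel_measurable_def borel_measurable_restrict_space_iff)
  have "integrable (lebesgue_on S) (\<lambda>x. 1 + (cmod (u x))\<^sup>2)"
    using assms(1) S
    by (intro Bochner_Integration.integrable_add)
      (auto simp: L2_on_def set_integrable_def integrable_restrict_space)
  then show ?thesis
  proof (rule Bochner_Integration.integrable_bound)
    have "cmod (u x) \<le> 1 + (cmod (u x))\<^sup>2" for x
      using sum_squares_ge_zero[of "cmod (u x) - 1" "cmod (u x)"] by (auto simp: power2_eq_square algebra_simps)
    then show "AE x in lebesgue_on S. norm (u x) \<le> norm (1 + (cmod (u x))\<^sup>2)" by simp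
  qed (rule m)
qed

lemma weak_deriv_interval:
  assumes "weak_deriv {0<..<l::real} 1 u v"
  shows "integrable (lebesgue_on {0<..<l}) v"
    and "test_function {0<..<l} \<psi> \<Longrightarrow>
      (\<integral>x. u x * partial_deriv 1 \<psi> x \<partial>lebesgue_on {0<..<l}) = - (\<integral>x. \<psi> x * v x \<partial>lebesgue_on {0<..<l})"
  using assms
  by (simp_all add: weak_deriv_def set_lebesgue_integral_eq_lebesgue_on L2_on_integrable mult.commute)

lemma partial_deriv_mult_exp:
  fixes c :: "real \<Rightarrow> complex"
  assumes "smooth_function c"
  shows "partial_deriv 1 (\<lambda>x. exp (a * of_real x) * c x)
    = (\<lambda>x. exp (a * of_real x) * (partial_deriv 1 c x + a * c x))"
  by (rule ext) (simp add: partial_deriv_mult[OF smooth_function_exp assms] partial_deriv_exp distrib_left)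

locale impedance_transform =
  fixes l :: real and f g :: "real \<Rightarrow> complex" and e :: "complex \<Rightarrow> real \<Rightarrow> complex"
    and K :: "real \<times> real \<Rightarrow> complex"
  assumes l_pos: "0 < l"
    and f_cont: "continuous_on {0..l} f"
    and f_nz: "\<And>x. x \<in> {0..l} \<Longrightarrow> f x \<noteq> 0"
    and f_0: "f 0 = 1"
    and fg: "weak_deriv {0<..<l} 1 f g"
    and e_sol: "\<And>\<rho>. impedance_exp_solution l f \<rho> (e \<rho>)"
    and K_kernel: "impedance_kernel l e K"
    and K_cont: "continuous_on (goursat_triangle l) K"
begin

abbreviation "M \<equiv> lebesgue_on {0<..<l}"

definition "F x = f x * f x"

text \<open>Left in the unsimplified form that the product rule yields for f * f, so that folding
  matches it literally.\<close>

definition "F' x = f x * g x + f x * g x"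

lemma f_approx: obtains p p' where "smooth_approx l f g p p'"
  by (rule weak_derivative_imp_smooth_approx[OF l_pos f_cont weak_deriv_interval[OF fg]])

lemma F_approx: obtains p p' where "smooth_approx l F F' p p'"
proof -
  obtain p p' where f: "smooth_approx l f g p p'" by (rule f_approx)
  show thesis
    by (rule smooth_approx_mult[OF l_pos f f, folded F_def F'_def]) (rule that)
qed

lemma F_cont: "continuous_on {0..l} F"
  unfolding F_def by (intro continuous_intros f_cont)

lemma F'_integrable: "integrable M F'"
  using smooth_approxD(5) F_approx by metis

lemma F_by_parts:
  assumes "test_function {0<..<l} \<psi>"
  shows "(\<integral>x. F x * partial_deriv 1 \<psi> x \<partial>M) = - (\<integral>x. \<psi> x * F' x \<partial>M)"
proof -
  obtain p p' where F: "smooth_approx l F F' p p'" by (rule F_approx)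
  show ?thesis by (rule smooth_approx_by_parts[OF l_pos F assms])
qed

lemma e_cont: "continuous_on {0..l} (e \<rho>)" and e_0: "e \<rho> 0 = 1"
  using e_sol[of \<rho>] by (simp_all add: impedance_exp_solution_def)

lemma test_cont:
  assumes "test_function {0<..<l} c"
  shows "continuous_on S c" "continuous_on S (partial_deriv 1 c)"
    "continuous_on S (partial_deriv 1 (partial_deriv 1 c))"
  by (intro smooth_function_continuous smooth_function_partial_deriv test_function_smooth[OF assms])+

lemma exp_cont: "continuous_on S (\<lambda>x. exp (a * complex_of_real x))"
  by (intro continuous_intros)

text \<open>Both derivatives are moved onto \<open>c\<close>: one by the definition of the weak
  derivative \<open>w\<close> of f^2 v, the other by the product rule for F e. The latter leaves
  \<open>F'\<close> as a merely integrable coefficient.\<close>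

lemma e_weak:
  assumes c: "test_function {0<..<l} c"
  shows "(\<integral>x. e \<rho> x * (F' x * partial_deriv 1 c x + F x * partial_deriv 1 (partial_deriv 1 c) x
     + \<rho>\<^sup>2 * F x * c x) \<partial>M) = 0"
proof -
  let ?c1 = "partial_deriv 1 c" and ?c2 = "partial_deriv 1 (partial_deriv 1 c)"
  from e_sol[of \<rho>] obtain v w where v: "weak_deriv {0<..<l} 1 (e \<rho>) v"
    and w: "weak_deriv {0<..<l} 1 (\<lambda>x. (f x)\<^sup>2 * v x) w"
    and ae: "AE x in lebesgue. x \<in> {0<..<l} \<longrightarrow> \<rho>\<^sup>2 * e \<rho> x = - (1 / (f x)\<^sup>2) * w x"
    unfolding impedance_exp_solution_def impedance_op_def by (elim exE conjE)
  obtain q q' where e: "smooth_approx l (e \<rho>) v q q'"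
    by (rule weak_derivative_imp_smooth_approx[OF l_pos e_cont weak_deriv_interval[OF v]])
  obtain p p' where F: "smooth_approx l F F' p p'" by (rule F_approx)
  obtain r r' where Fe: "smooth_approx l (\<lambda>x. F x * e \<rho> x) (\<lambda>x. F x * v x + e \<rho> x * F' x) r r'"
    by (rule smooth_approx_mult[OF l_pos F e])
  note iv = weak_deriv_interval(1)[OF v] and iw = weak_deriv_interval(1)[OF w]
  note cc = test_cont[OF c]
  have 1: "(\<integral>x. F x * e \<rho> x * ?c2 x \<partial>M) = - (\<integral>x. ?c1 x * (F x * v x + e \<rho> x * F' x) \<partial>M)"
    by (rule smooth_approx_by_parts[OF l_pos Fe test_function_partial_deriv[OF c]])
  have "(\<integral>x. ?c1 x * (F x * v x + e \<rho> x * F' x) \<partial>M)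
      = (\<integral>x. (?c1 x * F x) * v x + (?c1 x * e \<rho> x) * F' x \<partial>M)"
    by (simp add: algebra_simps)
  also have "\<dots> = (\<integral>x. (?c1 x * F x) * v x \<partial>M) + (\<integral>x. (?c1 x * e \<rho> x) * F' x \<partial>M)"
    by (intro Bochner_Integration.integral_add integrable_mult_continuous_interval continuous_intros
        cc F_cont e_cont iv F'_integrable)
  finally have 2: "(\<integral>x. ?c1 x * (F x * v x + e \<rho> x * F' x) \<partial>M)
      = (\<integral>x. (?c1 x * F x) * v x \<partial>M) + (\<integral>x. (?c1 x * e \<rho> x) * F' x \<partial>M)" .
  have "(\<integral>x. (?c1 x * F x) * v x \<partial>M) = (\<integral>x. ((f x)\<^sup>2 * v x) * ?c1 x \<partial>M)"
    by (simp add: F_def power2_eq_square mult_ac)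
  also have "\<dots> = - (\<integral>x. c x * w x \<partial>M)"
    by (rule weak_deriv_interval(2)[OF w c])
  \<comment> \<open>The equation holds almost everywhere and contains 1 / f^2; since
    \<open>f\<close> has no zeros it can be solved for \<open>w\<close>.\<close>
  also have "(\<integral>x. c x * w x \<partial>M) = (\<integral>x. - (\<rho>\<^sup>2 * F x * e \<rho> x * c x) \<partial>M)"
  proof (rule integral_cong_AE)
    have "AE x in M. \<rho>\<^sup>2 * e \<rho> x = - (1 / (f x)\<^sup>2) * w x"
      using ae by (subst AE_restrict_space_iff) (auto elim: AE_mp)
    then show "AE x in M. c x * w x = - (\<rho>\<^sup>2 * F x * e \<rho> x * c x)"
    proof (rule AE_mp, intro AE_I2 impI)
      fix x assume x: "x \<in> space M" and eq: "\<rho>\<^sup>2 * e \<rho> x = - (1 / (f x)\<^sup>2) * w x"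
      have "f x \<noteq> 0" using x f_nz[of x] by simp
      then have "w x = - (F x * (\<rho>\<^sup>2 * e \<rho> x))"
        unfolding eq by (simp add: F_def power2_eq_square)
      then show "c x * w x = - (\<rho>\<^sup>2 * F x * e \<rho> x * c x)" by simp
    qed
    show "(\<lambda>x. c x * w x) \<in> borel_measurable M"
      by (intro borel_measurable_integrable integrable_mult_continuous_interval cc iw)
    show "(\<lambda>x. - (\<rho>\<^sup>2 * F x * e \<rho> x * c x)) \<in> borel_measurable M"
      by (intro continuous_on_measurable_interval continuous_intros cc F_cont e_cont)
  qed
  finally have 3: "(\<integral>x. (?c1 x * F x) * v x \<partial>M) = (\<integral>x. \<rho>\<^sup>2 * F x * e \<rho> x * c x \<partial>M)"
    by simp
  have "(\<integral>x. e \<rho> x * (F' x * ?c1 x + F x * ?c2 x + \<rho>\<^sup>2 * F x * c x) \<partial>M)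
      = (\<integral>x. (?c1 x * e \<rho> x) * F' x + (F x * e \<rho> x * ?c2 x + \<rho>\<^sup>2 * F x * e \<rho> x * c x) \<partial>M)"
    by (simp add: algebra_simps)
  also have "\<dots> = (\<integral>x. (?c1 x * e \<rho> x) * F' x \<partial>M) + (\<integral>x. F x * e \<rho> x * ?c2 x + \<rho>\<^sup>2 * F x * e \<rho> x * c x \<partial>M)"
    by (intro Bochner_Integration.integral_add integrable_mult_continuous_interval integrable_continuous_interval
        continuous_intros cc F_cont e_cont F'_integrable)
  also have "(\<integral>x. F x * e \<rho> x * ?c2 x + \<rho>\<^sup>2 * F x * e \<rho> x * c x \<partial>M)
      = (\<integral>x. F x * e \<rho> x * ?c2 x \<partial>M) + (\<integral>x. \<rho>\<^sup>2 * F x * e \<rho> x * c x \<partial>M)"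
    by (intro Bochner_Integration.integral_add integrable_continuous_interval
        continuous_intros cc F_cont e_cont)
  finally show ?thesis using 1 2 3 by simp
qed

text \<open>For v = exp(a x) the expression (F v')' - a^2 F v reduces to a F' v. In weak form this
  follows by integrating \<open>F\<close> by parts against exp(a x) c' and exp(a x) c.\<close>

lemma exp_weak:
  assumes c: "test_function {0<..<l} c"
  shows "(\<integral>x. exp (a * of_real x) * (F' x * partial_deriv 1 c x + F x * partial_deriv 1 (partial_deriv 1 c) x
     - a\<^sup>2 * F x * c x) \<partial>M) = a * (\<integral>x. exp (a * of_real x) * c x * F' x \<partial>M)"
proof -
  let ?c1 = "partial_deriv 1 c" and ?c2 = "partial_deriv 1 (partial_deriv 1 c)"
  let ?E = "\<lambda>x. exp (a * complex_of_real x)"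
  note sm = test_function_smooth[OF c]
  note cc = test_cont[OF c]
  have A: "(\<integral>x. F x * (?E x * (?c2 x + a * ?c1 x)) \<partial>M) = - (\<integral>x. ?E x * ?c1 x * F' x \<partial>M)"
    using F_by_parts[OF test_function_mult[OF test_function_partial_deriv[OF c] smooth_function_exp]]
    unfolding partial_deriv_mult_exp[OF smooth_function_partial_deriv[OF sm]] .
  have B: "(\<integral>x. F x * (?E x * (?c1 x + a * c x)) \<partial>M) = - (\<integral>x. ?E x * c x * F' x \<partial>M)"
    using F_by_parts[OF test_function_mult[OF c smooth_function_exp]]
    unfolding partial_deriv_mult_exp[OF sm] .
  have "(\<integral>x. ?E x * (F' x * ?c1 x + F x * ?c2 x - a\<^sup>2 * F x * c x) \<partial>M)
      = (\<integral>x. ?E x * ?c1 x * F' x + (F x * (?E x * (?c2 x + a * ?c1 x)) - a * (F x * (?E x * (?c1 x + a * c x)))) \<partial>M)"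
    by (simp add: algebra_simps power2_eq_square)
  also have "\<dots> = (\<integral>x. ?E x * ?c1 x * F' x \<partial>M)
      + (\<integral>x. F x * (?E x * (?c2 x + a * ?c1 x)) - a * (F x * (?E x * (?c1 x + a * c x))) \<partial>M)"
    by (intro Bochner_Integration.integral_add integrable_mult_continuous_interval integrable_continuous_interval
        continuous_on_add continuous_on_mult continuous_on_diff continuous_on_const exp_cont cc F_cont F'_integrable)
  also have "(\<integral>x. F x * (?E x * (?c2 x + a * ?c1 x)) - a * (F x * (?E x * (?c1 x + a * c x))) \<partial>M)
      = (\<integral>x. F x * (?E x * (?c2 x + a * ?c1 x)) \<partial>M) - (\<integral>x. a * (F x * (?E x * (?c1 x + a * c x))) \<partial>M)"
    by (intro Bochner_Integration.integral_diff integrable_continuous_interval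
        continuous_on_add continuous_on_mult continuous_on_const exp_cont cc F_cont)
  finally show ?thesis using A B by simp
qed

text \<open>A gauge integral on the closed interval: it agrees with the Lebesgue integral in
  \<open>impedance_kernel\<close> because slices of \<open>K\<close> are continuous, and it is 0 at
  x = 0, which extends the representation of \<open>e\<close> to that point.\<close>

definition transform :: "complex \<Rightarrow> real \<Rightarrow> complex" where
  "transform \<rho> x = integral {-x..x} (\<lambda>t. K (x, t) * exp (\<i> * \<rho> * of_real t))"

lemma K_slice_cont:
  assumes "x \<in> {0..l}"
  shows "continuous_on {-x..x} (\<lambda>t. K (x, t))"
  by (rule continuous_on_compose2[OF K_cont])
    (use assms in \<open>auto simp: goursat_triangle_def intro!: continuous_intros\<close>)

lemma e_eq_transform:
  assumes x: "x \<in> {0..l}"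
  shows "e \<rho> x = exp (\<i> * \<rho> * of_real x) - \<i> * \<rho> * transform \<rho> x"
proof (cases "x = 0")
  case True
  then show ?thesis by (simp add: transform_def e_0)
next
  case False
  then have x': "x \<in> {0<..l}" using x by simp
  have "continuous_on {-x..x} (\<lambda>t. K (x, t) * exp (\<i> * \<rho> * of_real t))"
    by (intro continuous_on_mult K_slice_cont x exp_cont)
  then have "(\<lambda>t. K (x, t) * exp (\<i> * \<rho> * of_real t)) absolutely_integrable_on {-x..x}"
    by (rule absolutely_integrable_continuous_real)
  then have "(\<lambda>t. K (x, t) * exp (\<i> * \<rho> * of_real t)) absolutely_integrable_on {-x<..<x}"
    by (rule set_integrable_subset) auto
  then have "(LINT t:{-x<..<x}|lebesgue. K (x, t) * exp (\<i> * \<rho> * of_real t)) = transform \<rho> x"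
    by (simp add: set_lebesgue_integral_eq_integral transform_def integral_open_interval_real)
  with K_kernel x' show ?thesis by (simp add: impedance_kernel_def)
qed

lemma transform_eq:
  assumes "x \<in> {0..l}" "\<rho> \<noteq> 0"
  shows "transform \<rho> x = (exp (\<i> * \<rho> * of_real x) - e \<rho> x) / (\<i> * \<rho>)"
  using e_eq_transform[OF assms(1), of \<rho>] assms(2) by (simp add: field_simps)

lemma transform_cont:
  assumes "\<rho> \<noteq> 0"
  shows "continuous_on {0..l} (transform \<rho>)"
proof -
  have "continuous_on {0..l} (\<lambda>x. (exp (\<i> * \<rho> * of_real x) - e \<rho> x) / (\<i> * \<rho>))"
    using assms by (intro continuous_on_divide continuous_on_diff exp_cont e_cont continuous_on_const) simp
  then show ?thesis
    by (rule continuous_on_eq) (use transform_eq assms in simp)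
qed

text \<open>The difference of \<open>exp_weak\<close> with a = i \<rho> and \<open>e_weak\<close>,
  divided by i \<rho>; the factor \<open>a\<close> on the right of \<open>exp_weak\<close> cancels
  against the divisor.\<close>

lemma transform_weak:
  assumes c: "test_function {0<..<l} c" and \<rho>: "\<rho> \<noteq> 0"
  shows "(\<integral>x. transform \<rho> x * (F' x * partial_deriv 1 c x + F x * partial_deriv 1 (partial_deriv 1 c) x
     + \<rho>\<^sup>2 * F x * c x) \<partial>M) = (\<integral>x. exp (\<i> * \<rho> * of_real x) * c x * F' x \<partial>M)"
proof -
  let ?c1 = "partial_deriv 1 c" and ?c2 = "partial_deriv 1 (partial_deriv 1 c)"
  let ?E = "\<lambda>x. exp (\<i> * \<rho> * complex_of_real x)"
  let ?L = "\<lambda>x. F' x * ?c1 x + F x * ?c2 x + \<rho>\<^sup>2 * F x * c x"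
  note cc = test_cont[OF c]
  have L: "integrable M ?L"
  proof -
    have "integrable M (\<lambda>x. ?c1 x * F' x + (F x * ?c2 x + \<rho>\<^sup>2 * F x * c x))"
      by (intro Bochner_Integration.integrable_add integrable_mult_continuous_interval integrable_continuous_interval
        continuous_intros cc F_cont F'_integrable)
    then show ?thesis by (simp add: algebra_simps)
  qed
  have "(\<integral>x. transform \<rho> x * ?L x \<partial>M) = (\<integral>x. (?E x * ?L x - e \<rho> x * ?L x) / (\<i> * \<rho>) \<partial>M)"
    by (rule Bochner_Integration.integral_cong) (simp_all add: transform_eq[OF _ \<rho>] left_diff_distrib)
  also have "\<dots> = (\<integral>x. ?E x * ?L x - e \<rho> x * ?L x \<partial>M) / (\<i> * \<rho>)"
    by (rule integral_divide_zero)
  also have "(\<integral>x. ?E x * ?L x - e \<rho> x * ?L x \<partial>M) = (\<integral>x. ?E x * ?L x \<partial>M) - (\<integral>x. e \<rho> x * ?L x \<partial>M)"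
    by (intro Bochner_Integration.integral_diff integrable_mult_continuous_interval exp_cont e_cont L)
  also have "(\<integral>x. ?E x * ?L x \<partial>M) = \<i> * \<rho> * (\<integral>x. ?E x * c x * F' x \<partial>M)"
    using exp_weak[OF c, of "\<i> * \<rho>"] by (simp add: power_mult_distrib)
  finally show ?thesis using e_weak[OF c, of \<rho>] \<rho> by simp
qed

end

section \<open>Powers of the cosine\<close>

text \<open>The binomial theorem for Euler's formula; the j-th term has frequency j - (N - j) = 2 j
  - N.\<close>

lemma cos_power_eq_exp_sum:
  "complex_of_real (cos \<theta> ^ N) =
    (\<Sum>j\<le>N. (of_nat (N choose j) / 2 ^ N) * exp (\<i> * of_real ((2 * real j - real N) * \<theta>)))"
proof -
  have "complex_of_real (cos \<theta>) = (exp (\<i> * of_real \<theta>) + exp (- (\<i> * of_real \<theta>))) / 2"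
    by (simp add: cos_of_real[symmetric] cos_exp_eq)
  then have "complex_of_real (cos \<theta> ^ N) = (exp (\<i> * of_real \<theta>) + exp (- (\<i> * of_real \<theta>))) ^ N / 2 ^ N"
    by (simp only: of_real_power power_divide)
  also have "(exp (\<i> * of_real \<theta>) + exp (- (\<i> * of_real \<theta>))) ^ N =
      (\<Sum>j\<le>N. of_nat (N choose j) * exp (\<i> * of_real \<theta>) ^ j * exp (- (\<i> * of_real \<theta>)) ^ (N - j))"
    by (rule binomial_ring)
  also have "\<dots> = (\<Sum>j\<le>N. of_nat (N choose j) * exp (\<i> * of_real ((2 * real j - real N) * \<theta>)))"
  proof (rule sum.cong[OF refl])
    fix j assume "j \<in> {..N}"
    then have N: "real N = real j + real (N - j)" by simp
    have "exp (\<i> * of_real \<theta>) ^ j * exp (- (\<i> * of_real \<theta>)) ^ (N - j)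
        = exp (of_nat j * (\<i> * of_real \<theta>) + of_nat (N - j) * (- (\<i> * of_real \<theta>)))"
      by (simp only: exp_of_nat_mult exp_add)
    also have "of_nat j * (\<i> * of_real \<theta>) + of_nat (N - j) * (- (\<i> * of_real \<theta>))
        = \<i> * complex_of_real ((2 * real j - real N) * \<theta>)"
      unfolding N by (simp add: algebra_simps)
    finally show "of_nat (N choose j) * exp (\<i> * of_real \<theta>) ^ j * exp (- (\<i> * of_real \<theta>)) ^ (N - j)
        = of_nat (N choose j) * exp (\<i> * of_real ((2 * real j - real N) * \<theta>))"
      by (simp only: mult.assoc)
  qed
  finally show ?thesis by (simp add: sum_divide_distrib)
qed

definition cos_coeff :: "nat \<Rightarrow> nat \<Rightarrow> complex" where
  "cos_coeff N j = of_nat (N choose j) / 2 ^ N"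

definition cos_freq :: "real \<Rightarrow> nat \<Rightarrow> nat \<Rightarrow> complex" where
  "cos_freq \<alpha> N j = of_real ((2 * real j - real N) * \<alpha>)"

text \<open>The derivative of cos(\<alpha> s)^N in s. The truncated exponent N - 1 does no harm at N
  = 0 because of the factor N.\<close>

definition cos_pow_deriv :: "real \<Rightarrow> nat \<Rightarrow> real \<Rightarrow> real" where
  "cos_pow_deriv \<alpha> N s = - (real N * \<alpha> * cos (\<alpha> * s) ^ (N - 1) * sin (\<alpha> * s))"

lemma cos_freq_nonzero: "odd N \<Longrightarrow> \<alpha> \<noteq> 0 \<Longrightarrow> cos_freq \<alpha> N j \<noteq> 0"
proof -
  assume "odd N" "\<alpha> \<noteq> 0"
  then have "2 * real j \<noteq> real N" by (metis even_mult_iff even_numeral of_nat_eq_iff of_nat_mult of_nat_numeral)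
  with \<open>\<alpha> \<noteq> 0\<close> show ?thesis unfolding cos_freq_def of_real_eq_0_iff by simp
qed

lemma cos_pow_sum:
  "(\<Sum>j\<le>N. cos_coeff N j * exp (\<i> * cos_freq \<alpha> N j * of_real s)) = of_real (cos (\<alpha> * s) ^ N)"
  unfolding cos_power_eq_exp_sum cos_coeff_def cos_freq_def by (simp add: mult.assoc)

lemma cos_pow_has_derivative:
  "((\<lambda>s. cos (\<alpha> * (s - c)) ^ N) has_vector_derivative cos_pow_deriv \<alpha> N (s - c)) (at s within S)"
  unfolding has_real_derivative_iff_has_vector_derivative[symmetric]
  by (auto intro!: derivative_eq_intros simp: cos_pow_deriv_def)

text \<open>Both sides are the derivative of the two sides of \<open>cos_pow_sum\<close>.\<close>

lemma cos_pow_deriv_sum: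
  "(\<Sum>j\<le>N. cos_coeff N j * (\<i> * cos_freq \<alpha> N j * exp (\<i> * cos_freq \<alpha> N j * of_real s)))
    = of_real (cos_pow_deriv \<alpha> N s)"
proof (rule vector_derivative_unique_at)
  show "((\<lambda>s. \<Sum>j\<le>N. cos_coeff N j * exp (\<i> * cos_freq \<alpha> N j * of_real s)) has_vector_derivative
      (\<Sum>j\<le>N. cos_coeff N j * (\<i> * cos_freq \<alpha> N j * exp (\<i> * cos_freq \<alpha> N j * of_real s)))) (at s)"
    by (intro has_vector_derivative_sum has_vector_derivative_mult_right has_vector_derivative_cexp)
  show "((\<lambda>s. \<Sum>j\<le>N. cos_coeff N j * exp (\<i> * cos_freq \<alpha> N j * of_real s)) has_vector_derivative
      complex_of_real (cos_pow_deriv \<alpha> N s)) (at s)"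
    unfolding cos_pow_sum
    by (intro has_vector_derivative_of_real)
      (use cos_pow_has_derivative[of \<alpha> 0 N s UNIV] in
        \<open>simp add: has_real_derivative_iff_has_vector_derivative\<close>)
qed

lemma cos_pow_deriv_minus: "cos_pow_deriv \<alpha> N (- s) = - cos_pow_deriv \<alpha> N s"
  by (simp add: cos_pow_deriv_def)

lemma cos_pow_deriv_cont [continuous_intros]:
  fixes u :: "real \<Rightarrow> real"
  shows "continuous_on S u \<Longrightarrow> continuous_on S (\<lambda>t. cos_pow_deriv \<alpha> N (u t))"
  unfolding cos_pow_deriv_def by (intro continuous_intros) auto

text \<open>On \<open>[-x, x]\<close> the derivatives of \<open>cos (\<alpha> (t - x)) ^ n\<close> are nonnegative and concentrate at
  the right end point, where they have unit mass in the limit.\<close>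

locale cos_pow =
  fixes \<alpha> x :: real
  assumes \<alpha>: "\<alpha> > 0" and x: "x > 0" and \<alpha>x: "2 * \<alpha> * x \<le> pi / 2"
begin

text \<open>The argument runs through [-2 \<alpha> x, 0], at most a quarter period to the left of 0,
  where the cosine is nonnegative and the sine nonpositive.\<close>

lemma range: "t \<in> {-x..x} \<Longrightarrow> \<alpha> * (t - x) \<le> 0 \<and> - (pi / 2) \<le> \<alpha> * (t - x)"
proof -
  assume t: "t \<in> {-x..x}"
  have "\<alpha> * (x - t) \<le> \<alpha> * (2 * x)" using t \<alpha> by (intro mult_left_mono) auto
  then show ?thesis using t \<alpha> \<alpha>x by (auto simp: algebra_simps mult_left_mono)
qed

lemma cos_ge_0: "t \<in> {-x..x} \<Longrightarrow> 0 \<le> cos (\<alpha> * (t - x))"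
  using range[of t] by (intro cos_ge_zero) auto

lemma pow_bounds: "t \<in> {-x..x} \<Longrightarrow> 0 \<le> cos (\<alpha> * (t - x)) ^ n" "t \<in> {-x..x} \<Longrightarrow> cos (\<alpha> * (t - x)) ^ n \<le> 1"
  using cos_ge_0 by (simp_all add: power_le_one)

lemma deriv_nonneg: "t \<in> {-x..x} \<Longrightarrow> 0 \<le> cos_pow_deriv \<alpha> n (t - x)"
proof -
  assume t: "t \<in> {-x..x}"
  have "sin (\<alpha> * (t - x)) \<le> 0"
    using range[OF t] sin_ge_zero[of "- (\<alpha> * (t - x))"] pi_gt_zero by auto
  then show ?thesis
    using cos_ge_0[OF t] \<alpha> unfolding cos_pow_deriv_def
    by (simp add: mult_nonneg_nonpos)
qed

lemma cos_strict: "0 \<le> cos (\<alpha> * (2 * x))" "cos (\<alpha> * (2 * x)) < 1"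
proof -
  have b: "0 < \<alpha> * (2 * x)" "\<alpha> * (2 * x) \<le> pi / 2" using \<alpha> x \<alpha>x by (simp_all add: mult_ac)
  then show "0 \<le> cos (\<alpha> * (2 * x))" using pi_gt_zero by (intro cos_ge_zero) linarith+
  have "cos (\<alpha> * (2 * x)) < cos 0" using b pi_gt_zero by (intro cos_monotone_0_pi) linarith+
  then show "cos (\<alpha> * (2 * x)) < 1" by simp
qed

lemma cos_2x_tendsto: "(\<lambda>n. cos (\<alpha> * (2 * x)) ^ n) \<longlonglongrightarrow> 0"
  using cos_strict by (rule LIMSEQ_realpow_zero)

lemma cos_strict_less: assumes "t \<in> {-x..x}" "t \<noteq> x" shows "cos (\<alpha> * (t - x)) < 1"
proof -
  have "cos (- (\<alpha> * (t - x))) < cos 0"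
  proof (rule cos_monotone_0_pi)
    have "t - x < 0" using assms by auto
    then show "0 < - (\<alpha> * (t - x))" using \<alpha> by (simp add: mult_pos_neg)
  qed (use range[OF assms(1)] pi_gt_zero in linarith)+
  then show ?thesis by simp
qed

lemma integral_pow_tendsto: "(\<lambda>n. integral {-x..x} (\<lambda>t. cos (\<alpha> * (t - x)) ^ n)) \<longlonglongrightarrow> 0"
proof -
  have "(\<lambda>n. integral {-x..x} (\<lambda>t. cos (\<alpha> * (t - x)) ^ n)) \<longlonglongrightarrow> integral {-x..x} (\<lambda>t. if t = x then 1 else 0)"
  proof (rule dominated_convergence(2)[where h = "\<lambda>_. 1"])
    show "(\<lambda>t. cos (\<alpha> * (t - x)) ^ n) integrable_on {-x..x}" for n
      by (intro integrable_continuous_real continuous_intros)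
    show "norm (cos (\<alpha> * (t - x)) ^ n) \<le> 1" if "t \<in> {-x..x}" for n t
      using pow_bounds[OF that, of n] by simp
    show "(\<lambda>n. cos (\<alpha> * (t - x)) ^ n) \<longlonglongrightarrow> (if t = x then 1 else 0)" if "t \<in> {-x..x}" for t
      using LIMSEQ_realpow_zero[OF cos_ge_0[OF that] cos_strict_less[OF that]] by auto
  qed auto
  also have "integral {-x..x} (\<lambda>t. if t = x then 1 else 0) = integral {-x..x} (\<lambda>t. 0 :: real)"
    by (rule integral_spike[of "{x}"]) auto
  finally show ?thesis by simp
qed

lemma integral_pow_bound:
  assumes h: "continuous_on {-x..x} h" and B: "\<And>t. t \<in> {-x..x} \<Longrightarrow> cmod (h t) \<le> B"
  shows "cmod (integral {-x..x} (\<lambda>t. h t * of_real (cos (\<alpha> * (t - x)) ^ n)))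
    \<le> B * integral {-x..x} (\<lambda>t. cos (\<alpha> * (t - x)) ^ n)"
proof -
  have "cmod (integral {-x..x} (\<lambda>t. h t * of_real (cos (\<alpha> * (t - x)) ^ n)))
    \<le> integral {-x..x} (\<lambda>t. B * cos (\<alpha> * (t - x)) ^ n)"
  proof (rule integral_norm_bound_integral)
    show "(\<lambda>t. h t * of_real (cos (\<alpha> * (t - x)) ^ n)) integrable_on {-x..x}"
      by (intro integrable_continuous_real continuous_intros h)
    show "(\<lambda>t. B * cos (\<alpha> * (t - x)) ^ n) integrable_on {-x..x}"
      by (intro integrable_continuous_real continuous_intros)
    show "cmod (h t * of_real (cos (\<alpha> * (t - x)) ^ n)) \<le> B * cos (\<alpha> * (t - x)) ^ n" if "t \<in> {-x..x}" for t
      using mult_right_mono[OF B[OF that] pow_bounds(1)[OF that, of n]] pow_bounds(1)[OF that, of n]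
      by (simp only: norm_mult norm_of_real abs_of_nonneg)
  qed
  then show ?thesis by simp
qed

lemma integral_pow_le: "integral {-x..x} (\<lambda>t. cos (\<alpha> * (t - x)) ^ n) \<le> 2 * x"
proof -
  have "integral {-x..x} (\<lambda>t. cos (\<alpha> * (t - x)) ^ n) \<le> integral {-x..x} (\<lambda>t. 1)"
    by (rule integral_le) (auto intro!: integrable_continuous_real continuous_intros pow_bounds)
  then show ?thesis using x by simp
qed

lemma mult_pow_tendsto:
  assumes h: "continuous_on {-x..x} h" and B: "\<And>t. t \<in> {-x..x} \<Longrightarrow> cmod (h t) \<le> B"
  shows "(\<lambda>n. integral {-x..x} (\<lambda>t. h t * of_real (cos (\<alpha> * (t - x)) ^ n))) \<longlonglongrightarrow> 0"
proof (rule Lim_null_comparison)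
  show "\<forall>\<^sub>F n in sequentially. cmod (integral {-x..x} (\<lambda>t. h t * of_real (cos (\<alpha> * (t - x)) ^ n)))
    \<le> B * integral {-x..x} (\<lambda>t. cos (\<alpha> * (t - x)) ^ n)"
    by (intro always_eventually allI integral_pow_bound assms)
  show "(\<lambda>n. B * integral {-x..x} (\<lambda>t. cos (\<alpha> * (t - x)) ^ n)) \<longlonglongrightarrow> 0"
    by (rule tendsto_mult_right_zero[OF integral_pow_tendsto])
qed

text \<open>Integration by parts. Affine weights suffice for the convergence proof: the slope
  absorbs all values of the function away from the end point.\<close>

lemma integral_affine_deriv:
  "integral {-x..x} (\<lambda>t. (r + D * (x - t)) * cos_pow_deriv \<alpha> n (t - x))
    = r - (r + D * (2 * x)) * cos (\<alpha> * (2 * x)) ^ n + D * integral {-x..x} (\<lambda>t. cos (\<alpha> * (t - x)) ^ n)"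
proof -
  let ?d = "\<lambda>t. (r + D * (x - t)) * cos_pow_deriv \<alpha> n (t - x)"
  let ?c = "\<lambda>t. cos (\<alpha> * (t - x)) ^ n"
  have ci: "?d integrable_on {-x..x}" "(\<lambda>t. D * ?c t) integrable_on {-x..x}"
    by (intro integrable_continuous_real continuous_intros)+
  have "((\<lambda>t. ?d t - D * ?c t) has_integral
      ((r + D * (x - x)) * ?c x - (r + D * (x - (- x))) * ?c (- x))) {-x..x}"
  proof (rule fundamental_theorem_of_calculus)
    show "((\<lambda>t. (r + D * (x - t)) * ?c t) has_vector_derivative ?d t - D * ?c t) (at t within {-x..x})" for t
      using cos_pow_has_derivative[of \<alpha> x n t "{-x..x}"]
      unfolding has_real_derivative_iff_has_vector_derivative[symmetric]
      by (auto intro!: derivative_eq_intros simp: cos_pow_deriv_def)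
  qed (use x in simp)
  then have "integral {-x..x} (\<lambda>t. ?d t - D * ?c t) = r - (r + D * (2 * x)) * cos (\<alpha> * (2 * x)) ^ n"
  proof -
    have "cos (\<alpha> * (- x - x)) = cos (\<alpha> * (2 * x))"
      by (metis (no_types) cos_minus minus_mult_right mult_2 minus_add_distrib diff_conv_add_uminus)
    moreover assume "((\<lambda>t. ?d t - D * ?c t) has_integral
      ((r + D * (x - x)) * ?c x - (r + D * (x - (- x))) * ?c (- x))) {-x..x}"
    ultimately show ?thesis by (simp add: integral_unique)
  qed
  moreover have "integral {-x..x} (\<lambda>t. ?d t - D * ?c t) = integral {-x..x} ?d - D * integral {-x..x} ?c"
    using Henstock_Kurzweil_Integration.integral_diff[OF ci] by simp
  ultimately show ?thesis by simp
qed

text \<open>The kernel is nonnegative, so an affine majorant of |h| can be integrated exactly; the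
  boundary term at -x is nonpositive and is dropped.\<close>

lemma deriv_kernel_bound:
  assumes h: "continuous_on {-x..x} h" and hB: "\<And>t. t \<in> {-x..x} \<Longrightarrow> cmod (h t) \<le> r + D * (x - t)"
    and rD: "0 \<le> r" "0 \<le> D"
  shows "cmod (integral {-x..x} (\<lambda>t. h t * of_real (cos_pow_deriv \<alpha> n (t - x))))
    \<le> r + D * integral {-x..x} (\<lambda>t. cos (\<alpha> * (t - x)) ^ n)"
proof -
  have "cmod (integral {-x..x} (\<lambda>t. h t * of_real (cos_pow_deriv \<alpha> n (t - x))))
    \<le> integral {-x..x} (\<lambda>t. (r + D * (x - t)) * cos_pow_deriv \<alpha> n (t - x))"
  proof (rule integral_norm_bound_integral)
    show "(\<lambda>t. h t * of_real (cos_pow_deriv \<alpha> n (t - x))) integrable_on {-x..x}"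
      by (intro integrable_continuous_real continuous_intros h)
    show "(\<lambda>t. (r + D * (x - t)) * cos_pow_deriv \<alpha> n (t - x)) integrable_on {-x..x}"
      by (intro integrable_continuous_real continuous_intros)
    show "cmod (h t * of_real (cos_pow_deriv \<alpha> n (t - x))) \<le> (r + D * (x - t)) * cos_pow_deriv \<alpha> n (t - x)"
      if "t \<in> {-x..x}" for t
      using mult_right_mono[OF hB[OF that] deriv_nonneg[OF that, of n]] deriv_nonneg[OF that, of n]
      by (simp only: norm_mult norm_of_real abs_of_nonneg)
  qed
  also have "\<dots> \<le> r + D * integral {-x..x} (\<lambda>t. cos (\<alpha> * (t - x)) ^ n)"
    unfolding integral_affine_deriv using rD x cos_strict by simp
  finally show ?thesis .
qed

text \<open>The kernel is a one-sided approximate identity at \<open>x\<close>. Its mass is 1 -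
  cos(2 \<alpha> x)^n, and the oscillation of \<open>h\<close> is majorised by an affine function
  with small value at \<open>x\<close>.\<close>

lemma mult_deriv_tendsto:
  fixes h :: "real \<Rightarrow> complex"
  assumes h: "continuous_on {-x..x} h"
  shows "(\<lambda>n. integral {-x..x} (\<lambda>t. h t * of_real (cos_pow_deriv \<alpha> n (t - x)))) \<longlonglongrightarrow> h x"
proof -
  let ?E = "\<lambda>n. integral {-x..x} (\<lambda>t. cos (\<alpha> * (t - x)) ^ n)"
  let ?q = "cos (\<alpha> * (2 * x))"
  let ?I = "\<lambda>n. integral {-x..x} (\<lambda>t. (h t - h x) * of_real (cos_pow_deriv \<alpha> n (t - x)))"
  have "bounded (h ` {-x..x})"
    using h by (intro compact_imp_bounded compact_continuous_image) auto
  then obtain B where B: "B > 0" "\<And>t. t \<in> {-x..x} \<Longrightarrow> cmod (h t) \<le> B"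
    unfolding bounded_pos by auto
  have eq: "integral {-x..x} (\<lambda>t. h t * of_real (cos_pow_deriv \<alpha> n (t - x))) = ?I n + h x * (1 - of_real (?q ^ n))" for n
  proof -
    have 1: "(\<lambda>t. (h t - h x) * complex_of_real (cos_pow_deriv \<alpha> n (t - x))) integrable_on {-x..x}"
      by (intro integrable_continuous_real continuous_intros h)
    have 2: "(\<lambda>t. h x * complex_of_real (cos_pow_deriv \<alpha> n (t - x))) integrable_on {-x..x}"
      by (intro integrable_continuous_real continuous_intros)
    have 3: "(\<lambda>t. cos_pow_deriv \<alpha> n (t - x)) integrable_on {-x..x}"
      by (intro integrable_continuous_real continuous_intros)
    have "integral {-x..x} (\<lambda>t. h x * complex_of_real (cos_pow_deriv \<alpha> n (t - x)))
        = h x * of_real (integral {-x..x} (\<lambda>t. cos_pow_deriv \<alpha> n (t - x)))"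
      by (intro integral_unique has_integral_mult_right has_integral_of_real integrable_integral 3)
    also have "integral {-x..x} (\<lambda>t. cos_pow_deriv \<alpha> n (t - x)) = 1 - ?q ^ n"
      using integral_affine_deriv[of 1 0 n] by simp
    finally show ?thesis
      using Henstock_Kurzweil_Integration.integral_add[OF 1 2] by (simp add: algebra_simps)
  qed
  have "?I \<longlonglongrightarrow> 0"
  proof (rule LIMSEQ_I)
    fix r :: real assume r: "r > 0"
    have "\<exists>\<delta>>0. \<forall>t\<in>{-x..x}. dist t x < \<delta> \<longrightarrow> dist (h t) (h x) < r / 2"
      using h[unfolded continuous_on_iff, rule_format, of x "r / 2"] x r by simp
    then obtain \<delta> :: real where \<delta>: "\<delta> > 0" "\<And>t. t \<in> {-x..x} \<Longrightarrow> dist t x < \<delta> \<Longrightarrow> dist (h t) (h x) < r / 2"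
      by auto
    \<comment> \<open>At distance \<delta> from \<open>x\<close> the slope already reaches 2 B, the
      largest possible oscillation of \<open>h\<close>; nearer to \<open>x\<close> the constant r /
      2 is enough.\<close>
    define D where "D = 2 * B / \<delta>"
    have D: "D \<ge> 0" using B \<delta> by (simp add: D_def)
    have hB: "cmod (h t - h x) \<le> r / 2 + D * (x - t)" if t: "t \<in> {-x..x}" for t
    proof (cases "dist t x < \<delta>")
      case True
      then have "cmod (h t - h x) < r / 2" using \<delta>(2)[OF t] by (simp add: dist_norm)
      moreover have "D * (x - t) \<ge> 0" using D t by simp
      ultimately show ?thesis by linarith
    next
      case False
      then have "\<delta> \<le> x - t" using t by (simp add: dist_real_def)
      then have "D * \<delta> \<le> D * (x - t)" using D by (rule mult_left_mono)
      moreover have "D * \<delta> = 2 * B" using \<delta> by (simp add: D_def)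
      moreover have "cmod (h t - h x) \<le> 2 * B"
        using norm_triangle_ineq4[of "h t" "h x"] B(2)[OF t] B(2)[of x] x by simp
      ultimately show ?thesis using r by linarith
    qed
    have "\<forall>\<^sub>F n in sequentially. D * ?E n < r / 2"
      using tendsto_mult_right_zero[OF integral_pow_tendsto, of D] r by (intro order_tendstoD(2)) auto
    then obtain n0 where n0: "\<And>n. n \<ge> n0 \<Longrightarrow> D * ?E n < r / 2"
      unfolding eventually_sequentially by auto
    have "norm (?I n - 0) < r" if "n \<ge> n0" for n
    proof -
      have "norm (?I n) \<le> r / 2 + D * ?E n"
        by (rule deriv_kernel_bound[where h = "\<lambda>t. h t - h x", OF _ hB])
          (use r D in \<open>auto intro!: continuous_intros h\<close>)
      with n0[OF that] show ?thesis by simp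
    qed
    then show "\<exists>n0. \<forall>n\<ge>n0. norm (?I n - 0) < r" by auto
  qed
  moreover have "(\<lambda>n. h x * (1 - of_real (?q ^ n))) \<longlonglongrightarrow> h x * (1 - of_real 0)"
    by (intro tendsto_intros cos_2x_tendsto)
  ultimately have "(\<lambda>n. ?I n + h x * (1 - of_real (?q ^ n))) \<longlonglongrightarrow> 0 + h x * (1 - of_real 0)"
    by (rule tendsto_add)
  then show ?thesis unfolding eq by simp
qed

end

section \<open>The Goursat conditions\<close>

lemma odd_seq_strict_mono: "strict_mono (\<lambda>n::nat. 2 * n + 1)"
  by (rule strict_monoI) simp

lemma goursat_triangle_compact: "compact (goursat_triangle l)"
proof -
  have "goursat_triangle l = ({0..l} \<times> {-l..l}) \<inter> {p. \<bar>snd p\<bar> \<le> fst p}"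
    by (auto simp: goursat_triangle_def)
  also have "compact \<dots>"
    by (intro compact_Int_closed compact_Times compact_Icc closed_Collect_le continuous_intros)
  finally show ?thesis .
qed

context impedance_transform
begin

text \<open>Two points of [-l, l] are at most 2 l apart, and \<alpha> (2 l) = pi / 2: on the
  resulting arguments the cosine is nonnegative and attains its maximum only at 0.\<close>

definition "\<alpha> = pi / (4 * l)"

lemma \<alpha>_pos: "\<alpha> > 0"
  using l_pos by (simp add: \<alpha>_def)

lemma cos_pow_interval: "x \<in> {0<..<l} \<Longrightarrow> cos_pow \<alpha> x"
  using l_pos by unfold_locales (auto simp: \<alpha>_def field_simps)

lemma K_bounded: "\<exists>B>0. \<forall>p\<in>goursat_triangle l. cmod (K p) \<le> B"
  using compact_imp_bounded[OF compact_continuous_image[OF K_cont goursat_triangle_compact]]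
  unfolding bounded_pos by auto

lemma triangle_mem: "x \<in> {0..l} \<Longrightarrow> t \<in> {-x..x} \<Longrightarrow> (x, t) \<in> goursat_triangle l"
  by (auto simp: goursat_triangle_def)

section \<open>Exponential sums that concentrate on the sides of the triangle\<close>

text \<open>\<tau> = 1 and \<tau> = -1 select the sides t = x and t = -x. There is no normalisation:
  this sum is meant to vanish in the limit, while \<open>diag_deriv_sum\<close> has unit mass in the
  limit by itself.\<close>

definition diag_sum :: "real \<Rightarrow> nat \<Rightarrow> real \<Rightarrow> complex" where
  "diag_sum \<tau> N x = (\<Sum>j\<le>N. cos_coeff N j * (transform (cos_freq \<alpha> N j) x *
      exp (- \<i> * of_real \<tau> * cos_freq \<alpha> N j * of_real x)))"

definition diag_deriv_sum :: "real \<Rightarrow> nat \<Rightarrow> real \<Rightarrow> complex" where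
  "diag_deriv_sum \<tau> N x = (\<Sum>j\<le>N. cos_coeff N j * (transform (cos_freq \<alpha> N j) x *
      (- \<i> * of_real \<tau> * cos_freq \<alpha> N j * exp (- \<i> * of_real \<tau> * cos_freq \<alpha> N j * of_real x))))"

lemma transform_exp:
  assumes "x \<in> {0..l}"
  shows "((\<lambda>t. K (x, t) * exp (\<i> * \<rho> * of_real (t - \<tau> * x))) has_integral
    transform \<rho> x * exp (- \<i> * of_real \<tau> * \<rho> * of_real x)) {-x..x}"
proof -
  have "(\<lambda>t. K (x, t) * exp (\<i> * \<rho> * of_real t)) integrable_on {-x..x}"
    by (intro integrable_continuous_real continuous_on_mult K_slice_cont assms exp_cont)
  from has_integral_mult_left[OF integrable_integral[OF this], of "exp (- \<i> * of_real \<tau> * \<rho> * of_real x)"]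
  show ?thesis
    by (simp add: transform_def mult.assoc exp_add[symmetric] algebra_simps)
qed

lemma reflect_integral:
  fixes h :: "real \<Rightarrow> complex"
  assumes "\<tau> = 1 \<or> \<tau> = -1" and "x \<ge> 0"
  shows "integral {-x..x} h = integral {-x..x} (\<lambda>t. h (\<tau> * t))"
  using assms Henstock_Kurzweil_Integration.integral_reflect_real[of "x" "-x" h] by auto

lemma diag_sum_eq:
  assumes x: "x \<in> {0..l}" and \<tau>: "\<tau> = 1 \<or> \<tau> = -1"
  shows "diag_sum \<tau> N x = integral {-x..x} (\<lambda>t. K (x, \<tau> * t) * of_real (cos (\<alpha> * (t - x)) ^ N))"
proof -
  have "((\<lambda>t. \<Sum>j\<le>N. cos_coeff N j * (K (x, t) * exp (\<i> * cos_freq \<alpha> N j * of_real (t - \<tau> * x))))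
      has_integral diag_sum \<tau> N x) {-x..x}"
    unfolding diag_sum_def
    by (intro has_integral_sum has_integral_mult_right transform_exp x) simp
  moreover have "(\<Sum>j\<le>N. cos_coeff N j * (K (x, t) * exp (\<i> * cos_freq \<alpha> N j * of_real (t - \<tau> * x))))
      = K (x, t) * of_real (cos (\<alpha> * (t - \<tau> * x)) ^ N)" for t
    unfolding cos_pow_sum[symmetric] sum_distrib_left by (intro sum.cong refl) simp
  ultimately have "diag_sum \<tau> N x = integral {-x..x} (\<lambda>t. K (x, t) * of_real (cos (\<alpha> * (t - \<tau> * x)) ^ N))"
    by (simp only: integral_unique)
  also have "\<dots> = integral {-x..x} (\<lambda>t. K (x, \<tau> * t) * of_real (cos (\<alpha> * (\<tau> * t - \<tau> * x)) ^ N))"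
    by (rule reflect_integral[OF \<tau>]) (use x in simp)
  finally have eq: "diag_sum \<tau> N x
      = integral {-x..x} (\<lambda>t. K (x, \<tau> * t) * of_real (cos (\<alpha> * (\<tau> * t - \<tau> * x)) ^ N))" .
  have "cos (\<alpha> * (\<tau> * t - \<tau> * x)) = cos (\<alpha> * (t - x))" for t
  proof -
    have "\<alpha> * (\<tau> * t - \<tau> * x) = \<alpha> * (t - x) \<or> \<alpha> * (\<tau> * t - \<tau> * x) = - (\<alpha> * (t - x))"
      using \<tau> by (auto simp: algebra_simps)
    then show ?thesis by (elim disjE) (simp_all only: cos_minus)
  qed
  then show ?thesis unfolding eq by (simp only:)
qed

text \<open>After reflection by \<tau> both sides are treated at the end point t = x. The derivative
  of an even function is odd, so the reflection produces a factor \<tau>, which turns the prefactor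
  -\<tau> into -1.\<close>

lemma diag_deriv_sum_eq:
  assumes x: "x \<in> {0..l}" and \<tau>: "\<tau> = 1 \<or> \<tau> = -1"
  shows "diag_deriv_sum \<tau> N x = - integral {-x..x} (\<lambda>t. K (x, \<tau> * t) * of_real (cos_pow_deriv \<alpha> N (t - x)))"
proof -
  have "((\<lambda>t. \<Sum>j\<le>N. cos_coeff N j * ((- \<i> * of_real \<tau> * cos_freq \<alpha> N j) *
        (K (x, t) * exp (\<i> * cos_freq \<alpha> N j * of_real (t - \<tau> * x)))))
      has_integral (\<Sum>j\<le>N. cos_coeff N j * ((- \<i> * of_real \<tau> * cos_freq \<alpha> N j) * (transform (cos_freq \<alpha> N j) x *
      exp (- \<i> * of_real \<tau> * cos_freq \<alpha> N j * of_real x))))) {-x..x}"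
    by (intro has_integral_sum has_integral_mult_right transform_exp x) simp
  moreover have "(\<Sum>j\<le>N. cos_coeff N j * ((- \<i> * of_real \<tau> * cos_freq \<alpha> N j) *
        (K (x, t) * exp (\<i> * cos_freq \<alpha> N j * of_real (t - \<tau> * x)))))
      = - of_real \<tau> * (K (x, t) * of_real (cos_pow_deriv \<alpha> N (t - \<tau> * x)))" for t
    unfolding cos_pow_deriv_sum[symmetric] sum_distrib_left by (intro sum.cong refl) simp
  moreover have "(\<Sum>j\<le>N. cos_coeff N j * ((- \<i> * of_real \<tau> * cos_freq \<alpha> N j) * (transform (cos_freq \<alpha> N j) x *
      exp (- \<i> * of_real \<tau> * cos_freq \<alpha> N j * of_real x)))) = diag_deriv_sum \<tau> N x"
    unfolding diag_deriv_sum_def by (intro sum.cong refl) simp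
  ultimately have "diag_deriv_sum \<tau> N x
      = integral {-x..x} (\<lambda>t. - of_real \<tau> * (K (x, t) * of_real (cos_pow_deriv \<alpha> N (t - \<tau> * x))))"
    by (simp only: integral_unique)
  also have "\<dots> = integral {-x..x} (\<lambda>t. - of_real \<tau> * (K (x, \<tau> * t) * of_real (cos_pow_deriv \<alpha> N (\<tau> * t - \<tau> * x))))"
    by (rule reflect_integral[OF \<tau>]) (use x in simp)
  finally have eq: "diag_deriv_sum \<tau> N x
      = integral {-x..x} (\<lambda>t. - of_real \<tau> * (K (x, \<tau> * t) * of_real (cos_pow_deriv \<alpha> N (\<tau> * t - \<tau> * x))))" .
  have "- complex_of_real \<tau> * (K (x, \<tau> * t) * of_real (cos_pow_deriv \<alpha> N (\<tau> * t - \<tau> * x)))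
      = - (K (x, \<tau> * t) * of_real (cos_pow_deriv \<alpha> N (t - x)))" for t
    using \<tau>
  proof
    assume "\<tau> = -1"
    then have "\<tau> * t - \<tau> * x = - (t - x)" by simp
    then have "cos_pow_deriv \<alpha> N (\<tau> * t - \<tau> * x) = - cos_pow_deriv \<alpha> N (t - x)"
      by (simp only: cos_pow_deriv_minus)
    with \<open>\<tau> = -1\<close> show ?thesis by simp
  qed simp
  then show ?thesis unfolding eq by (simp only: integral_neg)
qed

text \<open>With E = exp(a x) and a^2 = -\<rho>^2 the quadratic terms in \<open>a\<close> cancel.
  What remains is linear in \<open>a\<close>, that is, at most one derivative of the cosine
  power.\<close>

lemma exp_factor_identity:
  fixes T :: complex
  shows "T * (F1 * (E * (c1 + a * c0)) + F0 * (E * ((c2 + a * c1) + a * (c1 + a * c0))) + - (a * a) * F0 * (E * c0))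
    = T * (E * ((c1 * F1 + F0 * c2) + a * (c0 * F1 + 2 * F0 * c1)))"
  by (simp add: algebra_simps)

text \<open>\<open>transform_weak\<close> for the test functions exp(-i \<tau> \<rho> x) c(x),
  summed over the frequencies with the binomial weights.\<close>

lemma diag_identity:
  assumes c: "test_function {0<..<l} c" and N: "odd N" and \<tau>: "\<tau> = 1 \<or> \<tau> = -1"
  shows "(\<integral>x. diag_sum \<tau> N x * (partial_deriv 1 c x * F' x + F x * partial_deriv 1 (partial_deriv 1 c) x)
      + diag_deriv_sum \<tau> N x * (c x * F' x + 2 * F x * partial_deriv 1 c x) \<partial>M)
    = (\<integral>x. of_real (cos (\<alpha> * ((1 - \<tau>) * x)) ^ N) * c x * F' x \<partial>M)"
proof -
  let ?c1 = "partial_deriv 1 c" and ?c2 = "partial_deriv 1 (partial_deriv 1 c)"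
  let ?\<sigma> = "\<lambda>j. cos_freq \<alpha> N j"
  let ?a = "\<lambda>j. - \<i> * complex_of_real \<tau> * ?\<sigma> j"
  let ?E = "\<lambda>j x. exp (?a j * complex_of_real x)"
  let ?L = "\<lambda>j x. cos_coeff N j * (transform (?\<sigma> j) x * (?E j x * ((?c1 x * F' x + F x * ?c2 x)
      + ?a j * (c x * F' x + 2 * F x * ?c1 x))))"
  let ?R = "\<lambda>j x. cos_coeff N j * (exp (\<i> * ?\<sigma> j * of_real ((1 - \<tau>) * x)) * c x * F' x)"
  note sm = test_function_smooth[OF c]
  note cc = test_cont[OF c]
  have nz: "?\<sigma> j \<noteq> 0" for j using cos_freq_nonzero[OF N] \<alpha>_pos by simp
  have A: "(\<integral>x. ?L j x \<partial>M) = (\<integral>x. ?R j x \<partial>M)" for j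
  proof -
    have tE: "test_function {0<..<l} (\<lambda>x. ?E j x * c x)"
      by (intro test_function_mult c smooth_function_exp)
    have d1: "partial_deriv 1 (\<lambda>x. ?E j x * c x) = (\<lambda>x. ?E j x * (?c1 x + ?a j * c x))"
      by (rule partial_deriv_mult_exp[OF sm])
    have sm1: "smooth_function (\<lambda>x. ?c1 x + ?a j * c x)"
      by (intro smooth_function_simps(2,3) smooth_function_simps(1) smooth_function_partial_deriv sm)
    have d2': "partial_deriv 1 (\<lambda>x. ?c1 x + ?a j * c x) x = ?c2 x + ?a j * ?c1 x" for x
      using partial_deriv_real_eq[OF has_vector_derivative_add[OF
            smooth_function_has_vector_derivative[OF smooth_function_partial_deriv[OF sm]]
            has_vector_derivative_mult_right[OF smooth_function_has_vector_derivative[OF sm]]], of 1]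
      by (simp only: scaleR_one)
    have d2: "partial_deriv 1 (partial_deriv 1 (\<lambda>x. ?E j x * c x))
        = (\<lambda>x. ?E j x * ((?c2 x + ?a j * ?c1 x) + ?a j * (?c1 x + ?a j * c x)))"
      unfolding d1 partial_deriv_mult_exp[OF sm1] d2' by (rule refl)
    have sq: "(?\<sigma> j)\<^sup>2 = - (?a j * ?a j)"
    proof -
      have "complex_of_real \<tau> * of_real \<tau> = 1" using \<tau> by auto
      then have "(\<i> * of_real \<tau> * s) * (\<i> * of_real \<tau> * s) = - (s * s)" for s :: complex
        by (simp only: mult_ac complex_i_mult_minus) (simp add: mult.left_commute[of _ s])
      then show ?thesis by (simp add: power2_eq_square)
    qed
    have "transform (?\<sigma> j) x * (F' x * (?E j x * (?c1 x + ?a j * c x))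
        + F x * (?E j x * ((?c2 x + ?a j * ?c1 x) + ?a j * (?c1 x + ?a j * c x)))
        + (?\<sigma> j)\<^sup>2 * F x * (?E j x * c x))
       = transform (?\<sigma> j) x * (?E j x * ((?c1 x * F' x + F x * ?c2 x) + ?a j * (c x * F' x + 2 * F x * ?c1 x)))" for x
      unfolding sq by (rule exp_factor_identity)
    \<comment> \<open>The free term acquires the frequency (1 - \<tau>) \<rho>: none for \<tau> = 1,
      doubled for \<tau> = -1. This is where the two sides of the triangle part.\<close>
    moreover have "exp (\<i> * ?\<sigma> j * of_real x) * (?E j x * c x) * F' x
        = exp (\<i> * ?\<sigma> j * of_real ((1 - \<tau>) * x)) * c x * F' x" for x
      by (simp add: mult.assoc[symmetric] exp_add[symmetric]) (simp add: algebra_simps)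
    ultimately have "(\<integral>x. transform (?\<sigma> j) x * (?E j x * ((?c1 x * F' x + F x * ?c2 x)
        + ?a j * (c x * F' x + 2 * F x * ?c1 x))) \<partial>M)
      = (\<integral>x. exp (\<i> * ?\<sigma> j * of_real ((1 - \<tau>) * x)) * c x * F' x \<partial>M)"
      using transform_weak[OF tE nz[of j], unfolded d2, unfolded d1] by (simp only:)
    then show ?thesis by simp
  qed
  have iL: "integrable M (?L j)" for j
  proof -
    have "integrable M (\<lambda>x. (cos_coeff N j * transform (?\<sigma> j) x * ?E j x) *
        ((?c1 x * F' x + F x * ?c2 x) + ?a j * (c x * F' x + 2 * F x * ?c1 x)))"
      by (intro integrable_mult_continuous_interval Bochner_Integration.integrable_add integrable_continuous_interval
        Bochner_Integration.integrable_mult_right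
        continuous_on_mult continuous_on_const exp_cont cc F_cont transform_cont[OF nz] F'_integrable)
    then show ?thesis by (simp only: mult.assoc)
  qed
  have iR: "integrable M (?R j)" for j
  proof -
    have "integrable M (\<lambda>x. (cos_coeff N j * exp (\<i> * ?\<sigma> j * of_real ((1 - \<tau>) * x)) * c x) * F' x)"
      by (intro integrable_mult_continuous_interval F'_integrable continuous_intros cc)
    then show ?thesis by (simp only: mult.assoc)
  qed
  have "(\<integral>x. (\<Sum>j\<le>N. ?L j x) \<partial>M) = (\<integral>x. (\<Sum>j\<le>N. ?R j x) \<partial>M)"
    by (simp only: Bochner_Integration.integral_sum iL iR A)
  moreover have "(\<Sum>j\<le>N. ?L j x) = diag_sum \<tau> N x * (?c1 x * F' x + F x * ?c2 x)
      + diag_deriv_sum \<tau> N x * (c x * F' x + 2 * F x * ?c1 x)" for x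
    unfolding diag_sum_def diag_deriv_sum_def sum_distrib_right sum.distrib[symmetric]
    by (intro sum.cong refl) (simp only: algebra_simps)
  moreover have "(\<Sum>j\<le>N. ?R j x) = of_real (cos (\<alpha> * ((1 - \<tau>) * x)) ^ N) * c x * F' x" for x
    unfolding cos_pow_sum[symmetric] sum_distrib_right by (intro sum.cong refl) (simp only: mult.assoc)
  ultimately show ?thesis by (simp only:)
qed

lemma diag_cont:
  assumes "\<tau> = 1 \<or> \<tau> = -1"
  shows "continuous_on {0..l} (\<lambda>x. K (x, \<tau> * x))"
  by (rule continuous_on_compose2[OF K_cont])
    (use assms in \<open>auto simp: goursat_triangle_def intro!: continuous_intros\<close>)

text \<open>The limit of \<open>diag_identity\<close> along odd N: the factor of c'' tends to 0, so
  only first order terms survive, and the differentiated sum tends to the negative of the value of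
  \<open>K\<close> on the side.\<close>

lemma diag_weak:
  assumes c: "test_function {0<..<l} c" and \<tau>: "\<tau> = 1 \<or> \<tau> = -1"
  shows "(\<integral>x. - K (x, \<tau> * x) * (c x * F' x + 2 * F x * partial_deriv 1 c x) \<partial>M)
    = (\<integral>x. (if \<tau> = 1 then 1 else 0) * c x * F' x \<partial>M)"
proof -
  let ?c1 = "partial_deriv 1 c" and ?c2 = "partial_deriv 1 (partial_deriv 1 c)"
  let ?N = "\<lambda>n::nat. 2 * n + 1"
  let ?G = "\<lambda>x. ?c1 x * F' x + F x * ?c2 x" and ?H = "\<lambda>x. c x * F' x + 2 * F x * ?c1 x"
  obtain B where B: "B > 0" "\<And>p. p \<in> goursat_triangle l \<Longrightarrow> cmod (K p) \<le> B"
    using K_bounded by auto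
  note cc = test_cont[OF c]
  have odd: "odd (?N n)" for n by simp
  have nz: "cos_freq \<alpha> (?N n) j \<noteq> 0" for n j using cos_freq_nonzero[OF odd] \<alpha>_pos by simp
  have cK: "continuous_on {-x..x} (\<lambda>t. K (x, \<tau> * t))" if "x \<in> {0..l}" for x
    by (rule continuous_on_compose2[OF K_slice_cont[OF that]])
      (use \<tau> in \<open>auto intro!: continuous_intros\<close>)
  have KB: "cmod (K (x, \<tau> * t)) \<le> B" if "x \<in> {0..l}" "t \<in> {-x..x}" for x t
    using \<tau> that by (intro B(2) triangle_mem) auto
  have iG: "integrable M ?G" and iH: "integrable M ?H"
    by (intro integrable_mult_continuous_interval Bochner_Integration.integrable_add integrable_continuous_interval
      continuous_intros cc F_cont F'_integrable)+
  have mS: "diag_sum \<tau> (?N n) \<in> borel_measurable M" "diag_deriv_sum \<tau> (?N n) \<in> borel_measurable M" for n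
    unfolding diag_sum_def[abs_def] diag_deriv_sum_def[abs_def]
    by (intro continuous_on_measurable_interval continuous_on_sum continuous_on_mult continuous_on_const
        transform_cont[OF nz] exp_cont)+
  have b1: "cmod (diag_sum \<tau> n x) \<le> B * (2 * l)" if x: "x \<in> {0<..<l}" for n x
  proof -
    interpret cp: cos_pow \<alpha> x by (rule cos_pow_interval[OF x])
    have x': "x \<in> {0..l}" using x by simp
    have "cmod (diag_sum \<tau> n x) \<le> B * integral {-x..x} (\<lambda>t. cos (\<alpha> * (t - x)) ^ n)"
      unfolding diag_sum_eq[OF x' \<tau>] by (rule cp.integral_pow_bound[OF cK[OF x'] KB[OF x']])
    also have "\<dots> \<le> B * (2 * l)"
      using cp.integral_pow_le[of n] x B(1) by (intro mult_left_mono) auto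
    finally show ?thesis .
  qed
  have b2: "cmod (diag_deriv_sum \<tau> n x) \<le> B" if x: "x \<in> {0<..<l}" for n x
  proof -
    interpret cp: cos_pow \<alpha> x by (rule cos_pow_interval[OF x])
    have x': "x \<in> {0..l}" using x by simp
    show ?thesis
      unfolding diag_deriv_sum_eq[OF x' \<tau>] norm_minus_cancel
      \<comment> \<open>A constant majorant, slope 0: the kernel has total mass at most 1.\<close>
      using cp.deriv_kernel_bound[of "\<lambda>t. K (x, \<tau> * t)" B 0 n] cK[OF x'] KB[OF x'] B(1) by simp
  qed
  have "(\<lambda>n. \<integral>x. diag_sum \<tau> (?N n) x * ?G x + diag_deriv_sum \<tau> (?N n) x * ?H x \<partial>M)
      \<longlonglongrightarrow> (\<integral>x. - K (x, \<tau> * x) * ?H x \<partial>M)"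
  proof (rule integral_dominated_convergence[where w = "\<lambda>x. B * (2 * l) * cmod (?G x) + B * cmod (?H x)"])
    show "(\<lambda>x. - K (x, \<tau> * x) * ?H x) \<in> borel_measurable M"
      by (rule borel_measurable_times[OF continuous_on_measurable_interval[OF continuous_on_minus[OF diag_cont[OF \<tau>]]]
            borel_measurable_integrable[OF iH]])
    show "(\<lambda>x. diag_sum \<tau> (?N n) x * ?G x + diag_deriv_sum \<tau> (?N n) x * ?H x) \<in> borel_measurable M" for n
      using iG iH by (intro borel_measurable_add borel_measurable_times mS borel_measurable_integrable)
    show "integrable M (\<lambda>x. B * (2 * l) * cmod (?G x) + B * cmod (?H x))"
      by (rule Bochner_Integration.integrable_add[OF Bochner_Integration.integrable_mult_right[OF integrable_norm[OF iG]]
            Bochner_Integration.integrable_mult_right[OF integrable_norm[OF iH]]])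
    show "AE x in M. norm (diag_sum \<tau> (?N n) x * ?G x + diag_deriv_sum \<tau> (?N n) x * ?H x)
        \<le> B * (2 * l) * cmod (?G x) + B * cmod (?H x)" for n
    proof (rule AE_I2)
      fix x assume "x \<in> space M"
      then have x: "x \<in> {0<..<l}" by simp
      show "norm (diag_sum \<tau> (?N n) x * ?G x + diag_deriv_sum \<tau> (?N n) x * ?H x)
        \<le> B * (2 * l) * cmod (?G x) + B * cmod (?H x)"
      proof (rule norm_triangle_le)
        show "norm (diag_sum \<tau> (?N n) x * ?G x) + norm (diag_deriv_sum \<tau> (?N n) x * ?H x)
            \<le> B * (2 * l) * cmod (?G x) + B * cmod (?H x)"
          unfolding norm_mult by (rule add_mono[OF mult_right_mono[OF b1[OF x]] mult_right_mono[OF b2[OF x]]]) simp_all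
      qed
    qed
    show "AE x in M. (\<lambda>n. diag_sum \<tau> (?N n) x * ?G x + diag_deriv_sum \<tau> (?N n) x * ?H x)
        \<longlonglongrightarrow> - K (x, \<tau> * x) * ?H x"
    proof (rule AE_I2)
      fix x assume "x \<in> space M"
      then have x: "x \<in> {0<..<l}" by simp
      interpret cp: cos_pow \<alpha> x by (rule cos_pow_interval[OF x])
      have x': "x \<in> {0..l}" using x by simp
      have "(\<lambda>n. diag_sum \<tau> n x) \<longlonglongrightarrow> 0"
        unfolding diag_sum_eq[OF x' \<tau>] by (rule cp.mult_pow_tendsto[OF cK[OF x'] KB[OF x']])
      from LIMSEQ_subseq_LIMSEQ[OF this odd_seq_strict_mono]
      have 1: "(\<lambda>n. diag_sum \<tau> (?N n) x) \<longlonglongrightarrow> 0" by (simp only: o_def)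
      have "(\<lambda>n. diag_deriv_sum \<tau> n x) \<longlonglongrightarrow> - K (x, \<tau> * x)"
        unfolding diag_deriv_sum_eq[OF x' \<tau>] by (intro tendsto_minus cp.mult_deriv_tendsto cK[OF x'])
      from LIMSEQ_subseq_LIMSEQ[OF this odd_seq_strict_mono]
      have 2: "(\<lambda>n. diag_deriv_sum \<tau> (?N n) x) \<longlonglongrightarrow> - K (x, \<tau> * x)" by (simp only: o_def)
      show "(\<lambda>n. diag_sum \<tau> (?N n) x * ?G x + diag_deriv_sum \<tau> (?N n) x * ?H x)
        \<longlonglongrightarrow> - K (x, \<tau> * x) * ?H x"
        using tendsto_add[OF tendsto_mult_right[OF 1, of "?G x"] tendsto_mult_right[OF 2, of "?H x"]] by simp
    qed
  qed
  moreover have "(\<lambda>n. \<integral>x. of_real (cos (\<alpha> * ((1 - \<tau>) * x)) ^ (?N n)) * c x * F' x \<partial>M)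
      \<longlonglongrightarrow> (\<integral>x. (if \<tau> = 1 then 1 else 0) * c x * F' x \<partial>M)"
  \<comment> \<open>For \<tau> = 1 the cosine is evaluated at 0 and equals 1 for every N; for \<tau>
    = -1 it is evaluated at 2 \<alpha> x, strictly between 0 and pi / 2, and its powers die
    out.\<close>
  proof (cases "\<tau> = 1")
    case True
    then show ?thesis by simp
  next
    case False
    with \<tau> have \<tau>': "\<tau> = -1" by simp
    have icF: "integrable M (\<lambda>x. c x * F' x)"
      by (intro integrable_mult_continuous_interval cc F'_integrable)
    have "(\<lambda>n. \<integral>x. of_real (cos (\<alpha> * (2 * x)) ^ (?N n)) * (c x * F' x) \<partial>M) \<longlonglongrightarrow> (\<integral>x. 0 \<partial>M)"
    proof (rule integral_dominated_convergence[where w = "\<lambda>x. cmod (c x * F' x)"])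
      show "(\<lambda>x. of_real (cos (\<alpha> * (2 * x)) ^ (?N n)) * (c x * F' x)) \<in> borel_measurable M" for n
        using icF by (intro borel_measurable_times continuous_on_measurable_interval continuous_intros
            borel_measurable_integrable)
      show "AE x in M. norm (of_real (cos (\<alpha> * (2 * x)) ^ (?N n)) * (c x * F' x)) \<le> cmod (c x * F' x)" for n
      proof (rule AE_I2)
        fix x
        have "\<bar>cos (\<alpha> * (2 * x)) ^ (?N n)\<bar> \<le> 1"
          unfolding power_abs by (intro power_le_one) auto
        then show "norm (of_real (cos (\<alpha> * (2 * x)) ^ (?N n)) * (c x * F' x)) \<le> cmod (c x * F' x)"
          using mult_right_mono[of _ 1 "cmod (c x * F' x)"] by (simp only: norm_mult norm_of_real) fastforce
      qed
      show "AE x in M. (\<lambda>n. of_real (cos (\<alpha> * (2 * x)) ^ (?N n)) * (c x * F' x)) \<longlonglongrightarrow> 0"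
      proof (rule AE_I2)
        fix x assume "x \<in> space M"
        then have x: "x \<in> {0<..<l}" by simp
        interpret cp: cos_pow \<alpha> x by (rule cos_pow_interval[OF x])
        have "(\<lambda>n. cos (\<alpha> * (2 * x)) ^ (?N n)) \<longlonglongrightarrow> 0"
          using LIMSEQ_subseq_LIMSEQ[OF cp.cos_2x_tendsto odd_seq_strict_mono] by (simp only: o_def)
        then have "(\<lambda>n. complex_of_real (cos (\<alpha> * (2 * x)) ^ (?N n))) \<longlonglongrightarrow> of_real 0"
          by (rule tendsto_of_real)
        from tendsto_mult_right[OF this, of "c x * F' x"]
        show "(\<lambda>n. of_real (cos (\<alpha> * (2 * x)) ^ (?N n)) * (c x * F' x)) \<longlonglongrightarrow> 0" by simp
      qed
    qed (use icF in auto)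
    then show ?thesis using \<tau>' by (simp add: mult.assoc)
  qed
  ultimately show ?thesis
    unfolding diag_identity[OF c odd \<tau>] by (rule LIMSEQ_unique)
qed


section \<open>The value of the kernel at the vertex and on the sides\<close>

text \<open>At 0 both exp(i x) and \<open>e 1\<close> have value 1 and derivative i, so their
  difference is o(x). The frequency 1 is an arbitrary nonzero choice.\<close>

lemma transform_small:
  assumes "\<epsilon> > 0"
  obtains \<delta> where "\<delta> > 0" "\<And>x. x \<in> {0..l} \<Longrightarrow> x < \<delta> \<Longrightarrow> cmod (transform 1 x) \<le> \<epsilon> * x"
proof -
  from e_sol[of 1] obtain v where v: "weak_deriv {0<..<l} 1 (e 1) v" "continuous_on {0..l} v" "v 0 = \<i>"
    unfolding impedance_exp_solution_def by auto
  have e: "e 1 x = 1 + integral {0..x} v" if "x \<in> {0..l}" for x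
    using weak_derivative_imp_indefinite_integral[OF l_pos e_cont weak_deriv_interval[OF v(1)] that] e_0 by simp
  have "((\<lambda>x. 1 + integral {0..x} v) has_vector_derivative 0 + v 0) (at 0 within {0..l})"
    using l_pos v(2) by (intro has_vector_derivative_add has_vector_derivative_const integral_has_vector_derivative) auto
  then have "(e 1 has_vector_derivative 0 + v 0) (at 0 within {0..l})"
    by (rule has_vector_derivative_transform[rotated 2]) (use l_pos e in auto)
  then have "((\<lambda>x. (exp (\<i> * of_real x) - e 1 x) * (1 / \<i>)) has_vector_derivative
      (\<i> * exp (\<i> * of_real 0) - (0 + v 0)) * (1 / \<i>)) (at 0 within {0..l})"
    by (intro has_vector_derivative_mult_left has_vector_derivative_diff has_vector_derivative_cexp)
  then have "((\<lambda>x. (exp (\<i> * of_real x) - e 1 x) * (1 / \<i>)) has_vector_derivative 0) (at 0 within {0..l})"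
    using v(3) by simp
  then have "(transform 1 has_vector_derivative 0) (at 0 within {0..l})"
    by (rule has_vector_derivative_transform[rotated 2]) (use l_pos in \<open>simp_all add: transform_eq\<close>)
  then have "\<forall>\<epsilon>>0. \<exists>\<delta>>0. \<forall>y\<in>{0..l}. norm (y - 0) < \<delta> \<longrightarrow>
      norm (transform 1 y - transform 1 0 - (y - 0) *\<^sub>R 0) \<le> \<epsilon> * norm (y - 0)"
    unfolding has_vector_derivative_def has_derivative_within_alt by simp
  then obtain \<delta> where "\<delta> > 0" "\<forall>y\<in>{0..l}. norm (y - 0) < \<delta> \<longrightarrow>
      norm (transform 1 y - transform 1 0 - (y - 0) *\<^sub>R 0) \<le> \<epsilon> * norm (y - 0)"
    using assms by auto
  moreover have "transform 1 0 = 0" by (simp add: transform_def)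
  ultimately show thesis using that[of \<delta>] by simp
qed

text \<open>By continuity the transform over [-x, x] is 2 x K(0, 0) + o(x), which contradicts
  \<open>transform_small\<close> unless the vertex value is 0.\<close>

lemma K_vertex: "K (0, 0) = 0"
proof (rule ccontr)
  let ?k = "K (0, 0)"
  assume nz: "?k \<noteq> 0"
  \<comment> \<open>The final comparison reads 2 |k| x \<le> 3 \<epsilon> x, that is 8 \<epsilon>
    \<le> 3 \<epsilon>.\<close>
  define \<epsilon> where "\<epsilon> = cmod ?k / 4"
  have \<epsilon>: "\<epsilon> > 0" using nz by (simp add: \<epsilon>_def)
  obtain \<delta>1 where \<delta>1: "\<delta>1 > 0" "\<And>x. x \<in> {0..l} \<Longrightarrow> x < \<delta>1 \<Longrightarrow> cmod (transform 1 x) \<le> \<epsilon> * x"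
    by (rule transform_small[OF \<epsilon>]) (rule that)
  let ?G = "\<lambda>p. K p * exp (\<i> * of_real (snd p))"
  have "continuous_on (goursat_triangle l) ?G"
    by (intro continuous_intros K_cont)
  moreover have "(0, 0) \<in> goursat_triangle l" using l_pos by (simp add: goursat_triangle_def)
  ultimately have "\<exists>\<delta>>0. \<forall>p\<in>goursat_triangle l. dist p (0, 0) < \<delta> \<longrightarrow> dist (?G p) (?G (0, 0)) < \<epsilon>"
    using \<epsilon> unfolding continuous_on_iff by blast
  then obtain \<delta>2 where \<delta>2: "\<delta>2 > 0"
    "\<And>p. p \<in> goursat_triangle l \<Longrightarrow> dist p (0, 0) < \<delta>2 \<Longrightarrow> dist (?G p) (?G (0, 0)) < \<epsilon>" by auto
  \<comment> \<open>Points (x, t) with |t| \<le> x are within 2 x of the vertex, so 2 x has to stay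
    below \<delta>2.\<close>
  define x where "x = min l (min \<delta>1 \<delta>2 / 4)"
  have x: "0 < x" "x \<le> l" "x < \<delta>1" "2 * x < \<delta>2"
    using l_pos \<delta>1 \<delta>2 by (auto simp: x_def min_def)
  then have x': "x \<in> {0..l}" by simp
  have cK: "(\<lambda>t. K (x, t) * exp (\<i> * 1 * of_real t)) integrable_on {-x..x}"
    by (intro integrable_continuous_real continuous_on_mult K_slice_cont x' exp_cont)
  have "transform 1 x - ?k * (2 * of_real x) = integral {-x..x} (\<lambda>t. K (x, t) * exp (\<i> * 1 * of_real t) - ?k)"
    using Henstock_Kurzweil_Integration.integral_diff[OF cK integrable_const_ivl[of ?k "-x" x]] x
    by (simp add: transform_def scaleR_conv_of_real mult.commute)
  also have "cmod \<dots> \<le> integral {-x..x} (\<lambda>t. \<epsilon>)"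
  proof (rule integral_norm_bound_integral)
    fix t assume t: "t \<in> {-x..x}"
    have "dist (x, t) (0, 0) \<le> \<bar>x\<bar> + \<bar>t\<bar>"
      using norm_Pair_le[of x t] by (simp add: dist_norm)
    also have "\<dots> < \<delta>2" using t x by auto
    finally have "dist (?G (x, t)) (?G (0, 0)) < \<epsilon>"
      by (intro \<delta>2 triangle_mem x' t)
    then show "cmod (K (x, t) * exp (\<i> * 1 * of_real t) - ?k) \<le> \<epsilon>"
      by (simp add: dist_norm)
  qed (use cK in \<open>auto intro: Henstock_Kurzweil_Integration.integrable_diff\<close>)
  also have "\<dots> = \<epsilon> * (2 * x)" using x by simp
  finally have "cmod (?k * (2 * of_real x)) \<le> cmod (transform 1 x) + \<epsilon> * (2 * x)"
    using norm_triangle_ineq2[of "?k * (2 * of_real x)" "transform 1 x"] by (simp add: norm_minus_commute)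
  also have "\<dots> \<le> \<epsilon> * x + \<epsilon> * (2 * x)"
    using \<delta>1(2)[OF x'] x by simp
  finally have "4 * \<epsilon> * (2 * x) \<le> 3 * \<epsilon> * x"
    using x by (simp add: norm_mult \<epsilon>_def)
  then show False using mult_pos_pos[OF \<epsilon> x(1)] by (simp add: mult.assoc)
qed

text \<open>Testing \<open>diag_weak\<close> with \<psi> / f makes the terms with the derivative of
  \<open>f\<close> cancel, because F = f^2: the left side becomes -2 \<kappa> f \<psi>', and by
  parts the right side becomes -2 s f \<psi>'. Hence (\<kappa> - s) f has weak derivative 0.\<close>

lemma goursat_condition:
  assumes \<tau>: "\<tau> = 1 \<or> \<tau> = -1" and x: "x \<in> {0..l}"
  shows "K (x, \<tau> * x) = (if \<tau> = 1 then 1 - 1 / f x else 0)"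
proof -
  define s :: complex where "s = (if \<tau> = 1 then 1 else 0)"
  let ?\<kappa> = "\<lambda>x. K (x, \<tau> * x)"
  note c\<kappa> = diag_cont[OF \<tau>]
  obtain p p' where f: "smooth_approx l f g p p'" by (rule f_approx)
  note ig = smooth_approxD(5)[OF f]
  \<comment> \<open>\<psi> / f need not be smooth; the products of \<psi> with these approximants
    are test functions.\<close>
  obtain q q' where q: "smooth_approx l (\<lambda>x. 1 / f x) (\<lambda>x. - 1 / (f x)\<^sup>2 * g x) q q'"
    using smooth_approx_inverse[OF l_pos f f_nz] by metis
  have "(?\<kappa> x - s) * f x = (?\<kappa> 0 - s) * f 0"
  proof (rule integral_test_deriv_zero_imp_constant[OF l_pos _ _ x])
    show "continuous_on {0..l} (\<lambda>x. (?\<kappa> x - s) * f x)" by (intro continuous_intros c\<kappa> f_cont)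
    fix \<psi> assume \<psi>: "test_function {0<..<l} \<psi>"
    let ?d = "partial_deriv 1 \<psi>"
    note cc = test_cont[OF \<psi>]
    have cq: "continuous_on {0..l} (q n)" "continuous_on {0..l} (q' n)" for n
      by (intro smooth_function_continuous smooth_approxD[OF q])+
    have i1: "integrable M (\<lambda>x. - ?\<kappa> x * (\<psi> x * F' x + 2 * F x * ?d x))"
      by (intro integrable_mult_continuous_interval Bochner_Integration.integrable_add integrable_continuous_interval
        continuous_on_minus continuous_on_mult continuous_on_const c\<kappa> cc F_cont F'_integrable)
    have i3: "integrable M (\<lambda>x. s * \<psi> x * F' x)"
      by (intro integrable_mult_continuous_interval continuous_intros cc F'_integrable)
    have eq: "(\<integral>x. q n x * (- ?\<kappa> x * (\<psi> x * F' x + 2 * F x * ?d x)) \<partial>M)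
        + (\<integral>x. (- ?\<kappa> x * (2 * F x * \<psi> x)) * q' n x \<partial>M) = (\<integral>x. q n x * (s * \<psi> x * F' x) \<partial>M)" for n
    proof -
      have "(\<integral>x. - ?\<kappa> x * (q n x * \<psi> x * F' x + 2 * F x * (q n x * ?d x + q' n x * \<psi> x)) \<partial>M)
          = (\<integral>x. s * (q n x * \<psi> x) * F' x \<partial>M)"
        using diag_weak[OF test_function_mult[OF \<psi> smooth_approxD(1)[OF q]] \<tau>, of n]
        by (simp only: partial_deriv_mult[OF smooth_approxD(1)[OF q] test_function_smooth[OF \<psi>]]
            smooth_approxD(7)[OF q] s_def)
      moreover have "(\<integral>x. - ?\<kappa> x * (q n x * \<psi> x * F' x + 2 * F x * (q n x * ?d x + q' n x * \<psi> x)) \<partial>M)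
          = (\<integral>x. q n x * (- ?\<kappa> x * (\<psi> x * F' x + 2 * F x * ?d x)) + (- ?\<kappa> x * (2 * F x * \<psi> x)) * q' n x \<partial>M)"
        by (rule Bochner_Integration.integral_cong) (simp_all only: algebra_simps)
      moreover have "\<dots> = (\<integral>x. q n x * (- ?\<kappa> x * (\<psi> x * F' x + 2 * F x * ?d x)) \<partial>M)
          + (\<integral>x. (- ?\<kappa> x * (2 * F x * \<psi> x)) * q' n x \<partial>M)"
        by (intro Bochner_Integration.integral_add integrable_mult_continuous_interval[OF cq(1) i1]
            integrable_continuous_interval continuous_on_minus continuous_on_mult continuous_on_const c\<kappa> cc F_cont cq)
      ultimately show ?thesis by (simp only: mult_ac)
    qed
    have "(\<lambda>n. (\<integral>x. q n x * (- ?\<kappa> x * (\<psi> x * F' x + 2 * F x * ?d x)) \<partial>M)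
        + (\<integral>x. (- ?\<kappa> x * (2 * F x * \<psi> x)) * q' n x \<partial>M))
      \<longlonglongrightarrow> (\<integral>x. 1 / f x * (- ?\<kappa> x * (\<psi> x * F' x + 2 * F x * ?d x)) \<partial>M)
        + (\<integral>x. (- ?\<kappa> x * (2 * F x * \<psi> x)) * (- 1 / (f x)\<^sup>2 * g x) \<partial>M)"
      by (intro tendsto_add smooth_approx_tendsto_integral[OF q i1]
          smooth_approx_tendsto_integral_deriv_continuous[OF q]
          continuous_on_minus continuous_on_mult continuous_on_const c\<kappa> cc F_cont)
    moreover have "(\<lambda>n. \<integral>x. q n x * (s * \<psi> x * F' x) \<partial>M) \<longlonglongrightarrow> (\<integral>x. 1 / f x * (s * \<psi> x * F' x) \<partial>M)"
      by (rule smooth_approx_tendsto_integral[OF q i3])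
    ultimately have lim: "(\<integral>x. 1 / f x * (- ?\<kappa> x * (\<psi> x * F' x + 2 * F x * ?d x)) \<partial>M)
        + (\<integral>x. (- ?\<kappa> x * (2 * F x * \<psi> x)) * (- 1 / (f x)\<^sup>2 * g x) \<partial>M)
        = (\<integral>x. 1 / f x * (s * \<psi> x * F' x) \<partial>M)"
      unfolding eq by (rule LIMSEQ_unique)
    have R: "(\<integral>x. 1 / f x * (s * \<psi> x * F' x) \<partial>M) = - (\<integral>x. 2 * s * (f x * ?d x) \<partial>M)"
    proof -
      have "(\<integral>x. 1 / f x * (s * \<psi> x * F' x) \<partial>M) = (\<integral>x. 2 * s * (\<psi> x * g x) \<partial>M)"
        by (rule Bochner_Integration.integral_cong) (use f_nz in \<open>simp_all add: F'_def field_simps\<close>)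
      also have "\<dots> = 2 * s * (\<integral>x. \<psi> x * g x \<partial>M)" by (rule integral_mult_right_zero)
      also have "\<dots> = - (2 * s * (\<integral>x. f x * ?d x \<partial>M))"
        using smooth_approx_by_parts[OF l_pos f \<psi>] by simp
      finally show ?thesis by (simp only: integral_mult_right_zero)
    qed
    have i4: "integrable M (\<lambda>x. 1 / f x * (- ?\<kappa> x * (\<psi> x * F' x + 2 * F x * ?d x)))"
      using f_nz by (intro integrable_mult_continuous_interval[OF _ i1] continuous_intros f_cont) auto
    have c2: "continuous_on {0..l} (\<lambda>x. - 1 / (f x)\<^sup>2)" using f_nz by (intro continuous_intros f_cont) auto
    have i5: "integrable M (\<lambda>x. (- ?\<kappa> x * (2 * F x * \<psi> x)) * (- 1 / (f x)\<^sup>2 * g x))"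
      by (intro integrable_mult_continuous_interval c2 ig
          continuous_on_minus continuous_on_mult continuous_on_const c\<kappa> cc F_cont)
    have "(\<integral>x. 1 / f x * (- ?\<kappa> x * (\<psi> x * F' x + 2 * F x * ?d x))
        + (- ?\<kappa> x * (2 * F x * \<psi> x)) * (- 1 / (f x)\<^sup>2 * g x) \<partial>M) = - (\<integral>x. 2 * s * (f x * ?d x) \<partial>M)"
      using lim R by (simp only: Bochner_Integration.integral_add[OF i4 i5])
    \<comment> \<open>The contribution 2 \<psi> g of F' / f is cancelled by the derivative of 1 / f
      multiplied by 2 F \<psi>.\<close>
    moreover have "(\<integral>x. 1 / f x * (- ?\<kappa> x * (\<psi> x * F' x + 2 * F x * ?d x))
        + (- ?\<kappa> x * (2 * F x * \<psi> x)) * (- 1 / (f x)\<^sup>2 * g x) \<partial>M) = (\<integral>x. - (2 * ?\<kappa> x * (f x * ?d x)) \<partial>M)"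
      by (rule Bochner_Integration.integral_cong)
        (use f_nz in \<open>simp_all add: F'_def F_def power2_eq_square field_simps\<close>)
    ultimately have L: "(\<integral>x. - (2 * ?\<kappa> x * (f x * ?d x)) \<partial>M) = - (\<integral>x. 2 * s * (f x * ?d x) \<partial>M)" by (simp only:)
    have "(\<integral>x. - (2 * ?\<kappa> x * (f x * ?d x)) + 2 * s * (f x * ?d x) \<partial>M)
        = (\<integral>x. - (2 * ?\<kappa> x * (f x * ?d x)) \<partial>M) + (\<integral>x. 2 * s * (f x * ?d x) \<partial>M)"
      by (intro Bochner_Integration.integral_add integrable_continuous_interval
          continuous_on_minus continuous_on_mult continuous_on_const c\<kappa> cc f_cont)
    then have "(\<integral>x. - 2 * ((?\<kappa> x - s) * f x * ?d x) \<partial>M) = 0"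
      unfolding L by (simp add: algebra_simps)
    then show "(\<integral>x. (?\<kappa> x - s) * f x * ?d x \<partial>M) = 0"
      unfolding integral_mult_right_zero by simp
  qed
  \<comment> \<open>The constant is read off at 0, where \<kappa> is the vertex value 0 and
    \<open>f\<close> is 1.\<close>
  then have "(?\<kappa> x - s) * f x = - s" using K_vertex f_0 by simp
  then have "?\<kappa> x = s - s / f x" using f_nz[OF x] by (simp add: field_simps)
  then show ?thesis by (simp add: s_def)
qed

end

section \<open>The cosine approximate identity\<close>

locale cos_kernel =
  fixes l \<alpha> :: real
  assumes l: "0 < l" and \<alpha>: "\<alpha> = pi / (4 * l)"
begin

definition mass :: "nat \<Rightarrow> real" where
  "mass N = integral {-(2*l)..2*l} (\<lambda>u. cos (\<alpha> * u) ^ N)"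

lemma cos_nonneg: "u \<in> {-(2*l)..2*l} \<Longrightarrow> 0 \<le> cos (\<alpha> * u)"
proof -
  assume u: "u \<in> {-(2*l)..2*l}"
  have a: "\<alpha> > 0" and e: "\<alpha> * (2 * l) = pi / 2" using l by (simp_all add: \<alpha>)
  have "\<alpha> * u \<le> \<alpha> * (2 * l)" "\<alpha> * (- (2 * l)) \<le> \<alpha> * u"
    using u a by (intro mult_left_mono; simp)+
  then show ?thesis unfolding mult_minus_right e by (intro cos_ge_zero)
qed

lemma pow_integrable: "(\<lambda>u. cos (\<alpha> * u) ^ N) integrable_on {-(2*l)..2*l}"
  by (intro integrable_continuous_real continuous_intros)

lemma mass_pos: "mass N > 0"
proof -
  have nn: "0 \<le> cos (\<alpha> * u) ^ N" if "u \<in> cbox (-(2*l)) (2*l)" for u using cos_nonneg that by simp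
  have "0 \<le> mass N"
    unfolding mass_def using nn by (intro integral_nonneg pow_integrable) simp
  moreover have "mass N \<noteq> 0"
  proof
    assume "mass N = 0"
    then have "integral (cbox (-(2*l)) (2*l)) (\<lambda>u. cos (\<alpha> * u) ^ N) = 0" by (simp add: mass_def)
    then have "\<forall>u\<in>cbox (-(2*l)) (2*l). cos (\<alpha> * u) ^ N = 0"
      using l nn by (subst (asm) integral_cbox_eq_0_iff) (auto intro!: continuous_intros)
    then have "cos (\<alpha> * 0) ^ N = 0" using l by (intro bspec[where x = 0]) auto
    then show False by simp
  qed
  ultimately show ?thesis by simp
qed

text \<open>The derivative of sin(\<alpha> u) cos(\<alpha> u)^(N+1) is \<alpha> (cos^N - (N + 2)
  sin^2 cos^N), and the boundary terms vanish as \<alpha> (2 l) = pi / 2. This second moment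
  measures concentration at 0 without any asymptotics of the mass.\<close>

lemma sin_square_mass:
  "integral {-(2*l)..2*l} (\<lambda>u. (sin (\<alpha> * u))\<^sup>2 * cos (\<alpha> * u) ^ N) = mass N / (real N + 2)"
proof -
  let ?s = "\<lambda>u. (sin (\<alpha> * u))\<^sup>2 * cos (\<alpha> * u) ^ N"
  have s: "(\<lambda>u. (real N + 2) * ?s u) integrable_on {-(2*l)..2*l}"
    by (intro integrable_continuous_real continuous_intros)
  have "((\<lambda>u. \<alpha> * (cos (\<alpha> * u) ^ N - (real N + 2) * ?s u)) has_integral
      (sin (\<alpha> * (2*l)) * cos (\<alpha> * (2*l)) ^ Suc N - sin (\<alpha> * (-(2*l))) * cos (\<alpha> * (-(2*l))) ^ Suc N)) {-(2*l)..2*l}"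
  proof (rule fundamental_theorem_of_calculus)
    fix u
    have "((\<lambda>u. sin (\<alpha> * u) * cos (\<alpha> * u) ^ Suc N) has_real_derivative
        (\<alpha> * cos (\<alpha> * u)) * cos (\<alpha> * u) ^ Suc N
          + sin (\<alpha> * u) * (real (Suc N) * cos (\<alpha> * u) ^ N * (- sin (\<alpha> * u) * \<alpha>))) (at u within {-(2*l)..2*l})"
      by (auto intro!: derivative_eq_intros simp del: power_Suc simp: algebra_simps)
    moreover have "(\<alpha> * cos (\<alpha> * u)) * cos (\<alpha> * u) ^ Suc N
          + sin (\<alpha> * u) * (real (Suc N) * cos (\<alpha> * u) ^ N * (- sin (\<alpha> * u) * \<alpha>))
        = \<alpha> * ((cos (\<alpha> * u))\<^sup>2 * cos (\<alpha> * u) ^ N - (real N + 1) * ?s u)"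
      by (simp add: power2_eq_square algebra_simps)
    moreover have "\<dots> = \<alpha> * (cos (\<alpha> * u) ^ N - (real N + 2) * ?s u)"
      unfolding cos_squared_eq by (simp add: algebra_simps)
    ultimately show "((\<lambda>u. sin (\<alpha> * u) * cos (\<alpha> * u) ^ Suc N) has_vector_derivative
        \<alpha> * (cos (\<alpha> * u) ^ N - (real N + 2) * ?s u)) (at u within {-(2*l)..2*l})"
      by (simp only: has_real_derivative_iff_has_vector_derivative)
  qed (use l in simp)
  moreover have "\<alpha> * (2*l) = pi / 2" using l by (simp add: \<alpha>)
  ultimately have "((\<lambda>u. \<alpha> * (cos (\<alpha> * u) ^ N - (real N + 2) * ?s u)) has_integral 0) {-(2*l)..2*l}"
    by simp
  then have "integral {-(2*l)..2*l} (\<lambda>u. \<alpha> * (cos (\<alpha> * u) ^ N - (real N + 2) * ?s u)) = 0"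
    by (rule integral_unique)
  then have "integral {-(2*l)..2*l} (\<lambda>u. cos (\<alpha> * u) ^ N - (real N + 2) * ?s u) = 0"
    using l by (simp add: \<alpha>)
  then have "mass N = (real N + 2) * integral {-(2*l)..2*l} ?s"
    unfolding mass_def using Henstock_Kurzweil_Integration.integral_diff[OF pow_integrable s] by simp
  then show ?thesis by simp
qed

definition conv :: "nat \<Rightarrow> (real \<Rightarrow> complex) \<Rightarrow> real \<Rightarrow> complex" where
  "conv N \<psi> t = integral {-l..l} (\<lambda>s. \<psi> s * of_real (cos (\<alpha> * (t - s)) ^ N))"

text \<open>Substitution u = t - s. For |t| \<le> l the interval [t - 2 l, t + 2 l] contains
  [-l, l], outside of which \<psi> vanishes, so the domain no longer depends on t.\<close>

lemma conv_eq:
  assumes \<psi>: "continuous_on UNIV \<psi>" and supp: "\<forall>s. s \<notin> {-l..l} \<longrightarrow> \<psi> s = 0" and t: "t \<in> {-l..l}"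
  shows "conv N \<psi> t = integral {-(2*l)..2*l} (\<lambda>u. \<psi> (t - u) * of_real (cos (\<alpha> * u) ^ N))"
proof -
  let ?g = "\<lambda>s. \<psi> s * complex_of_real (cos (\<alpha> * (t - s)) ^ N)"
  have c\<psi>: "continuous_on S \<psi>" for S using \<psi> continuous_on_subset by blast
  have cg: "continuous_on S ?g" for S by (intro continuous_intros c\<psi>)
  have "(?g has_integral conv N \<psi> t) {-l..l}"
    unfolding conv_def by (intro integrable_integral integrable_continuous_real cg)
  then have "(?g has_integral conv N \<psi> t) {-(2*l) + t..2*l + t}"
    by (rule has_integral_on_superset) (use supp t in auto)
  then have "conv N \<psi> t = integral {-(2*l) + t..2*l + t} ?g" by (simp add: integral_unique)
  also have "\<dots> = integral {-(2*l)..2*l} (?g \<circ> (\<lambda>x. x + t))"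
    by (rule integral_shift[symmetric, OF cg])
  also have "\<dots> = integral {-(2*l)..2*l} (\<lambda>u. (?g \<circ> (\<lambda>x. x + t)) (- u))"
    using Henstock_Kurzweil_Integration.integral_reflect_real[of "2*l" "-(2*l)" "?g \<circ> (\<lambda>x. x + t)"] by simp
  finally show ?thesis by (simp add: o_def)
qed

lemma conv_bounded:
  assumes \<psi>: "continuous_on UNIV \<psi>" and supp: "\<forall>s. s \<notin> {-l..l} \<longrightarrow> \<psi> s = 0" and t: "t \<in> {-l..l}"
    and B: "\<And>s. cmod (\<psi> s) \<le> B"
  shows "cmod (conv N \<psi> t) \<le> B * mass N"
proof -
  have c\<psi>: "continuous_on S (\<lambda>u. \<psi> (t - u))" for S
    by (rule continuous_on_compose2[OF \<psi>]) (auto intro!: continuous_intros)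
  have "cmod (integral {-(2*l)..2*l} (\<lambda>u. \<psi> (t - u) * of_real (cos (\<alpha> * u) ^ N)))
      \<le> integral {-(2*l)..2*l} (\<lambda>u. B * cos (\<alpha> * u) ^ N)"
  proof (rule integral_norm_bound_integral)
    show "(\<lambda>u. \<psi> (t - u) * of_real (cos (\<alpha> * u) ^ N)) integrable_on {-(2*l)..2*l}"
      by (intro integrable_continuous_real continuous_intros c\<psi>)
    show "(\<lambda>u. B * cos (\<alpha> * u) ^ N) integrable_on {-(2*l)..2*l}"
      by (intro integrable_continuous_real continuous_intros)
    show "cmod (\<psi> (t - u) * of_real (cos (\<alpha> * u) ^ N)) \<le> B * cos (\<alpha> * u) ^ N" if "u \<in> {-(2*l)..2*l}" for u
      using mult_right_mono[OF B[of "t - u"]] cos_nonneg[OF that]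
      by (simp only: norm_mult norm_of_real abs_of_nonneg zero_le_power)
  qed
  then show ?thesis unfolding conv_eq[OF \<psi> supp t] by (simp add: mass_def)
qed

text \<open>A Chebyshev argument: |\<psi>(t - u) - \<psi>(t)| is at most r / 2 + D sin(\<alpha>
  u)^2, and the mean of sin^2 under the normalised kernel is 1 / (N + 2).\<close>

lemma conv_tendsto:
  assumes \<psi>: "continuous_on UNIV \<psi>" and supp: "\<forall>s. s \<notin> {-l..l} \<longrightarrow> \<psi> s = 0" and t: "t \<in> {-l..l}"
    and B: "\<And>s. cmod (\<psi> s) \<le> B"
  shows "(\<lambda>N. conv N \<psi> t / of_real (mass N)) \<longlonglongrightarrow> \<psi> t"
proof (rule LIMSEQ_I)
  fix r :: real assume r: "r > 0"
  have c\<psi>: "continuous_on S (\<lambda>u. \<psi> (t - u))" for S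
    by (rule continuous_on_compose2[OF \<psi>]) (auto intro!: continuous_intros)
  have B0: "0 \<le> B" using B[of 0] norm_ge_zero order_trans by blast
  have "\<exists>\<delta>>0. \<forall>s\<in>UNIV. dist s t < \<delta> \<longrightarrow> dist (\<psi> s) (\<psi> t) < r / 2"
    using \<psi>[unfolded continuous_on_iff, rule_format, of t "r / 2"] r by simp
  then obtain \<delta>0 :: real where \<delta>0: "\<delta>0 > 0" "\<And>s. dist s t < \<delta>0 \<Longrightarrow> dist (\<psi> s) (\<psi> t) < r / 2" by auto
  \<comment> \<open>The cap at 2 l keeps \<alpha> \<delta> in (0, pi / 2], where the sine is
    positive and increasing.\<close>
  define \<delta> where "\<delta> = min \<delta>0 (2 * l)"
  have \<delta>: "0 < \<delta>" "\<delta> \<le> 2 * l" "\<And>s. dist s t < \<delta> \<Longrightarrow> dist (\<psi> s) (\<psi> t) < r / 2"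
    using \<delta>0 l by (auto simp: \<delta>_def)
  have \<alpha>0: "\<alpha> > 0" and \<alpha>l: "\<alpha> * (2 * l) = pi / 2" using l by (simp_all add: \<alpha>)
  have s\<delta>: "sin (\<alpha> * \<delta>) > 0"
  proof (rule sin_gt_zero)
    have "\<alpha> * \<delta> \<le> \<alpha> * (2 * l)" using \<delta> \<alpha>0 by (intro mult_left_mono) auto
    then show "\<alpha> * \<delta> < pi" using \<alpha>l pi_gt_zero by linarith
  qed (use \<delta> \<alpha>0 in simp)
  \<comment> \<open>Chosen so that D sin^2 is at least 2 B, the largest possible oscillation of
    \<psi>, as soon as |u| \<ge> \<delta>.\<close>
  define D where "D = 2 * B / (sin (\<alpha> * \<delta>))\<^sup>2"
  have D: "D \<ge> 0" using B0 by (simp add: D_def)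
  have bound: "cmod (\<psi> (t - u) - \<psi> t) \<le> r / 2 + D * (sin (\<alpha> * u))\<^sup>2" if u: "u \<in> {-(2*l)..2*l}" for u
  proof (cases "\<bar>u\<bar> < \<delta>")
    case True
    then have "cmod (\<psi> (t - u) - \<psi> t) < r / 2" using \<delta>(3)[of "t - u"] by (simp add: dist_norm)
    moreover have "D * (sin (\<alpha> * u))\<^sup>2 \<ge> 0" using D by simp
    ultimately show ?thesis by linarith
  next
    case False
    have "sin (\<alpha> * \<delta>) \<le> sin (\<alpha> * \<bar>u\<bar>)"
    proof (rule sin_monotone_2pi_le)
      show "\<alpha> * \<delta> \<le> \<alpha> * \<bar>u\<bar>" using False \<alpha>0 by simp
      have "\<alpha> * \<bar>u\<bar> \<le> \<alpha> * (2 * l)" using u \<alpha>0 by (intro mult_left_mono) auto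
      then show "\<alpha> * \<bar>u\<bar> \<le> pi / 2" using \<alpha>l by simp
      have "0 \<le> \<alpha> * \<delta>" using \<alpha>0 \<delta> by simp
      then show "- (pi / 2) \<le> \<alpha> * \<delta>" using pi_gt_zero by linarith
    qed
    then have "(sin (\<alpha> * \<delta>))\<^sup>2 \<le> (sin (\<alpha> * \<bar>u\<bar>))\<^sup>2" using s\<delta> by (intro power_mono) auto
    also have "(sin (\<alpha> * \<bar>u\<bar>))\<^sup>2 = (sin (\<alpha> * u))\<^sup>2" by (auto simp: abs_if)
    finally have "D * (sin (\<alpha> * \<delta>))\<^sup>2 \<le> D * (sin (\<alpha> * u))\<^sup>2" using D by (rule mult_left_mono)
    moreover have "D * (sin (\<alpha> * \<delta>))\<^sup>2 = 2 * B" using s\<delta> by (simp add: D_def)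
    moreover have "cmod (\<psi> (t - u) - \<psi> t) \<le> 2 * B"
      using norm_triangle_ineq4[of "\<psi> (t - u)" "\<psi> t"] B[of "t - u"] B[of t] by simp
    ultimately show ?thesis using r by linarith
  qed
  have est: "cmod (conv N \<psi> t / of_real (mass N) - \<psi> t) \<le> r / 2 + D / (real N + 2)" for N
  proof -
    have 1: "(\<lambda>u. \<psi> (t - u) * complex_of_real (cos (\<alpha> * u) ^ N)) integrable_on {-(2*l)..2*l}"
      by (intro integrable_continuous_real continuous_intros c\<psi>)
    have 2: "((\<lambda>u. \<psi> t * complex_of_real (cos (\<alpha> * u) ^ N)) has_integral \<psi> t * of_real (mass N)) {-(2*l)..2*l}"
      unfolding mass_def by (intro has_integral_mult_right has_integral_of_real integrable_integral pow_integrable)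
    have 3: "(\<lambda>u. r / 2 * cos (\<alpha> * u) ^ N) integrable_on {-(2*l)..2*l}"
      by (intro integrable_continuous_real continuous_on_mult continuous_on_const continuous_on_power
          continuous_on_cos continuous_on_id)
    have 4: "(\<lambda>u. D * ((sin (\<alpha> * u))\<^sup>2 * cos (\<alpha> * u) ^ N)) integrable_on {-(2*l)..2*l}"
      by (intro integrable_continuous_real continuous_on_mult continuous_on_const continuous_on_power
          continuous_on_cos continuous_on_sin continuous_on_id)
    have "conv N \<psi> t - \<psi> t * of_real (mass N)
        = integral {-(2*l)..2*l} (\<lambda>u. \<psi> (t - u) * of_real (cos (\<alpha> * u) ^ N) - \<psi> t * of_real (cos (\<alpha> * u) ^ N))"
      unfolding conv_eq[OF \<psi> supp t]
      using Henstock_Kurzweil_Integration.integral_diff[OF 1 has_integral_integrable[OF 2]] integral_unique[OF 2]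
      by (simp only:)
    then have "cmod (conv N \<psi> t - \<psi> t * of_real (mass N)) = cmod (integral {-(2*l)..2*l}
        (\<lambda>u. \<psi> (t - u) * of_real (cos (\<alpha> * u) ^ N) - \<psi> t * of_real (cos (\<alpha> * u) ^ N)))"
      by (simp only:)
    also have "\<dots> \<le> integral {-(2*l)..2*l} (\<lambda>u. r / 2 * cos (\<alpha> * u) ^ N + D * ((sin (\<alpha> * u))\<^sup>2 * cos (\<alpha> * u) ^ N))"
    proof (rule integral_norm_bound_integral)
      show "(\<lambda>u. \<psi> (t - u) * of_real (cos (\<alpha> * u) ^ N) - \<psi> t * of_real (cos (\<alpha> * u) ^ N)) integrable_on {-(2*l)..2*l}"
        by (rule Henstock_Kurzweil_Integration.integrable_diff[OF 1 has_integral_integrable[OF 2]])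
      show "(\<lambda>u. r / 2 * cos (\<alpha> * u) ^ N + D * ((sin (\<alpha> * u))\<^sup>2 * cos (\<alpha> * u) ^ N)) integrable_on {-(2*l)..2*l}"
        by (rule Henstock_Kurzweil_Integration.integrable_add[OF 3 4])
      fix u assume u: "u \<in> {-(2*l)..2*l}"
      have "\<psi> (t - u) * of_real (cos (\<alpha> * u) ^ N) - \<psi> t * of_real (cos (\<alpha> * u) ^ N)
          = (\<psi> (t - u) - \<psi> t) * of_real (cos (\<alpha> * u) ^ N)"
        by (rule left_diff_distrib[symmetric])
      then have "cmod (\<psi> (t - u) * of_real (cos (\<alpha> * u) ^ N) - \<psi> t * of_real (cos (\<alpha> * u) ^ N))
          = cmod (\<psi> (t - u) - \<psi> t) * cos (\<alpha> * u) ^ N"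
        by (simp only: norm_mult norm_of_real abs_of_nonneg zero_le_power cos_nonneg[OF u])
      also have "\<dots> \<le> (r / 2 + D * (sin (\<alpha> * u))\<^sup>2) * cos (\<alpha> * u) ^ N"
        using bound[OF u] cos_nonneg[OF u] by (intro mult_right_mono) auto
      finally show "cmod (\<psi> (t - u) * of_real (cos (\<alpha> * u) ^ N) - \<psi> t * of_real (cos (\<alpha> * u) ^ N))
          \<le> r / 2 * cos (\<alpha> * u) ^ N + D * ((sin (\<alpha> * u))\<^sup>2 * cos (\<alpha> * u) ^ N)"
        by (simp only: distrib_right mult.assoc)
    qed
    also have "\<dots> = integral {-(2*l)..2*l} (\<lambda>u. r / 2 * cos (\<alpha> * u) ^ N)
        + integral {-(2*l)..2*l} (\<lambda>u. D * ((sin (\<alpha> * u))\<^sup>2 * cos (\<alpha> * u) ^ N))"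
      by (rule Henstock_Kurzweil_Integration.integral_add[OF 3 4])
    also have "\<dots> = r / 2 * mass N + D * (mass N / (real N + 2))"
      by (simp only: Henstock_Kurzweil_Integration.integral_mult_right sin_square_mass mass_def)
    finally have "cmod (conv N \<psi> t - \<psi> t * of_real (mass N)) \<le> (r / 2 + D / (real N + 2)) * mass N"
      by (simp add: algebra_simps)
    moreover have "conv N \<psi> t / of_real (mass N) - \<psi> t = (conv N \<psi> t - \<psi> t * of_real (mass N)) / of_real (mass N)"
      using mass_pos[of N] by (simp add: diff_divide_distrib)
    ultimately show ?thesis
      using mass_pos[of N] by (simp add: norm_divide pos_divide_le_eq)
  qed
  have "(\<lambda>N. D * inverse (real (Suc (N + 1)))) \<longlonglongrightarrow> 0"
    using LIMSEQ_inverse_real_of_nat by (intro tendsto_mult_right_zero LIMSEQ_ignore_initial_segment)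
  then have "(\<lambda>N. D / (real N + 2)) \<longlonglongrightarrow> 0"
    by (simp add: divide_inverse add.commute)
  then have "\<forall>\<^sub>F N in sequentially. D / (real N + 2) < r / 2"
    using r by (intro order_tendstoD(2)) auto
  then obtain n0 where n0: "\<And>N. N \<ge> n0 \<Longrightarrow> D / (real N + 2) < r / 2"
    unfolding eventually_sequentially by auto
  have fin: "norm (conv N \<psi> t / of_real (mass N) - \<psi> t) < r" if "N \<ge> n0" for N
    using est[of N] n0[OF that] by linarith
  show "\<exists>n0. \<forall>N\<ge>n0. norm (conv N \<psi> t / of_real (mass N) - \<psi> t) < r"
    by (intro exI[of _ n0] allI impI fin)
qed

end

section \<open>The interior equation\<close>

lemma partial_deriv_scaleR:
  assumes "smooth_function \<phi>"
  shows "partial_deriv (r *\<^sub>R b) \<phi> x = r *\<^sub>R partial_deriv b \<phi> x"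
proof -
  interpret bounded_linear "\<lambda>b. partial_deriv b \<phi> x"
    by (rule has_derivative_bounded_linear[OF smooth_function_has_derivative[OF assms]])
  show ?thesis by (rule scaleR)
qed

lemma slice_fst_has_vector_derivative:
  fixes \<phi> :: "real \<times> real \<Rightarrow> complex"
  assumes "smooth_function \<phi>"
  shows "((\<lambda>x. \<phi> (x, s)) has_vector_derivative partial_deriv (1, 0) \<phi> (x, s)) (at x within S)"
proof -
  have "((\<lambda>x. \<phi> (x, s)) has_derivative (\<lambda>d. partial_deriv (d, 0) \<phi> (x, s))) (at x)"
    by (rule has_derivative_compose[OF has_derivative_Pair[OF has_derivative_ident has_derivative_const]
          smooth_function_has_derivative[OF assms]])
  moreover have "(\<lambda>d. partial_deriv (d, 0) \<phi> (x, s)) = (\<lambda>d. d *\<^sub>R partial_deriv (1, 0) \<phi> (x, s))"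
  proof
    show "partial_deriv (d, 0) \<phi> (x, s) = d *\<^sub>R partial_deriv (1, 0) \<phi> (x, s)" for d
      using partial_deriv_scaleR[OF assms, of d "(1, 0)" "(x, s)"]
      by (simp only: scaleR_Pair real_scaleR_def mult_1_right mult_zero_right)
  qed
  ultimately show ?thesis
    unfolding has_vector_derivative_def by (simp only: has_derivative_at_withinI)
qed

lemma slice_snd_has_vector_derivative:
  fixes \<phi> :: "real \<times> real \<Rightarrow> complex"
  assumes "smooth_function \<phi>"
  shows "((\<lambda>t. \<phi> (x, t)) has_vector_derivative partial_deriv (0, 1) \<phi> (x, t)) (at t within S)"
proof -
  have "((\<lambda>t. \<phi> (x, t)) has_derivative (\<lambda>d. partial_deriv (0, d) \<phi> (x, t))) (at t)"
    by (rule has_derivative_compose[OF has_derivative_Pair[OF has_derivative_const has_derivative_ident]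
          smooth_function_has_derivative[OF assms]])
  moreover have "(\<lambda>d. partial_deriv (0, d) \<phi> (x, t)) = (\<lambda>d. d *\<^sub>R partial_deriv (0, 1) \<phi> (x, t))"
  proof
    show "partial_deriv (0, d) \<phi> (x, t) = d *\<^sub>R partial_deriv (0, 1) \<phi> (x, t)" for d
      using partial_deriv_scaleR[OF assms, of d "(0, 1)" "(x, t)"]
      by (simp only: scaleR_Pair real_scaleR_def mult_1_right mult_zero_right)
  qed
  ultimately show ?thesis
    unfolding has_vector_derivative_def by (simp only: has_derivative_at_withinI)
qed

section \<open>Fourier coefficients in the second variable\<close>

definition fourier_coeff :: "real \<Rightarrow> complex \<Rightarrow> (real \<times> real \<Rightarrow> complex) \<Rightarrow> real \<Rightarrow> complex" where
  "fourier_coeff l a \<psi> x = integral {-l..l} (\<lambda>s. \<psi> (x, s) * exp (a * of_real s))"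

lemma fourier_coeff_has_vector_derivative:
  assumes "smooth_function \<psi>"
  shows "(fourier_coeff l a \<psi> has_vector_derivative fourier_coeff l a (partial_deriv (1, 0) \<psi>) x) (at x)"
proof -
  have "((\<lambda>x. integral (cbox (-l) l) (\<lambda>s. \<psi> (x, s) * exp (a * of_real s))) has_vector_derivative
      integral (cbox (-l) l) (\<lambda>s. partial_deriv (1, 0) \<psi> (x, s) * exp (a * of_real s))) (at x within UNIV)"
  proof (rule leibniz_rule_vector_derivative)
    show "((\<lambda>x. \<psi> (x, s) * exp (a * of_real s)) has_vector_derivative
        partial_deriv (1, 0) \<psi> (x, s) * exp (a * of_real s)) (at x within UNIV)" for x s
      by (intro has_vector_derivative_mult_left slice_fst_has_vector_derivative assms)
    show "(\<lambda>s. \<psi> (x, s) * exp (a * of_real s)) integrable_on cbox (-l) l" for x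
      by (intro integrable_continuous continuous_intros continuous_on_compose2[OF smooth_function_continuous[OF assms, of UNIV]]) auto
    show "continuous_on (UNIV \<times> cbox (-l) l) (\<lambda>(x, s). partial_deriv (1, 0) \<psi> (x, s) * exp (a * of_real s))"
      unfolding split_def
      by (intro continuous_intros continuous_on_compose2[OF smooth_function_continuous[OF smooth_function_partial_deriv[OF assms], of UNIV]]) auto
  qed auto
  then show ?thesis by (simp add: fourier_coeff_def[abs_def])
qed

text \<open>Differentiating under the integral gives the coefficient of the x-derivative, so the
  induction needs \<psi> to be arbitrary.\<close>

lemma smooth_function_fourier_coeff:
  assumes "smooth_function \<psi>"
  shows "smooth_function (fourier_coeff l a \<psi>)"
proof -
  have "smooth_function \<psi> \<Longrightarrow> Ck_function k (fourier_coeff l a \<psi>)" for k \<psi>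
  proof (induction k arbitrary: \<psi>)
    case 0
    then show ?case
      using has_vector_derivative_continuous[OF fourier_coeff_has_vector_derivative]
      by (simp add: continuous_on_eq_continuous_within)
  next
    case (Suc k)
    show ?case
      by (rule Ck_function_of_vector_derivative[OF fourier_coeff_has_vector_derivative[OF Suc.prems]
        Suc.IH[OF smooth_function_partial_deriv[OF Suc.prems]]])
  qed
  with assms show ?thesis by (simp add: smooth_function_def)
qed

lemma partial_deriv_fourier_coeff:
  assumes "smooth_function \<psi>"
  shows "partial_deriv 1 (fourier_coeff l a \<psi>) = fourier_coeff l a (partial_deriv (1, 0) \<psi>)"
  using partial_deriv_real_eq[OF fourier_coeff_has_vector_derivative[OF assms], of 1] by (intro ext) simp

text \<open>Integration by parts in s with vanishing boundary terms. Applied twice it trades the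
  factor \<rho>^2 of the weak equation for a second t-derivative.\<close>

lemma fourier_coeff_partial_deriv_snd:
  assumes \<psi>: "smooth_function \<psi>" and ends: "\<psi> (x, l) = 0" "\<psi> (x, -l) = 0" and l: "0 \<le> l"
  shows "fourier_coeff l a (partial_deriv (0, 1) \<psi>) x = - a * fourier_coeff l a \<psi> x"
proof -
  have c: "(\<lambda>s. \<phi> (x, s) * exp (a * of_real s)) integrable_on {-l..l}" if "smooth_function \<phi>" for \<phi>
    by (intro integrable_continuous_real continuous_intros continuous_on_compose2[OF smooth_function_continuous[OF that, of UNIV]]) auto
  note 1 = c[OF smooth_function_partial_deriv[OF \<psi>, of "(0, 1)"]] and 2 = c[OF \<psi>]
  have "((\<lambda>s. \<psi> (x, s) * (a * exp (a * of_real s)) + partial_deriv (0, 1) \<psi> (x, s) * exp (a * of_real s))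
      has_integral (\<psi> (x, l) * exp (a * of_real l) - \<psi> (x, -l) * exp (a * of_real (-l)))) {-l..l}"
    using l by (intro fundamental_theorem_of_calculus has_vector_derivative_mult
        slice_snd_has_vector_derivative \<psi> has_vector_derivative_cexp) simp
  then have "((\<lambda>s. a * (\<psi> (x, s) * exp (a * of_real s)) + partial_deriv (0, 1) \<psi> (x, s) * exp (a * of_real s))
      has_integral 0) {-l..l}"
    using ends by (simp add: mult_ac)
  moreover have "((\<lambda>s. a * (\<psi> (x, s) * exp (a * of_real s)) + partial_deriv (0, 1) \<psi> (x, s) * exp (a * of_real s))
      has_integral (a * fourier_coeff l a \<psi> x + fourier_coeff l a (partial_deriv (0, 1) \<psi>) x)) {-l..l}"
    unfolding fourier_coeff_def by (intro has_integral_add has_integral_mult_right integrable_integral 1 2)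
  ultimately have "a * fourier_coeff l a \<psi> x + fourier_coeff l a (partial_deriv (0, 1) \<psi>) x = 0"
    using has_integral_unique by blast
  then show ?thesis by (simp add: add_eq_0_iff2)
qed

text \<open>Horizontal shifts by half the radius of a ball around the point stay in the triangle: to
  the right this gives x < l, to the left the other two strict inequalities.\<close>

lemma interior_goursat_triangle:
  assumes "(x, t) \<in> interior (goursat_triangle l)"
  shows "0 < x" "x < l" "\<bar>t\<bar> < x"
proof -
  obtain r where r: "r > 0" "ball (x, t) r \<subseteq> goursat_triangle l"
    using assms by (auto simp: mem_interior)
  have in_T: "(x + a, t + b) \<in> goursat_triangle l" if "\<bar>a\<bar> + \<bar>b\<bar> < r" for a b
  proof -
    have "dist (x, t) (x + a, t + b) \<le> \<bar>a\<bar> + \<bar>b\<bar>"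
      using norm_Pair_le[of "- a" "- b"] by (simp add: dist_norm)
    then show ?thesis using that r by (auto simp: subset_eq)
  qed
  have "(x + r / 2, t + 0) \<in> goursat_triangle l" "(x + (- r / 2), t + 0) \<in> goursat_triangle l"
    using r by (intro in_T; simp)+
  then show "x < l" "\<bar>t\<bar> < x" "0 < x" using r by (auto simp: goursat_triangle_def)
qed

text \<open>The support lies in the projection of the support of \<psi>, which is compact and inside
  (0, l).\<close>

lemma test_function_fourier_coeff:
  assumes \<psi>: "test_function (interior (goursat_triangle l)) \<psi>"
  shows "test_function {0<..<l} (fourier_coeff l a \<psi>)"
proof -
  let ?S = "closure {p. \<psi> p \<noteq> 0}"
  have "{x. fourier_coeff l a \<psi> x \<noteq> 0} \<subseteq> fst ` ?S"
  proof
    fix x assume "x \<in> {x. fourier_coeff l a \<psi> x \<noteq> 0}"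
    then have "\<exists>s. \<psi> (x, s) \<noteq> 0" by (auto simp: fourier_coeff_def)
    then obtain s where "\<psi> (x, s) \<noteq> 0" ..
    then have "(x, s) \<in> ?S" using closure_subset[of "{p. \<psi> p \<noteq> 0}"] by auto
    then show "x \<in> fst ` ?S" by force
  qed
  moreover have cS: "compact (fst ` ?S)"
    using \<psi> by (intro compact_continuous_image continuous_intros) (simp add: test_function_def)
  ultimately have cl: "closure {x. fourier_coeff l a \<psi> x \<noteq> 0} \<subseteq> fst ` ?S"
    by (intro closure_minimal compact_imp_closed)
  have "fst ` ?S \<subseteq> {0<..<l}"
  proof
    fix x assume "x \<in> fst ` ?S"
    then obtain t where "(x, t) \<in> ?S" by auto
    moreover have "?S \<subseteq> interior (goursat_triangle l)" using \<psi> by (simp add: test_function_def)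
    ultimately have "(x, t) \<in> interior (goursat_triangle l)" by (rule subsetD[rotated])
    from interior_goursat_triangle[OF this] show "x \<in> {0<..<l}" by simp
  qed
  from subset_trans[OF cl this] show ?thesis
    unfolding test_function_def
    by (intro conjI compact_closure_subset[OF cS cl] smooth_function_fourier_coeff test_function_smooth[OF \<psi>])
qed

context impedance_transform
begin

abbreviation "\<Omega> \<equiv> interior (goursat_triangle l)"

sublocale cos_kernel l \<alpha>
  by unfold_locales (simp_all add: l_pos \<alpha>_def)

lemma test_slice:
  assumes "test_function \<Omega> \<psi>"
  shows "continuous_on S (\<lambda>s. \<psi> (x, s))" "\<forall>s. s \<notin> {-l..l} \<longrightarrow> \<psi> (x, s) = 0"
proof -
  show "continuous_on S (\<lambda>s. \<psi> (x, s))"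
    by (rule continuous_on_compose2[OF smooth_function_continuous[OF test_function_smooth[OF assms], of UNIV]])
      (auto intro!: continuous_intros)
  have "\<psi> (x, s) = 0" if "s \<notin> {-l..l}" for s
  proof (rule test_function_zero_outside[OF assms])
    show "(x, s) \<notin> \<Omega>"
    proof
      assume "(x, s) \<in> \<Omega>"
      from interior_goursat_triangle[OF this] that show False by auto
    qed
  qed
  then show "\<forall>s. s \<notin> {-l..l} \<longrightarrow> \<psi> (x, s) = 0" by blast
qed

lemma fourier_coeff_cont:
  "test_function \<Omega> \<psi> \<Longrightarrow> continuous_on S (fourier_coeff l a \<psi>)"
  by (intro smooth_function_continuous smooth_function_fourier_coeff test_function_smooth)

text \<open>exp(i \<rho> (t - s)) splits into a factor in t, which \<open>K\<close> integrates to
  its transform, and a factor in s, which becomes the Fourier coefficient used as test function in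
  x.\<close>

lemma conv_sum:
  assumes \<psi>: "test_function \<Omega> \<psi>"
  shows "conv N (\<lambda>s. \<psi> (x, s)) t = (\<Sum>j\<le>N. cos_coeff N j *
    (exp (\<i> * cos_freq \<alpha> N j * of_real t) * fourier_coeff l (- \<i> * cos_freq \<alpha> N j) \<psi> x))"
proof -
  have int: "(\<lambda>s. \<psi> (x, s) * exp (a * of_real s)) integrable_on {-l..l}" for a
    by (intro integrable_continuous_real continuous_intros test_slice(1)[OF \<psi>])
  have "((\<lambda>s. \<Sum>j\<le>N. cos_coeff N j * (exp (\<i> * cos_freq \<alpha> N j * of_real t) *
      (\<psi> (x, s) * exp (- \<i> * cos_freq \<alpha> N j * of_real s)))) has_integral
    (\<Sum>j\<le>N. cos_coeff N j * (exp (\<i> * cos_freq \<alpha> N j * of_real t) *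
      fourier_coeff l (- \<i> * cos_freq \<alpha> N j) \<psi> x))) {-l..l}"
    unfolding fourier_coeff_def
    by (intro has_integral_sum has_integral_mult_right integrable_integral int finite_atMost)
  moreover have "(\<Sum>j\<le>N. cos_coeff N j * (exp (\<i> * cos_freq \<alpha> N j * of_real t) *
      (\<psi> (x, s) * exp (- \<i> * cos_freq \<alpha> N j * of_real s)))) = \<psi> (x, s) * of_real (cos (\<alpha> * (t - s)) ^ N)" for s
  proof -
    have "exp (\<i> * cos_freq \<alpha> N j * of_real t) * exp (- \<i> * cos_freq \<alpha> N j * of_real s)
        = exp (\<i> * cos_freq \<alpha> N j * of_real (t - s))" for j
      unfolding exp_add[symmetric] by (simp add: algebra_simps)
    then show ?thesis
      unfolding cos_pow_sum[symmetric] sum_distrib_left by (intro sum.cong refl) (metis mult.left_commute)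
  qed
  ultimately show ?thesis by (simp only: conv_def integral_unique)
qed

definition pairing :: "(real \<times> real \<Rightarrow> complex) \<Rightarrow> real \<Rightarrow> complex" where
  "pairing \<psi> x = integral {-x..x} (\<lambda>t. K (x, t) * \<psi> (x, t))"

text \<open>This is \<open>pairing\<close> with \<psi> replaced by its convolution with the cosine
  power, written through transforms so that the weak equation applies term by term; division by
  \<open>mass N\<close> is postponed to the limit.\<close>

definition pairing_approx :: "nat \<Rightarrow> (real \<times> real \<Rightarrow> complex) \<Rightarrow> real \<Rightarrow> complex" where
  "pairing_approx N \<psi> x = (\<Sum>j\<le>N. cos_coeff N j *
    (transform (cos_freq \<alpha> N j) x * fourier_coeff l (- \<i> * cos_freq \<alpha> N j) \<psi> x))"

lemma pairing_approx_eq: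
  assumes \<psi>: "test_function \<Omega> \<psi>" and x: "x \<in> {0..l}"
  shows "((\<lambda>t. K (x, t) * conv N (\<lambda>s. \<psi> (x, s)) t) has_integral pairing_approx N \<psi> x) {-x..x}"
proof -
  have int: "(\<lambda>t. K (x, t) * exp (\<i> * \<rho> * of_real t)) integrable_on {-x..x}" for \<rho>
    by (intro integrable_continuous_real continuous_on_mult K_slice_cont x exp_cont)
  have "((\<lambda>t. \<Sum>j\<le>N. cos_coeff N j * ((K (x, t) * exp (\<i> * cos_freq \<alpha> N j * of_real t)) *
      fourier_coeff l (- \<i> * cos_freq \<alpha> N j) \<psi> x)) has_integral pairing_approx N \<psi> x) {-x..x}"
    unfolding pairing_approx_def transform_def
    by (intro has_integral_sum has_integral_mult_right has_integral_mult_left integrable_integral int finite_atMost)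
  moreover have "(\<Sum>j\<le>N. cos_coeff N j * ((K (x, t) * exp (\<i> * cos_freq \<alpha> N j * of_real t)) *
      fourier_coeff l (- \<i> * cos_freq \<alpha> N j) \<psi> x)) = K (x, t) * conv N (\<lambda>s. \<psi> (x, s)) t" for t
    unfolding conv_sum[OF \<psi>] sum_distrib_left by (intro sum.cong refl) (simp only: mult_ac)
  ultimately show ?thesis by (simp only:)
qed

text \<open>\<open>transform_weak\<close> tested with the Fourier coefficients of \<phi> and summed.
  On the right exp(i \<rho> x) takes the place of exp(i \<rho> t), so the convolution is evaluated
  on the diagonal t = x.\<close>

lemma pairing_identity:
  assumes \<phi>: "test_function \<Omega> \<phi>" and N: "odd N"
  shows "(\<integral>x. pairing_approx N (partial_deriv (1, 0) \<phi>) x * F' x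
      + F x * (pairing_approx N (partial_deriv (1, 0) (partial_deriv (1, 0) \<phi>)) x
        - pairing_approx N (partial_deriv (0, 1) (partial_deriv (0, 1) \<phi>)) x) \<partial>M)
    = (\<integral>x. conv N (\<lambda>s. \<phi> (x, s)) x * F' x \<partial>M)"
proof -
  let ?x = "partial_deriv (1, 0) \<phi>" and ?xx = "partial_deriv (1, 0) (partial_deriv (1, 0) \<phi>)"
    and ?tt = "partial_deriv (0, 1) (partial_deriv (0, 1) \<phi>)"
  let ?\<sigma> = "\<lambda>j. cos_freq \<alpha> N j"
  let ?c = "\<lambda>j. fourier_coeff l (- \<i> * cos_freq \<alpha> N j)"
  let ?L = "\<lambda>j x. cos_coeff N j * (transform (?\<sigma> j) x * (F' x * ?c j ?x x + F x * (?c j ?xx x - ?c j ?tt x)))"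
  let ?R = "\<lambda>j x. cos_coeff N j * (exp (\<i> * ?\<sigma> j * of_real x) * ?c j \<phi> x * F' x)"
  have nz: "?\<sigma> j \<noteq> 0" for j using cos_freq_nonzero[OF N] \<alpha>_pos by simp
  note sm = test_function_smooth[OF \<phi>]
  note t\<phi> = test_function_partial_deriv
  have z: "\<psi> (x, l) = 0" "\<psi> (x, - l) = 0" if \<psi>: "test_function \<Omega> \<psi>" for \<psi> x
  proof -
    have "(x, y) \<notin> \<Omega>" if "\<bar>y\<bar> = l" for y
    proof
      assume "(x, y) \<in> \<Omega>"
      from interior_goursat_triangle[OF this] that show False by simp
    qed
    then show "\<psi> (x, l) = 0" "\<psi> (x, - l) = 0"
      using l_pos by (auto intro!: test_function_zero_outside[OF \<psi>])
  qed
  \<comment> \<open>Two integrations by parts, with exponent -i \<rho> each time; the boundary terms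
    vanish because \<phi> and its t-derivative are zero at t = l and t = -l.\<close>
  have tt: "?c j ?tt x = - ((?\<sigma> j)\<^sup>2 * ?c j \<phi> x)" for j x
    using l_pos
    by (simp add: fourier_coeff_partial_deriv_snd[OF smooth_function_partial_deriv[OF sm] z(1)[OF t\<phi>[OF \<phi>]] z(2)[OF t\<phi>[OF \<phi>]]]
        fourier_coeff_partial_deriv_snd[OF sm z(1)[OF \<phi>] z(2)[OF \<phi>]] power2_eq_square)
      (simp add: mult_ac)
  have A: "(\<integral>x. ?L j x \<partial>M) = (\<integral>x. ?R j x \<partial>M)" for j
  proof -
    have "(\<integral>x. transform (?\<sigma> j) x * (F' x * ?c j ?x x + F x * ?c j ?xx x + (?\<sigma> j)\<^sup>2 * F x * ?c j \<phi> x) \<partial>M)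
        = (\<integral>x. exp (\<i> * ?\<sigma> j * of_real x) * ?c j \<phi> x * F' x \<partial>M)"
      using transform_weak[OF test_function_fourier_coeff[OF \<phi>] nz[of j], of "- \<i> * cos_freq \<alpha> N j"]
      by (simp only: partial_deriv_fourier_coeff sm smooth_function_partial_deriv)
    moreover have "F' x * ?c j ?x x + F x * ?c j ?xx x + (?\<sigma> j)\<^sup>2 * F x * ?c j \<phi> x
        = F' x * ?c j ?x x + F x * (?c j ?xx x - ?c j ?tt x)" for x
      unfolding tt by (simp add: algebra_simps)
    ultimately have "(\<integral>x. transform (?\<sigma> j) x * (F' x * ?c j ?x x + F x * (?c j ?xx x - ?c j ?tt x)) \<partial>M)
        = (\<integral>x. exp (\<i> * ?\<sigma> j * of_real x) * ?c j \<phi> x * F' x \<partial>M)" by (simp only:)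
    then show ?thesis by (simp only: integral_mult_right_zero)
  qed
  have iL: "integrable M (?L j)" for j
  proof -
    have "integrable M (\<lambda>x. (cos_coeff N j * transform (?\<sigma> j) x) * (?c j ?x x * F' x + F x * (?c j ?xx x - ?c j ?tt x)))"
      by (intro integrable_mult_continuous_interval Bochner_Integration.integrable_add integrable_continuous_interval
        continuous_on_mult continuous_on_diff continuous_on_const fourier_coeff_cont t\<phi> \<phi> F_cont transform_cont[OF nz] F'_integrable)
    then show ?thesis by (simp only: mult_ac)
  qed
  have iR: "integrable M (?R j)" for j
  proof -
    have "integrable M (\<lambda>x. (cos_coeff N j * (exp (\<i> * ?\<sigma> j * of_real x) * ?c j \<phi> x)) * F' x)"
      by (intro integrable_mult_continuous_interval F'_integrable
        continuous_on_mult continuous_on_const exp_cont fourier_coeff_cont \<phi>)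
    then show ?thesis by (simp only: mult.assoc)
  qed
  have "(\<integral>x. (\<Sum>j\<le>N. ?L j x) \<partial>M) = (\<integral>x. (\<Sum>j\<le>N. ?R j x) \<partial>M)"
    by (simp only: Bochner_Integration.integral_sum iL iR A)
  moreover have "(\<Sum>j\<le>N. ?L j x) = pairing_approx N ?x x * F' x
      + F x * (pairing_approx N ?xx x - pairing_approx N ?tt x)" for x
    unfolding pairing_approx_def sum_distrib_right sum_distrib_left sum.distrib[symmetric] sum_subtractf[symmetric]
    by (intro sum.cong refl) (simp only: algebra_simps)
  moreover have "(\<Sum>j\<le>N. ?R j x) = conv N (\<lambda>s. \<phi> (x, s)) x * F' x" for x
    unfolding conv_sum[OF \<phi>] sum_distrib_right by (intro sum.cong refl) (simp only: mult.assoc)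
  ultimately show ?thesis by (simp only:)
qed

section \<open>The limit of the pairings\<close>

lemma conv_bound:
  assumes \<psi>: "test_function \<Omega> \<psi>" and B: "\<And>p. cmod (\<psi> p) \<le> B" and t: "t \<in> {-l..l}"
  shows "cmod (conv N (\<lambda>s. \<psi> (x, s)) t / of_real (mass N)) \<le> B"
  using conv_bounded[OF test_slice[OF \<psi>] t B, of N x] mass_pos[of N]
  by (simp add: norm_divide pos_divide_le_eq)

lemma conv_lim:
  assumes \<psi>: "test_function \<Omega> \<psi>" and t: "t \<in> {-l..l}"
  shows "(\<lambda>N. conv N (\<lambda>s. \<psi> (x, s)) t / of_real (mass N)) \<longlonglongrightarrow> \<psi> (x, t)"
proof -
  obtain B where "\<And>p. cmod (\<psi> p) \<le> B" using test_function_bounded[OF \<psi>] by metis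
  then show ?thesis by (rule conv_tendsto[OF test_slice[OF \<psi>] t])
qed

text \<open>Dominated convergence in t. The bound in the second claim is uniform in N and x, which
  is what the later dominated convergence in x requires.\<close>

lemma pairing_approx_lim:
  assumes \<psi>: "test_function \<Omega> \<psi>" and x: "x \<in> {0..l}"
  shows "(\<lambda>N. pairing_approx N \<psi> x / of_real (mass N)) \<longlonglongrightarrow> pairing \<psi> x"
    and "\<lbrakk>\<And>p. p \<in> goursat_triangle l \<Longrightarrow> cmod (K p) \<le> A; \<And>p. cmod (\<psi> p) \<le> B; A \<ge> 0\<rbrakk>
      \<Longrightarrow> cmod (pairing_approx N \<psi> x / of_real (mass N)) \<le> A * B * (2 * l)"
proof -
  have I: "((\<lambda>t. K (x, t) * (conv N (\<lambda>s. \<psi> (x, s)) t / of_real (mass N))) has_integral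
      pairing_approx N \<psi> x / of_real (mass N)) {-x..x}" for N
    using has_integral_divide[OF pairing_approx_eq[OF \<psi> x, of N], of "of_real (mass N)"] by simp
  have t: "t \<in> {-l..l}" if "t \<in> {-x..x}" for t using that x by auto
  have bd: "cmod (K (x, t) * (conv N (\<lambda>s. \<psi> (x, s)) t / of_real (mass N))) \<le> A * B"
    if "\<And>p. p \<in> goursat_triangle l \<Longrightarrow> cmod (K p) \<le> A" "\<And>p. cmod (\<psi> p) \<le> B" "A \<ge> 0" "t \<in> {-x..x}" for A B t N
    using that(1)[OF triangle_mem[OF x that(4)]] conv_bound[OF \<psi> that(2) t[OF that(4)]] that(3)
    unfolding norm_mult by (intro mult_mono) auto
  obtain A1 where A: "A1 > 0" "\<And>p. p \<in> goursat_triangle l \<Longrightarrow> cmod (K p) \<le> A1" using K_bounded by auto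
  obtain B1 where B: "\<And>p. cmod (\<psi> p) \<le> B1" using test_function_bounded[OF \<psi>] by metis
  have "(\<lambda>N. integral {-x..x} (\<lambda>t. K (x, t) * (conv N (\<lambda>s. \<psi> (x, s)) t / of_real (mass N))))
      \<longlonglongrightarrow> integral {-x..x} (\<lambda>t. K (x, t) * \<psi> (x, t))"
  proof (rule dominated_convergence(2)[where h = "\<lambda>_. A1 * B1"])
    show "(\<lambda>t. K (x, t) * (conv N (\<lambda>s. \<psi> (x, s)) t / of_real (mass N))) integrable_on {-x..x}" for N
      by (rule has_integral_integrable[OF I])
    show "norm (K (x, t) * (conv N (\<lambda>s. \<psi> (x, s)) t / of_real (mass N))) \<le> A1 * B1" if "t \<in> {-x..x}" for N t
      by (rule bd[OF A(2) B less_imp_le[OF A(1)] that])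
    show "(\<lambda>N. K (x, t) * (conv N (\<lambda>s. \<psi> (x, s)) t / of_real (mass N))) \<longlonglongrightarrow> K (x, t) * \<psi> (x, t)"
      if "t \<in> {-x..x}" for t
      by (intro tendsto_mult_left conv_lim[OF \<psi> t[OF that]])
  qed auto
  then show "(\<lambda>N. pairing_approx N \<psi> x / of_real (mass N)) \<longlonglongrightarrow> pairing \<psi> x"
    unfolding integral_unique[OF I] pairing_def .
  show "cmod (pairing_approx N \<psi> x / of_real (mass N)) \<le> A * B * (2 * l)"
    if "\<And>p. p \<in> goursat_triangle l \<Longrightarrow> cmod (K p) \<le> A" "\<And>p. cmod (\<psi> p) \<le> B" "A \<ge> 0"
  proof -
    have B0: "B \<ge> 0" using that(2)[of "(0, 0)"] norm_ge_zero order_trans by blast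
    have "cmod (integral {-x..x} (\<lambda>t. K (x, t) * (conv N (\<lambda>s. \<psi> (x, s)) t / of_real (mass N))))
        \<le> integral {-x..x} (\<lambda>t. A * B)"
      by (rule integral_norm_bound_integral[OF has_integral_integrable[OF I] integrable_const_ivl])
        (rule bd[OF that])
    also have "\<dots> = A * B * (2 * x)" using x by simp
    also have "\<dots> \<le> A * B * (2 * l)" using x B0 that(3) by (intro mult_left_mono) auto
    finally show ?thesis unfolding integral_unique[OF I] .
  qed
qed


text \<open>Collects along odd N what dominated convergence in x needs. For odd N all frequencies
  are nonzero, so the approximants are continuous in x, and \<open>pairing \<psi>\<close> is
  measurable as their pointwise limit.\<close>

lemma pairing_measurable_bounded:
  assumes \<psi>: "test_function \<Omega> \<psi>"
  shows "pairing \<psi> \<in> borel_measurable M"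
    and "\<exists>B. \<forall>n. \<forall>x\<in>{0<..<l}. cmod (pairing_approx (2 * n + 1) \<psi> x / of_real (mass (2 * n + 1))) \<le> B \<and> cmod (pairing \<psi> x) \<le> B"
    and "pairing_approx (2 * n + 1) \<psi> \<in> borel_measurable M"
    and "x \<in> {0<..<l} \<Longrightarrow> (\<lambda>n. pairing_approx (2 * n + 1) \<psi> x / of_real (mass (2 * n + 1))) \<longlonglongrightarrow> pairing \<psi> x"
proof -
  have lim: "(\<lambda>n. pairing_approx (2 * n + 1) \<psi> x / of_real (mass (2 * n + 1))) \<longlonglongrightarrow> pairing \<psi> x"
    if "x \<in> {0<..<l}" for x
  proof -
    have "x \<in> {0..l}" using that by simp
    from LIMSEQ_subseq_LIMSEQ[OF pairing_approx_lim(1)[OF \<psi> this] odd_seq_strict_mono]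
    show ?thesis by (simp only: o_def)
  qed
  then show "x \<in> {0<..<l} \<Longrightarrow> (\<lambda>n. pairing_approx (2 * n + 1) \<psi> x / of_real (mass (2 * n + 1))) \<longlonglongrightarrow> pairing \<psi> x" .
  have nz: "cos_freq \<alpha> (2 * n + 1) j \<noteq> 0" for n j
    using cos_freq_nonzero[of "2 * n + 1" \<alpha> j] \<alpha>_pos by simp
  have m: "pairing_approx (2 * n + 1) \<psi> \<in> borel_measurable M" for n
    unfolding pairing_approx_def[abs_def]
    by (intro continuous_on_measurable_interval continuous_on_sum continuous_on_mult continuous_on_const
        transform_cont[OF nz] fourier_coeff_cont[OF \<psi>])
  then show "pairing_approx (2 * n + 1) \<psi> \<in> borel_measurable M" .
  show "pairing \<psi> \<in> borel_measurable M"
  proof (rule borel_measurable_LIMSEQ_metric)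
    show "(\<lambda>x. pairing_approx (2 * n + 1) \<psi> x / of_real (mass (2 * n + 1))) \<in> borel_measurable M" for n
      by (intro borel_measurable_divide m borel_measurable_const)
    show "(\<lambda>n. pairing_approx (2 * n + 1) \<psi> x / of_real (mass (2 * n + 1))) \<longlonglongrightarrow> pairing \<psi> x"
      if "x \<in> space M" for x
      by (rule lim) (use that in simp)
  qed
  obtain A where A: "A > 0" "\<And>p. p \<in> goursat_triangle l \<Longrightarrow> cmod (K p) \<le> A" using K_bounded by auto
  obtain B where B: "\<And>p. cmod (\<psi> p) \<le> B" using test_function_bounded[OF \<psi>] by metis
  have b: "cmod (pairing_approx (2 * n + 1) \<psi> x / of_real (mass (2 * n + 1))) \<le> A * B * (2 * l)"
    if "x \<in> {0<..<l}" for n x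
    by (rule pairing_approx_lim(2)[OF \<psi> _ A(2) B less_imp_le[OF A(1)]]) (use that in simp_all)
  have "cmod (pairing \<psi> x) \<le> A * B * (2 * l)" if "x \<in> {0<..<l}" for x
    by (rule LIMSEQ_le_const2[OF tendsto_norm[OF lim[OF that]]]) (use b[OF that] in blast)
  with b show "\<exists>B. \<forall>n. \<forall>x\<in>{0<..<l}. cmod (pairing_approx (2 * n + 1) \<psi> x / of_real (mass (2 * n + 1))) \<le> B \<and> cmod (pairing \<psi> x) \<le> B"
    by (intro exI[of _ "A * B * (2 * l)"]) simp
qed

lemma pairing_integrable:
  assumes \<psi>: "test_function \<Omega> \<psi>"
  shows "integrable M (pairing \<psi>)"
proof -
  obtain B where "\<And>x. x \<in> {0<..<l} \<Longrightarrow> cmod (pairing \<psi> x) \<le> B"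
    using pairing_measurable_bounded(2)[OF \<psi>] by metis
  then show ?thesis
    by (intro integrable_bounded_finite[where B = B] finite_measure_lebesgue_on pairing_measurable_bounded(1)[OF \<psi>]) simp_all
qed

text \<open>The limit of \<open>pairing_identity\<close> after division by the mass; the right side
  tends to the integral of \<phi>(x, x) F'(x).\<close>

lemma interior_identity:
  assumes \<phi>: "test_function \<Omega> \<phi>"
  shows "(\<integral>x. pairing (partial_deriv (1, 0) \<phi>) x * F' x
      + F x * (pairing (partial_deriv (1, 0) (partial_deriv (1, 0) \<phi>)) x
        - pairing (partial_deriv (0, 1) (partial_deriv (0, 1) \<phi>)) x) \<partial>M) = 0"
proof -
  let ?x = "partial_deriv (1, 0) \<phi>" and ?xx = "partial_deriv (1, 0) (partial_deriv (1, 0) \<phi>)"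
    and ?tt = "partial_deriv (0, 1) (partial_deriv (0, 1) \<phi>)"
  let ?N = "\<lambda>n::nat. 2 * n + 1"
  let ?m = "\<lambda>n. complex_of_real (mass (?N n))"
  let ?P = "\<lambda>\<psi> n x. pairing_approx (?N n) \<psi> x / ?m n"
  have t: "test_function \<Omega> ?x" "test_function \<Omega> ?xx" "test_function \<Omega> ?tt"
    by (intro test_function_partial_deriv \<phi>)+
  obtain B1 where B1: "\<forall>n. \<forall>x\<in>{0<..<l}. cmod (?P ?x n x) \<le> B1 \<and> cmod (pairing ?x x) \<le> B1"
    using pairing_measurable_bounded(2)[OF t(1)] ..
  obtain B2 where B2: "\<forall>n. \<forall>x\<in>{0<..<l}. cmod (?P ?xx n x) \<le> B2 \<and> cmod (pairing ?xx x) \<le> B2"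
    using pairing_measurable_bounded(2)[OF t(2)] ..
  obtain B3 where B3: "\<forall>n. \<forall>x\<in>{0<..<l}. cmod (?P ?tt n x) \<le> B3 \<and> cmod (pairing ?tt x) \<le> B3"
    using pairing_measurable_bounded(2)[OF t(3)] ..
  obtain BF where BF: "\<And>x. x \<in> {0..l} \<Longrightarrow> cmod (F x) \<le> BF"
    using continuous_on_interval_bounded[OF F_cont] by blast
  have "finite_measure M" by (rule finite_measure_lebesgue_on) simp
  then interpret finite_measure M .
  have F'm: "F' \<in> borel_measurable M" and Fm: "F \<in> borel_measurable M"
    using F'_integrable continuous_on_measurable_interval[OF F_cont] by auto
  note pm = pairing_measurable_bounded(1)
  note am = borel_measurable_divide[OF pairing_measurable_bounded(3) borel_measurable_const]
  have L: "(\<lambda>n. \<integral>x. ?P ?x n x * F' x + F x * (?P ?xx n x - ?P ?tt n x) \<partial>M) \<longlonglongrightarrow>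
      (\<integral>x. pairing ?x x * F' x + F x * (pairing ?xx x - pairing ?tt x) \<partial>M)"
  proof (rule integral_dominated_convergence[where w = "\<lambda>x. B1 * cmod (F' x) + BF * (B2 + B3)"])
    show "(\<lambda>x. pairing ?x x * F' x + F x * (pairing ?xx x - pairing ?tt x)) \<in> borel_measurable M"
      by (intro borel_measurable_add borel_measurable_times borel_measurable_diff F'm Fm pm t)
    show "(\<lambda>x. ?P ?x n x * F' x + F x * (?P ?xx n x - ?P ?tt n x)) \<in> borel_measurable M" for n
      by (intro borel_measurable_add borel_measurable_times borel_measurable_diff F'm Fm am t)
    show "integrable M (\<lambda>x. B1 * cmod (F' x) + BF * (B2 + B3))"
      using F'_integrable by simp
    show "AE x in M. (\<lambda>n. ?P ?x n x * F' x + F x * (?P ?xx n x - ?P ?tt n x)) \<longlonglongrightarrow>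
        pairing ?x x * F' x + F x * (pairing ?xx x - pairing ?tt x)"
    proof (rule AE_I2)
      fix x assume "x \<in> space M"
      then have x: "x \<in> {0<..<l}" by simp
      show "(\<lambda>n. ?P ?x n x * F' x + F x * (?P ?xx n x - ?P ?tt n x)) \<longlonglongrightarrow>
        pairing ?x x * F' x + F x * (pairing ?xx x - pairing ?tt x)"
        by (intro tendsto_add tendsto_mult tendsto_diff tendsto_const pairing_measurable_bounded(4)[OF _ x] t)
    qed
    show "AE x in M. norm (?P ?x n x * F' x + F x * (?P ?xx n x - ?P ?tt n x)) \<le> B1 * cmod (F' x) + BF * (B2 + B3)" for n
    proof (rule AE_I2)
      fix x assume "x \<in> space M"
      then have x: "x \<in> {0<..<l}" and x': "x \<in> {0..l}" by simp_all
      have 1: "cmod (?P ?x n x) \<le> B1" and 2: "cmod (?P ?xx n x) \<le> B2" and 3: "cmod (?P ?tt n x) \<le> B3"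
        using B1 B2 B3 x by auto
      have "cmod (?P ?xx n x - ?P ?tt n x) \<le> B2 + B3"
        using norm_triangle_ineq4[of "?P ?xx n x" "?P ?tt n x"] 2 3 by linarith
      then have "cmod (F x * (?P ?xx n x - ?P ?tt n x)) \<le> BF * (B2 + B3)"
        unfolding norm_mult using BF[OF x'] order_trans[OF norm_ge_zero BF[OF x']] by (intro mult_mono) auto
      moreover have "cmod (?P ?x n x * F' x) \<le> B1 * cmod (F' x)"
        unfolding norm_mult using 1 by (rule mult_right_mono) simp
      ultimately show "norm (?P ?x n x * F' x + F x * (?P ?xx n x - ?P ?tt n x)) \<le> B1 * cmod (F' x) + BF * (B2 + B3)"
        by (intro norm_triangle_le add_mono) simp_all
    qed
  qed
  have eq: "(\<integral>x. ?P ?x n x * F' x + F x * (?P ?xx n x - ?P ?tt n x) \<partial>M)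
      = (\<integral>x. (conv (?N n) (\<lambda>s. \<phi> (x, s)) x / ?m n) * F' x \<partial>M)" for n
  proof -
    have odd: "odd (?N n)" by simp
    have "(\<integral>x. ?P ?x n x * F' x + F x * (?P ?xx n x - ?P ?tt n x) \<partial>M)
      = (\<integral>x. (pairing_approx (?N n) ?x x * F' x + F x * (pairing_approx (?N n) ?xx x - pairing_approx (?N n) ?tt x)) / ?m n \<partial>M)"
      by (simp add: add_divide_distrib diff_divide_distrib right_diff_distrib)
    moreover have "\<dots> = (\<integral>x. (conv (?N n) (\<lambda>s. \<phi> (x, s)) x * F' x) / ?m n \<partial>M)"
      by (simp only: integral_divide_zero pairing_identity[OF \<phi> odd])
    ultimately show ?thesis by (simp add: field_simps)
  qed
  obtain B where B: "\<And>p. cmod (\<phi> p) \<le> B" using test_function_bounded[OF \<phi>] by metis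
  have R: "(\<lambda>n. \<integral>x. (conv (?N n) (\<lambda>s. \<phi> (x, s)) x / ?m n) * F' x \<partial>M) \<longlonglongrightarrow> (\<integral>x. \<phi> (x, x) * F' x \<partial>M)"
  proof (rule integral_dominated_convergence[where w = "\<lambda>x. B * cmod (F' x)"])
    have "continuous_on {0..l} (\<lambda>x. \<phi> (x, x))"
      by (rule continuous_on_compose2[OF smooth_function_continuous[OF test_function_smooth[OF \<phi>], of UNIV]])
        (auto intro!: continuous_intros)
    then show "(\<lambda>x. \<phi> (x, x) * F' x) \<in> borel_measurable M"
      by (intro borel_measurable_times F'm continuous_on_measurable_interval)
    have "continuous_on {0..l} (\<lambda>x. conv (?N n) (\<lambda>s. \<phi> (x, s)) x)" for n
      unfolding conv_sum[OF \<phi>]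
      by (intro continuous_on_sum continuous_on_mult continuous_on_const exp_cont fourier_coeff_cont[OF \<phi>])
    from continuous_on_measurable_interval[OF this]
    show "(\<lambda>x. (conv (?N n) (\<lambda>s. \<phi> (x, s)) x / ?m n) * F' x) \<in> borel_measurable M" for n
      by (intro borel_measurable_times borel_measurable_divide borel_measurable_const F'm)
    show "AE x in M. (\<lambda>n. (conv (?N n) (\<lambda>s. \<phi> (x, s)) x / ?m n) * F' x) \<longlonglongrightarrow> \<phi> (x, x) * F' x"
    proof (rule AE_I2)
      fix x assume "x \<in> space M"
      then have x: "x \<in> {-l..l}" by simp
      from LIMSEQ_subseq_LIMSEQ[OF conv_lim[OF \<phi> x] odd_seq_strict_mono]
      have "(\<lambda>n. conv (?N n) (\<lambda>s. \<phi> (x, s)) x / ?m n) \<longlonglongrightarrow> \<phi> (x, x)" by (simp only: o_def)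
      then show "(\<lambda>n. (conv (?N n) (\<lambda>s. \<phi> (x, s)) x / ?m n) * F' x) \<longlonglongrightarrow> \<phi> (x, x) * F' x"
        by (rule tendsto_mult_right)
    qed
    show "AE x in M. norm ((conv (?N n) (\<lambda>s. \<phi> (x, s)) x / ?m n) * F' x) \<le> B * cmod (F' x)" for n
    proof (rule AE_I2)
      fix x assume "x \<in> space M"
      then have x: "x \<in> {-l..l}" by simp
      show "norm ((conv (?N n) (\<lambda>s. \<phi> (x, s)) x / ?m n) * F' x) \<le> B * cmod (F' x)"
        unfolding norm_mult by (rule mult_right_mono[OF conv_bound[OF \<phi> B x]]) simp
    qed
    show "integrable M (\<lambda>x. B * cmod (F' x))" using F'_integrable by simp
  qed
  \<comment> \<open>The diagonal is a side of the triangle and misses its interior, so the diagonal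
    term disappears for interior test functions.\<close>
  have "\<phi> (x, x) = 0" for x
  proof (rule test_function_zero_outside[OF \<phi>])
    show "(x, x) \<notin> \<Omega>"
    proof
      assume "(x, x) \<in> \<Omega>"
      from interior_goursat_triangle(3)[OF this] show False by simp
    qed
  qed
  then have "(\<integral>x. \<phi> (x, x) * F' x \<partial>M) = 0" by simp
  with LIMSEQ_unique[OF L R[folded eq]] show ?thesis by simp
qed

section \<open>From iterated integrals to the weak derivatives of the kernel\<close>

lemma \<Omega>_lmeasurable: "\<Omega> \<in> lmeasurable"
proof (rule lmeasurable_open)
  show "bounded \<Omega>"
    by (rule bounded_subset[OF compact_imp_bounded[OF goursat_triangle_compact] interior_subset])
qed simp

text \<open>Since \<open>h\<close> vanishes off the interior, it may be cut off by the closed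
  triangle instead. On that compact set it is continuous, which gives Borel integrability; Fubini
  applies to \<open>lborel\<close>, and passing to the completion changes no integral.\<close>

lemma integral_interior_Fubini:
  fixes h :: "real \<times> real \<Rightarrow> complex"
  assumes h: "continuous_on (goursat_triangle l) h" and out: "\<forall>p. p \<notin> \<Omega> \<longrightarrow> h p = 0"
  shows "(\<integral>p. h p \<partial>lebesgue_on \<Omega>) = (\<integral>x. integral {-x..x} (\<lambda>t. h (x, t)) \<partial>M)"
proof -
  let ?T = "goursat_triangle l"
  let ?H = "\<lambda>p. indicator ?T p *\<^sub>R h p"
  let ?G = "\<lambda>x. \<integral>t. ?H (x, t) \<partial>lborel"
  have Hi: "integrable lborel ?H"
    by (rule borel_integrable_compact[OF goursat_triangle_compact h])
  have "\<Omega> \<in> sets lebesgue" using \<Omega>_lmeasurable by (rule fmeasurableD)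
  then have "(\<integral>p. h p \<partial>lebesgue_on \<Omega>) = (\<integral>p. indicator \<Omega> p *\<^sub>R h p \<partial>lebesgue)"
    by (simp add: integral_restrict_space)
  moreover have "(\<lambda>p. indicator \<Omega> p *\<^sub>R h p) = ?H"
  proof
    fix p
    show "indicator \<Omega> p *\<^sub>R h p = ?H p"
    proof (cases "p \<in> \<Omega>")
      case True
      with interior_subset have "p \<in> ?T" ..
      with True show ?thesis by simp
    next
      case False
      with out have "h p = 0" by blast
      then show ?thesis by simp
    qed
  qed
  moreover have "(\<integral>p. ?H p \<partial>lebesgue) = (\<integral>p. ?H p \<partial>lborel)"
    by (intro integral_completion borel_measurable_integrable Hi)
  ultimately have 1: "(\<integral>p. h p \<partial>lebesgue_on \<Omega>) = (\<integral>p. ?H p \<partial>lborel)" by (simp only:)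
  have Hp: "integrable (lborel \<Otimes>\<^sub>M lborel) ?H"
    using Hi by (simp only: lborel_prod)
  have 2: "(\<integral>p. ?H p \<partial>lborel) = (\<integral>x. ?G x \<partial>lborel)"
    using lborel_pair.integral_fst'[OF Hp] by (simp only: lborel_prod)
  have Gm: "?G \<in> borel_measurable lborel"
    by (rule borel_measurable_integrable[OF lborel_pair.integrable_fst'[OF Hp]])
  have 3: "(\<integral>x. ?G x \<partial>lborel) = (\<integral>x. ?G x \<partial>lebesgue)"
    by (rule integral_completion[OF Gm, symmetric])
  have G: "?G x = indicator {0<..<l} x *\<^sub>R integral {-x..x} (\<lambda>t. h (x, t))" for x
  proof (cases "x \<in> {0<..<l}")
    case True
    have c: "continuous_on {-x..x} (\<lambda>t. h (x, t))"
      by (rule continuous_on_compose2[OF h])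
        (use True in \<open>auto simp: goursat_triangle_def intro!: continuous_intros\<close>)
    have "?G x = (\<integral>t. indicator {-x..x} t *\<^sub>R h (x, t) \<partial>lborel)"
      by (rule Bochner_Integration.integral_cong) (use True in \<open>auto simp: indicator_def goursat_triangle_def\<close>)
    moreover have "set_integrable lborel {-x..x} (\<lambda>t. h (x, t))"
      unfolding set_integrable_def by (rule borel_integrable_compact[OF _ c]) simp
    ultimately show ?thesis
      using True by (simp add: set_borel_integral_eq_integral(2) set_lebesgue_integral_def[symmetric])
  next
    case False
    have "?H (x, t) = 0" for t
    proof -
      have "(x, t) \<notin> \<Omega>"
      proof
        assume "(x, t) \<in> \<Omega>"
        from interior_goursat_triangle[OF this] False show False by simp
      qed
      then show ?thesis using out by simp
    qed
    then have "?G x = 0" by (simp only: Bochner_Integration.integral_zero)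
    then show ?thesis using False by simp
  qed
  have 4: "(\<integral>x. ?G x \<partial>lebesgue) = (\<integral>x. integral {-x..x} (\<lambda>t. h (x, t)) \<partial>M)"
    unfolding G by (simp add: integral_restrict_space)
  show ?thesis unfolding 1 2 3 4 ..
qed

lemma integral_interior_pairing:
  assumes \<psi>: "test_function \<Omega> \<psi>" and r: "continuous_on {0..l} r"
  shows "(\<integral>p. K p * (r (fst p) * \<psi> p) \<partial>lebesgue_on \<Omega>) = (\<integral>x. r x * pairing \<psi> x \<partial>M)"
proof -
  have "continuous_on (goursat_triangle l) (\<lambda>p. r (fst p))"
    by (rule continuous_on_compose2[OF r]) (auto simp: goursat_triangle_def intro!: continuous_intros)
  then have "continuous_on (goursat_triangle l) (\<lambda>p. K p * (r (fst p) * \<psi> p))"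
    by (rule continuous_on_mult[OF K_cont continuous_on_mult[OF _
          smooth_function_continuous[OF test_function_smooth[OF \<psi>]]]])
  moreover have "\<forall>p. p \<notin> \<Omega> \<longrightarrow> K p * (r (fst p) * \<psi> p) = 0"
    using test_function_zero_outside[OF \<psi>] by simp
  ultimately have "(\<integral>p. K p * (r (fst p) * \<psi> p) \<partial>lebesgue_on \<Omega>)
      = (\<integral>x. integral {-x..x} (\<lambda>t. K (x, t) * (r (fst (x, t)) * \<psi> (x, t))) \<partial>M)"
    by (rule integral_interior_Fubini)
  moreover have "integral {-x..x} (\<lambda>t. K (x, t) * (r (fst (x, t)) * \<psi> (x, t))) = r x * pairing \<psi> x" for x
    unfolding pairing_def integral_mult_right[symmetric] by (simp add: mult_ac)
  ultimately show ?thesis by (simp only:)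
qed

lemma integrable_interior:
  fixes h :: "real \<times> real \<Rightarrow> complex"
  assumes "continuous_on (goursat_triangle l) h"
  shows "integrable (lebesgue_on \<Omega>) h"
proof -
  have "bounded (h ` goursat_triangle l)"
    by (intro compact_imp_bounded compact_continuous_image assms goursat_triangle_compact)
  then obtain B where B: "\<And>p. p \<in> goursat_triangle l \<Longrightarrow> cmod (h p) \<le> B"
    unfolding bounded_pos by auto
  show ?thesis
  proof (rule integrable_bounded_finite[OF finite_measure_lebesgue_on[OF \<Omega>_lmeasurable]])
    show "h \<in> borel_measurable (lebesgue_on \<Omega>)"
      by (rule continuous_imp_measurable_on_sets_lebesgue[OF continuous_on_subset[OF assms interior_subset]
            fmeasurableD[OF \<Omega>_lmeasurable]])
    show "cmod (h p) \<le> B" if "p \<in> space (lebesgue_on \<Omega>)" for p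
      using that interior_subset by (intro B) auto
  qed
qed

text \<open>F(x) \<eta> need not be smooth, so the weak derivative is tested with p n (x) \<eta>.
  The limit uses uniform convergence for the terms with \<open>F\<close> and mean convergence for
  the term with \<open>F'\<close>.\<close>

lemma weak_deriv_interior:
  assumes Kb: "weak_deriv \<Omega> b K Kb" and \<eta>: "test_function \<Omega> \<eta>"
  shows "integrable (lebesgue_on \<Omega>) (\<lambda>p. Kb p * \<eta> p)"
    and "(\<integral>p. F (fst p) * (Kb p * \<eta> p) \<partial>lebesgue_on \<Omega>)
      = - ((\<integral>x. F x * pairing (partial_deriv b \<eta>) x \<partial>M) + of_real (fst b) * (\<integral>x. pairing \<eta> x * F' x \<partial>M))"
proof -
  let ?M2 = "lebesgue_on \<Omega>"
  have \<Omega>s: "\<Omega> \<in> sets lebesgue" using \<Omega>_lmeasurable by (rule fmeasurableD)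
  have Kbi: "integrable ?M2 Kb"
    using Kb by (intro L2_on_integrable[OF _ \<Omega>_lmeasurable]) (simp add: weak_deriv_def)
  obtain B where B: "\<And>p. cmod (\<eta> p) \<le> B" using test_function_bounded[OF \<eta>] by metis
  have "integrable ?M2 (\<lambda>p. \<eta> p * Kb p)"
    by (rule integrable_mult_bounded[OF Kbi continuous_imp_measurable_on_sets_lebesgue[OF
          smooth_function_continuous[OF test_function_smooth[OF \<eta>]] \<Omega>s] B])
  then show iK\<eta>: "integrable ?M2 (\<lambda>p. Kb p * \<eta> p)" by (simp only: mult.commute)
  obtain p p' where F: "smooth_approx l F F' p p'" by (rule F_approx)
  have in_I: "fst q \<in> {0..l}" if "q \<in> \<Omega>" for q
    using interior_goursat_triangle[of "fst q" "snd q" l] that by simp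
  obtain BF where BF: "\<And>x. x \<in> {0..l} \<Longrightarrow> cmod (F x) \<le> BF"
    using continuous_on_interval_bounded[OF F_cont] by blast
  have db: "test_function \<Omega> (partial_deriv b \<eta>)" by (rule test_function_partial_deriv[OF \<eta>])
  have cT: "continuous_on (goursat_triangle l) (\<lambda>q. K q * (r (fst q) * \<psi> q))"
    if "smooth_function r" "test_function \<Omega> \<psi>" for r \<psi>
    by (intro continuous_on_mult K_cont smooth_function_continuous[OF smooth_function_fst[OF that(1)]]
        smooth_function_continuous[OF test_function_smooth[OF that(2)]])
  have eq: "(\<integral>q. p n (fst q) * (Kb q * \<eta> q) \<partial>?M2)
      = - ((\<integral>x. p n x * pairing (partial_deriv b \<eta>) x \<partial>M) + of_real (fst b) * (\<integral>x. pairing \<eta> x * p' n x \<partial>M))" for n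
  proof -
    note pn = smooth_approxD(1)[OF F, of n] and pn' = smooth_approxD(2)[OF F, of n]
    have "test_function \<Omega> (\<lambda>q. p n (fst q) * \<eta> q)"
      by (rule test_function_mult[OF \<eta> smooth_function_fst[OF pn]])
    then have "(\<integral>q. K q * partial_deriv b (\<lambda>q. p n (fst q) * \<eta> q) q \<partial>?M2)
        = - (\<integral>q. Kb q * (p n (fst q) * \<eta> q) \<partial>?M2)"
      using Kb \<Omega>s by (simp add: weak_deriv_def set_lebesgue_integral_eq_lebesgue_on)
    \<comment> \<open>The weight depends on x alone, so its derivative in direction \<open>b\<close>
      carries the factor \<open>fst b\<close>: 1 for the x-direction, 0 for the t-direction. One
      lemma thus serves both.\<close>
    moreover have "partial_deriv b (\<lambda>q. p n (fst q) * \<eta> q) q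
        = p n (fst q) * partial_deriv b \<eta> q + of_real (fst b) * (p' n (fst q) * \<eta> q)" for q
      using partial_deriv_mult[OF smooth_function_fst[OF pn] test_function_smooth[OF \<eta>], of b q]
        partial_deriv_fst[OF pn, of b q] partial_deriv_real_eq[OF smooth_approxD(3)[OF F], of "fst b" n "fst q"]
      by (simp add: scaleR_conv_of_real)
    ultimately have "(\<integral>q. Kb q * (p n (fst q) * \<eta> q) \<partial>?M2)
        = - (\<integral>q. K q * (p n (fst q) * partial_deriv b \<eta> q) + of_real (fst b) * (K q * (p' n (fst q) * \<eta> q)) \<partial>?M2)"
      by (simp add: distrib_left mult.left_commute)
    also have "(\<integral>q. K q * (p n (fst q) * partial_deriv b \<eta> q) + of_real (fst b) * (K q * (p' n (fst q) * \<eta> q)) \<partial>?M2)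
        = (\<integral>q. K q * (p n (fst q) * partial_deriv b \<eta> q) \<partial>?M2) + (\<integral>q. of_real (fst b) * (K q * (p' n (fst q) * \<eta> q)) \<partial>?M2)"
      by (rule Bochner_Integration.integral_add[OF integrable_interior[OF cT[OF pn db]]
            Bochner_Integration.integrable_mult_right[OF integrable_interior[OF cT[OF pn' \<eta>]]]])
    finally show ?thesis
      unfolding integral_mult_right_zero integral_interior_pairing[OF db smooth_function_continuous[OF pn]]
        integral_interior_pairing[OF \<eta> smooth_function_continuous[OF pn']]
      by (simp only: mult.commute mult.left_commute)
  qed
  have "(\<lambda>n. \<integral>q. p n (fst q) * (Kb q * \<eta> q) \<partial>?M2) \<longlonglongrightarrow> (\<integral>q. F (fst q) * (Kb q * \<eta> q) \<partial>?M2)"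
  proof (rule tendsto_integral_mult_uniform[OF _ _ _ iK\<eta>])
    show "uniform_limit (space ?M2) (\<lambda>n q. p n (fst q)) (\<lambda>q. F (fst q)) sequentially"
      by (rule uniform_limit_compose'[OF smooth_approxD(4)[OF F]]) (use in_I in auto)
    show "(\<lambda>q. p n (fst q)) \<in> borel_measurable ?M2" for n
      by (rule continuous_imp_measurable_on_sets_lebesgue[OF
          smooth_function_continuous[OF smooth_function_fst[OF smooth_approxD(1)[OF F]]] \<Omega>s])
    show "cmod (F (fst q)) \<le> BF" if "q \<in> space ?M2" for q
      using that by (intro BF in_I) simp
  qed
  moreover obtain B' where B': "\<And>x. x \<in> {0<..<l} \<Longrightarrow> cmod (pairing \<eta> x) \<le> B'"
    using pairing_measurable_bounded(2)[OF \<eta>] by metis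
  then have "(\<lambda>n. - ((\<integral>x. p n x * pairing (partial_deriv b \<eta>) x \<partial>M) + of_real (fst b) * (\<integral>x. pairing \<eta> x * p' n x \<partial>M)))
      \<longlonglongrightarrow> - ((\<integral>x. F x * pairing (partial_deriv b \<eta>) x \<partial>M) + of_real (fst b) * (\<integral>x. pairing \<eta> x * F' x \<partial>M))"
    by (intro tendsto_minus tendsto_add tendsto_mult_left smooth_approx_tendsto_integral[OF F pairing_integrable[OF db]]
        smooth_approx_tendsto_integral_deriv[OF F pairing_measurable_bounded(1)[OF \<eta>]])
  ultimately show "(\<integral>p. F (fst p) * (Kb p * \<eta> p) \<partial>lebesgue_on \<Omega>)
      = - ((\<integral>x. F x * pairing (partial_deriv b \<eta>) x \<partial>M) + of_real (fst b) * (\<integral>x. pairing \<eta> x * F' x \<partial>M))"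
    unfolding eq by (rule LIMSEQ_unique)
qed

text \<open>\<open>weak_deriv_interior\<close> is used in the x-direction with \<eta> the
  x-derivative of \<phi>, and in the t-direction with \<eta> its t-derivative. The difference is the
  negative of the expression in \<open>interior_identity\<close>.\<close>

lemma kernel_weak_equation:
  assumes Kx: "weak_deriv \<Omega> (1, 0) K Kx" and Kt: "weak_deriv \<Omega> (0, 1) K Kt" and \<phi>: "test_function \<Omega> \<phi>"
  shows "(LINT p:goursat_triangle l|lebesgue. (f (fst p))\<^sup>2 *
     (Kx p * partial_deriv (1, 0) \<phi> p - Kt p * partial_deriv (0, 1) \<phi> p)) = 0"
proof -
  let ?M2 = "lebesgue_on \<Omega>"
  let ?x = "partial_deriv (1, 0) \<phi>" and ?t = "partial_deriv (0, 1) \<phi>"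
  let ?xx = "partial_deriv (1, 0) (partial_deriv (1, 0) \<phi>)" and ?tt = "partial_deriv (0, 1) (partial_deriv (0, 1) \<phi>)"
  have tx: "test_function \<Omega> ?x" and tt: "test_function \<Omega> ?t" and txx: "test_function \<Omega> ?xx" and ttt: "test_function \<Omega> ?tt"
    by (intro test_function_partial_deriv \<phi>)+
  have \<Omega>s: "\<Omega> \<in> sets lebesgue" using \<Omega>_lmeasurable by (rule fmeasurableD)
  have \<Omega>T: "\<Omega> \<subseteq> goursat_triangle l" by (rule interior_subset)
  have in_I: "fst q \<in> {0..l}" if "q \<in> \<Omega>" for q
    using interior_goursat_triangle[of "fst q" "snd q" l] that by simp
  obtain BF where BF: "\<And>x. x \<in> {0..l} \<Longrightarrow> cmod (F x) \<le> BF"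
    using continuous_on_interval_bounded[OF F_cont] by blast
  have "continuous_on \<Omega> (\<lambda>q. F (fst q))"
    by (rule continuous_on_compose2[OF F_cont]) (use in_I in \<open>auto intro!: continuous_intros\<close>)
  then have Fm: "(\<lambda>q. F (fst q)) \<in> borel_measurable ?M2"
    by (rule continuous_imp_measurable_on_sets_lebesgue[OF _ \<Omega>s])
  have iF: "integrable ?M2 (\<lambda>q. F (fst q) * h q)" if "integrable ?M2 h" for h
  proof (rule integrable_mult_bounded[OF that Fm])
    show "cmod (F (fst q)) \<le> BF" if "q \<in> space ?M2" for q
      using that by (intro BF in_I) simp
  qed
  have z: "?x p = 0" "?t p = 0" if "p \<notin> \<Omega>" for p
    using test_function_zero_outside[OF tx that] test_function_zero_outside[OF tt that] by simp_all
  \<comment> \<open>The weak derivatives carry information only on the open triangle; off it the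
    derivatives of \<phi> vanish, whatever values \<open>Kx\<close> and \<open>Kt\<close> have
    there.\<close>
  have "(LINT p:goursat_triangle l|lebesgue. (f (fst p))\<^sup>2 * (Kx p * ?x p - Kt p * ?t p))
      = (\<integral>p. indicator \<Omega> p *\<^sub>R (F (fst p) * (Kx p * ?x p) - F (fst p) * (Kt p * ?t p)) \<partial>lebesgue)"
    unfolding set_lebesgue_integral_def
  proof (rule Bochner_Integration.integral_cong)
    fix p
    show "indicator (goursat_triangle l) p *\<^sub>R ((f (fst p))\<^sup>2 * (Kx p * ?x p - Kt p * ?t p))
        = indicator \<Omega> p *\<^sub>R (F (fst p) * (Kx p * ?x p) - F (fst p) * (Kt p * ?t p))"
    proof (cases "p \<in> \<Omega>")
      case True
      with \<Omega>T have "p \<in> goursat_triangle l" ..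
      with True show ?thesis by (simp add: F_def power2_eq_square right_diff_distrib)
    next
      case False
      from z[OF this] show ?thesis by (simp only: mult_zero_right diff_zero scaleR_zero_right)
    qed
  qed simp
  moreover have "\<dots> = (\<integral>p. F (fst p) * (Kx p * ?x p) - F (fst p) * (Kt p * ?t p) \<partial>?M2)"
    using \<Omega>s by (simp add: integral_restrict_space)
  moreover have "\<dots> = (\<integral>p. F (fst p) * (Kx p * ?x p) \<partial>?M2) - (\<integral>p. F (fst p) * (Kt p * ?t p) \<partial>?M2)"
    by (intro Bochner_Integration.integral_diff iF weak_deriv_interior(1)[OF Kx tx] weak_deriv_interior(1)[OF Kt tt])
  moreover have "(\<integral>p. F (fst p) * (Kx p * ?x p) \<partial>?M2)
      = - ((\<integral>x. F x * pairing ?xx x \<partial>M) + (\<integral>x. pairing ?x x * F' x \<partial>M))"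
    using weak_deriv_interior(2)[OF Kx tx] by simp
  moreover have "(\<integral>p. F (fst p) * (Kt p * ?t p) \<partial>?M2) = - (\<integral>x. F x * pairing ?tt x \<partial>M)"
    using weak_deriv_interior(2)[OF Kt tt] by simp
  ultimately have "(LINT p:goursat_triangle l|lebesgue. (f (fst p))\<^sup>2 * (Kx p * ?x p - Kt p * ?t p))
      = - ((\<integral>x. F x * pairing ?xx x \<partial>M) + (\<integral>x. pairing ?x x * F' x \<partial>M)) - - (\<integral>x. F x * pairing ?tt x \<partial>M)"
    by (simp only:)
  also have "\<dots> = - ((\<integral>x. pairing ?x x * F' x \<partial>M) + ((\<integral>x. F x * pairing ?xx x \<partial>M) - (\<integral>x. F x * pairing ?tt x \<partial>M)))"
    by simp
  also have "(\<integral>x. pairing ?x x * F' x \<partial>M) + ((\<integral>x. F x * pairing ?xx x \<partial>M) - (\<integral>x. F x * pairing ?tt x \<partial>M)) = 0"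
  proof -
    have i: "integrable M (\<lambda>x. F x * pairing ?xx x)" "integrable M (\<lambda>x. F x * pairing ?tt x)"
      by (intro integrable_mult_continuous_interval F_cont pairing_integrable txx ttt)+
    obtain B' where B': "\<And>x. x \<in> {0<..<l} \<Longrightarrow> cmod (pairing ?x x) \<le> B'"
      using pairing_measurable_bounded(2)[OF tx] by metis
    have i': "integrable M (\<lambda>x. pairing ?x x * F' x)"
      by (rule integrable_mult_bounded[OF F'_integrable pairing_measurable_bounded(1)[OF tx]]) (use B' in simp)
    have "(\<integral>x. pairing ?x x * F' x + (F x * pairing ?xx x - F x * pairing ?tt x) \<partial>M) = 0"
      using interior_identity[OF \<phi>] by (simp only: right_diff_distrib)
    moreover have "(\<integral>x. pairing ?x x * F' x + (F x * pairing ?xx x - F x * pairing ?tt x) \<partial>M)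
        = (\<integral>x. pairing ?x x * F' x \<partial>M) + (\<integral>x. F x * pairing ?xx x - F x * pairing ?tt x \<partial>M)"
      by (rule Bochner_Integration.integral_add[OF i' Bochner_Integration.integrable_diff[OF i]])
    moreover have "(\<integral>x. F x * pairing ?xx x - F x * pairing ?tt x \<partial>M)
        = (\<integral>x. F x * pairing ?xx x \<partial>M) - (\<integral>x. F x * pairing ?tt x \<partial>M)"
      by (rule Bochner_Integration.integral_diff[OF i])
    ultimately show ?thesis by (simp only:)
  qed
  finally show ?thesis by simp
qed

end

text \<open>\<open>K\<close> stands for the continuous representative of the kernel, which gives the
  pointwise conditions on the sides a meaning; \<open>Kx\<close> and \<open>Kt\<close> are arbitrary
  representatives of its weak derivatives.\<close>

theorem mainTheorem14:
  fixes l :: real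
    and f :: "real \<Rightarrow> complex"
    and e :: "complex \<Rightarrow> real \<Rightarrow> complex"
    and K Kx Kt :: "real \<times> real \<Rightarrow> complex"
  assumes l_pos: "l > 0"
    and f_sobolev: "sobolev2 1 {0<..<l} f"
    and f_cont: "continuous_on {0..l} f"
    and f_nz: "\<And>x. x \<in> {0..l} \<Longrightarrow> f x \<noteq> 0"
    and f_0: "f 0 = 1"
    and e_sol: "\<And>\<rho>. impedance_exp_solution l f \<rho> (e \<rho>)"
    and K_kernel: "impedance_kernel l e K"
    and K_cont: "continuous_on (goursat_triangle l) K"
    and K_x: "weak_deriv (interior (goursat_triangle l)) (1, 0) K Kx"
    and K_t: "weak_deriv (interior (goursat_triangle l)) (0, 1) K Kt"
  shows "(\<forall>\<phi>. test_function (interior (goursat_triangle l)) \<phi> \<longrightarrow>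
            (LINT p:goursat_triangle l|lebesgue. (f (fst p))\<^sup>2 *
               (Kx p * partial_deriv (1, 0) \<phi> p - Kt p * partial_deriv (0, 1) \<phi> p)) = 0) \<and>
         (\<forall>x\<in>{0..l}. K (x, x) = 1 - 1 / f x) \<and>
         (\<forall>x\<in>{0..l}. K (x, -x) = 0)"
proof -
  have "\<exists>g. weak_deriv {0<..<l} 1 f g"
    using f_sobolev by auto
  then obtain g where g: "weak_deriv {0<..<l} 1 f g" ..
  interpret impedance_transform l f g e K
    by unfold_locales (fact l_pos f_cont f_nz f_0 g e_sol K_kernel K_cont)+
  show ?thesis
    using kernel_weak_equation[OF K_x K_t] goursat_condition[of 1] goursat_condition[of "-1"] by simp
qed

end
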